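(* Let $\kappa\ge 3$ and $\lambda\ge 0$ be integers with $\lambda\le\kappa-2$, let $\mathcal{G}=\big(\delta_i=(\gamma_i,\alpha_i,\beta_i)\big)_{i=1}^{g+1}$ be a $(\kappa,\lambda)$-graphical sequence, let $\Delta=(\delta_{i_p})_{p=1}^{\tau}$ be a subsequence of $\mathcal{G}$ with $(1,\lambda,\kappa-\lambda-1)$ among its terms and $(\gamma_{g+1},\alpha_{g+1},\beta_{g+1})$ not among its terms, and let $L:\{1,\dots,g+1\}\setminus\{i_1,\dots,i_\tau\}\to\mathbb{N}$ be a function. Let $\epsilon>0$ be a real number and $C>0$ a constant (depending only on $\kappa$). Then there exist positive constants $F$, depending only on $\kappa,\mathcal{G},\Delta,L$, and $H$, depending only on $\kappa,\lambda,\epsilon,\mathcal{G},\Delta,L$ (and $C$), with the following property: whenever $\ell:\{1,\dots,g+1\}\to\mathbb{N}$ is a function such that $(\mathcal{G},\Delta;L,\ell)$ is a $(\kappa,\lambda)$-quadruple and the associated tridiagonal sequence $\mathcal{T}=\mathcal{T}(\mathcal{G},\ell)$ satisfies (i) Property (AC), (ii) $D_{\mathcal{T}}\le C\,\mathtt{h}_{\mathcal{T}}$, and (iii) $D_{\mathcal{T}}-(\mathtt{h}_{\mathcal{T}}+\mathtt{t}_{\mathcal{T}})>\epsilon\,\mathtt{h}_{\mathcal{T}}$, and moreover $\ell(i_p)>F$ for all $1\le p\le\tau$, then $\mathtt{h}_{\mathcal{T}}\le H$.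
   Context: For integers $\kappa\ge3$, $0\le\lambda\le\kappa-2$, let $V_{\kappa,\lambda}=\{(\gamma,\alpha,\beta)\in\mathbb{N}_0^3:\beta,\gamma\ge1,\ \gamma+\alpha+\beta=\kappa,\ \alpha\ge\max\{\lambda+1-\beta,\lambda+1-\gamma\}\}$. A $(\kappa,\lambda)$-graphical sequence is a sequence $\mathcal{G}=((\gamma_i,\alpha_i,\beta_i))_{i=1}^{g+1}$ of pairwise distinct elements of $\mathbb{N}_0^3$ such that: $(\gamma_i,\alpha_i,\beta_i)\in V_{\kappa,\lambda}$ for $1\le i\le g$; $(\gamma_1,\alpha_1,\beta_1)=(1,\lambda,\kappa-\lambda-1)$; $\beta_i\ge\beta_{i+1}$ for $1\le i\le g-1$ and $\gamma_i\le\gamma_{i+1}$ for $1\le i\le g$; $\beta_{g+1}=0$ and $\gamma_{g+1}+\alpha_{g+1}=\kappa$. Given $\ell:\{1,\dots,g+1\}\to\mathbb{N}$ with $\ell(g+1)=1$, put $s(1)=1$, $s(i)=1+\sum_{j<i}\ell(j)$. The tridiagonal sequence $\mathcal{T}(\mathcal{G},\ell)=((c_m,a_m,b_m))_{m=1}^{s(g+1)}$ is defined by $(c_{s(i)+j},a_{s(i)+j},b_{s(i)+j})=(\gamma_i,\alpha_i,\beta_i)$ for $1\le i\le g+1$, $0\le j\le\ell(i)-1$. Its head is $\mathtt{h}_{\mathcal{T}}=\ell(1)$, its tail is $\mathtt{t}_{\mathcal{T}}=|\{\mathtt{h}_{\mathcal{T}}<i\le s(g+1):(c_i,a_i,b_i)=(\kappa-\lambda-1,\lambda,1)\}|$,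 and its diameter is $D=D_{\mathcal{T}}=s(g+1)$. Let $L_1(\mathcal{T})$ be the $(D+1)\times(D+1)$ tridiagonal matrix with rows indexed $0,\dots,D$, diagonal entries $0,a_1,\dots,a_D$, superdiagonal entries $\kappa,b_1,\dots,b_{D-1}$ and subdiagonal entries $c_1,\dots,c_D$; it has $D+1$ distinct real eigenvalues (the eigenvalues of $\mathcal{T}$). Define polynomials $v_0=1$, $v_1=x$, $xv_i=b_{i-1}v_{i-1}+a_iv_i+c_{i+1}v_{i+1}$ ($1\le i\le D-1$, with $b_0=\kappa$), put $\kappa_i=v_i(\kappa)$, and for an eigenvalue $\theta$ define its Christoffel number $m(\theta)=\big(\sum_{i=0}^D\kappa_i\big)/\big(\sum_{i=0}^Dv_i(\theta)^2/\kappa_i\big)$. Property (AC): any two eigenvalues of $\mathcal{T}$ which are algebraically conjugate over $\mathbb{Q}$ have the same Christoffel number. A $(\kappa,\lambda)$-quadruple is $(\mathcal{G},\Delta;L,\ell)$ where $\mathcal{G}$ is a $(\kappa,\lambda)$-graphical sequence, $\Delta=(\delta_{i_p})_{p=1}^\tau$ is a subsequence of $\mathcal{G}$ with $i_1=1$ and not containing the term $(\gamma_{g+1},\alpha_{g+1},\beta_{g+1})$, $\ell:\{1,\dots,g+1\}\to\mathbb{N}$ with $\ell(g+1)=1$, and $L:\{1,\dots,g+1\}\setminus\{i_1,\dots,i_\tau\}\to\mathbb{N}$ with $L(i)=\ell(i)$ for all $i$ in its domain. *)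

theory Defs
  imports Complex_Main "HOL-Computational_Algebra.Polynomial" "Jordan_Normal_Form.Char_Poly"
begin

(* Triples are written (gamma, alpha, beta).  A sequence (delta_i)_{i=1}^{g+1} is a list Gs of
   length g+1, with delta_i = Gs ! (i-1). *)

definition gdelta :: "(nat \<times> nat \<times> nat) list \<Rightarrow> nat \<Rightarrow> nat \<times> nat \<times> nat" where
  "gdelta Gs i = Gs ! (i - 1)"

definition ggam :: "(nat \<times> nat \<times> nat) list \<Rightarrow> nat \<Rightarrow> nat" where
  "ggam Gs i = fst (gdelta Gs i)"
definition galp :: "(nat \<times> nat \<times> nat) list \<Rightarrow> nat \<Rightarrow> nat" where
  "galp Gs i = fst (snd (gdelta Gs i))"
definition gbet :: "(nat \<times> nat \<times> nat) list \<Rightarrow> nat \<Rightarrow> nat" where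
  "gbet Gs i = snd (snd (gdelta Gs i))"

(* V_{kappa,lambda}; alpha >= max{lam+1-beta, lam+1-gamma} written without nat truncation *)
definition Vset :: "nat \<Rightarrow> nat \<Rightarrow> (nat \<times> nat \<times> nat) set" where
  "Vset k lam = {(c, a, b). b \<ge> 1 \<and> c \<ge> 1 \<and> c + a + b = k \<and>
                            a + b \<ge> lam + 1 \<and> a + c \<ge> lam + 1}"

definition graphical :: "nat \<Rightarrow> nat \<Rightarrow> (nat \<times> nat \<times> nat) list \<Rightarrow> bool" where
  "graphical k lam Gs \<longleftrightarrow> (let g = length Gs - 1 in
     Gs \<noteq> [] \<and> distinct Gs \<and>
     (\<forall>i\<in>{1..g}. gdelta Gs i \<in> Vset k lam) \<and>
     gdelta Gs 1 = (1, lam, k - lam - 1) \<and>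
     (\<forall>i\<in>{1..g-1}. gbet Gs i \<ge> gbet Gs (i+1)) \<and>
     (\<forall>i\<in>{1..g}. ggam Gs i \<le> ggam Gs (i+1)) \<and>
     gbet Gs (g+1) = 0 \<and> ggam Gs (g+1) + galp Gs (g+1) = k)"

definition spos :: "(nat \<Rightarrow> nat) \<Rightarrow> nat \<Rightarrow> nat" where
  "spos l i = 1 + (\<Sum>j\<in>{1..<i}. l j)"

definition diam :: "(nat \<times> nat \<times> nat) list \<Rightarrow> (nat \<Rightarrow> nat) \<Rightarrow> nat" where
  "diam Gs l = spos l (length Gs)"

(* the m-th term (c_m,a_m,b_m) of T(G,l), 1 <= m <= D: the block i with s(i) <= m < s(i)+l(i) *)
definition tri :: "(nat \<times> nat \<times> nat) list \<Rightarrow> (nat \<Rightarrow> nat) \<Rightarrow> nat \<Rightarrow> nat \<times> nat \<times> nat" where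
  "tri Gs l m = gdelta Gs (THE i. i \<in> {1..length Gs} \<and> spos l i \<le> m \<and> m < spos l i + l i)"

definition head :: "(nat \<Rightarrow> nat) \<Rightarrow> nat" where
  "head l = l 1"

definition tail :: "nat \<Rightarrow> nat \<Rightarrow> (nat \<times> nat \<times> nat) list \<Rightarrow> (nat \<Rightarrow> nat) \<Rightarrow> nat" where
  "tail k lam Gs l = card {i. head l < i \<and> i \<le> diam Gs l \<and> tri Gs l i = (k - lam - 1, lam, 1)}"

definition cT :: "(nat \<times> nat \<times> nat) list \<Rightarrow> (nat \<Rightarrow> nat) \<Rightarrow> nat \<Rightarrow> real" where
  "cT Gs l m = real (fst (tri Gs l m))"
definition aT :: "(nat \<times> nat \<times> nat) list \<Rightarrow> (nat \<Rightarrow> nat) \<Rightarrow> nat \<Rightarrow> real" where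
  "aT Gs l m = (if m = 0 then 0 else real (fst (snd (tri Gs l m))))"
definition bT :: "nat \<Rightarrow> (nat \<times> nat \<times> nat) list \<Rightarrow> (nat \<Rightarrow> nat) \<Rightarrow> nat \<Rightarrow> real" where
  "bT k Gs l m = (if m = 0 then real k else real (snd (snd (tri Gs l m))))"

definition L1 :: "nat \<Rightarrow> (nat \<times> nat \<times> nat) list \<Rightarrow> (nat \<Rightarrow> nat) \<Rightarrow> real mat" where
  "L1 k Gs l = mat (diam Gs l + 1) (diam Gs l + 1)
     (\<lambda>(i, j). if j = i then aT Gs l i
               else if j = i + 1 then bT k Gs l i
               else if i = j + 1 then cT Gs l i else 0)"

definition eigT :: "nat \<Rightarrow> (nat \<times> nat \<times> nat) list \<Rightarrow> (nat \<Rightarrow> nat) \<Rightarrow> real \<Rightarrow> bool" where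
  "eigT k Gs l \<theta> = eigenvalue (L1 k Gs l) \<theta>"

(* v_0 = 1, v_1 = x, x v_i = b_{i-1} v_{i-1} + a_i v_i + c_{i+1} v_{i+1} (evaluated at x) *)
fun vrec :: "(nat \<Rightarrow> real) \<Rightarrow> (nat \<Rightarrow> real) \<Rightarrow> (nat \<Rightarrow> real) \<Rightarrow> real \<Rightarrow> nat \<Rightarrow> real" where
  "vrec c a b x 0 = 1"
| "vrec c a b x (Suc 0) = x"
| "vrec c a b x (Suc (Suc i)) =
     ((x - a (Suc i)) * vrec c a b x (Suc i) - b i * vrec c a b x i) / c (Suc (Suc i))"

definition vT :: "nat \<Rightarrow> (nat \<times> nat \<times> nat) list \<Rightarrow> (nat \<Rightarrow> nat) \<Rightarrow> real \<Rightarrow> nat \<Rightarrow> real" where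
  "vT k Gs l x i = vrec (cT Gs l) (aT Gs l) (bT k Gs l) x i"

definition christoffel :: "nat \<Rightarrow> (nat \<times> nat \<times> nat) list \<Rightarrow> (nat \<Rightarrow> nat) \<Rightarrow> real \<Rightarrow> real" where
  "christoffel k Gs l \<theta> =
     (\<Sum>i\<in>{0..diam Gs l}. vT k Gs l (real k) i) /
     (\<Sum>i\<in>{0..diam Gs l}. (vT k Gs l \<theta> i)^2 / vT k Gs l (real k) i)"

definition alg_conj :: "real \<Rightarrow> real \<Rightarrow> bool" where
  "alg_conj x y \<longleftrightarrow> (\<exists>p :: rat poly. irreducible p \<and>
      poly (map_poly of_rat p) x = 0 \<and> poly (map_poly of_rat p) y = 0)"

definition propAC :: "nat \<Rightarrow> (nat \<times> nat \<times> nat) list \<Rightarrow> (nat \<Rightarrow> nat) \<Rightarrow> bool" where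
  "propAC k Gs l \<longleftrightarrow> (\<forall>\<theta> \<theta>'. eigT k Gs l \<theta> \<and> eigT k Gs l \<theta>' \<and> alg_conj \<theta> \<theta>' \<longrightarrow>
       christoffel k Gs l \<theta> = christoffel k Gs l \<theta>')"

(* (kappa,lambda)-quadruple (G, Delta; L, l).  Delta is represented by its index set Is
   (the subsequence is determined by its indices since G has distinct terms). *)
definition quadruple :: "nat \<Rightarrow> nat \<Rightarrow> (nat \<times> nat \<times> nat) list \<Rightarrow> nat set \<Rightarrow> (nat \<Rightarrow> nat) \<Rightarrow> (nat \<Rightarrow> nat) \<Rightarrow> bool" where
  "quadruple k lam Gs Is L l \<longleftrightarrow>
     graphical k lam Gs \<and> Is \<subseteq> {1..length Gs - 1} \<and> 1 \<in> Is \<and>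
     (\<forall>i\<in>{1..length Gs}. l i \<ge> 1) \<and> l (length Gs) = 1 \<and>
     (\<forall>i\<in>{1..length Gs} - Is. L i \<ge> 1 \<and> L i = l i)"

end

theory Submission
  imports Defs "HOL-Computational_Algebra.Fundamental_Theorem_Algebra"
    "Berlekamp_Zassenhaus.Factor_Bound"
begin

text \<open>Write \<open>u\<close> for the orthonormal polynomials of the symmetrised tridiagonal matrix and
  \<open>K(x) = \<Sum>u\<^sub>i(x)\<^sup>2\<close>; the Christoffel number of an eigenvalue \<open>x\<close> is a constant divided by \<open>K(x)\<close>.
  A block \<open>(\<gamma>, \<alpha>, \<beta>)\<close> has a guide interval with right end
  \<open>\<kappa> - (\<surd>\<beta> - \<surd>\<gamma>)\<^sup>2\<close>, which is unimodal in the block index and smallest exactly at head and tail. Let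
  \<open>M\<close> be the largest right end over the long blocks and \<open>J\<close> a short interval just below \<open>M\<close>. Truncated
  Chebyshev waves in a long block attaining \<open>M\<close> show that \<open>J\<close> contains a number of eigenvalues linear
  in the head. On \<open>J\<close>, all long blocks before those attaining \<open>M\<close> force growth of \<open>u\<close> at a rate strictly
  increasing in \<open>x\<close>, and all later ones force decay of an eigenvector, so equality of \<open>K\<close> at two conjugate
  eigenvalues in \<open>J\<close> forces them to be extremely close. But the discriminant of an irreducible
  integer polynomial is a nonzero integer, so only a small proportion of the conjugates of an
  algebraic integer can lie so close together, and there are only finitely many of small degree. Hence
  \<open>J\<close> contains too few eigenvalues once the head is large.\<close>

hide_const (open) Module.smult up_ring.coeff up_ring.monom

section \<open>Jacobi matrices and their orthogonal polynomials\<close>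

text \<open>The obstacle is that blocks occur at every scale relative to the head
  \<open>h = l 1\<close>. Across a block to which no guide interval argument is applied,
  \<open>u\<close> is controlled only by a factor \<open>(2 * k + 1) ^ length\<close>, so such a
  block must have length at most \<open>\<nu> * h\<close> with \<open>\<nu>\<close> tiny. How tiny
  is dictated by the closeness \<open>\<eta>\<close> that the discriminant argument needs,
  \<open>\<eta>\<close> by the sparsity \<open>N\<close> that is wanted, and \<open>N\<close> by the
  share \<open>\<mu>\<close> of the head from which a block counts as long. So \<open>\<nu>\<close>
  depends on \<open>\<mu>\<close>, and blocks of intermediate length would spoil any fixed choice.
  Iterating \<open>\<mu>\<close>, \<open>min \<mu> (\<nu> \<mu>)\<close>, ... gives one more gap
  between thresholds than there are blocks, and some gap contains no block. The interval just below
  \<open>M\<close> is kept at depth between \<open>\<delta>\<close> and \<open>2 * \<delta>\<close>.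
  Depth at least \<open>\<delta>\<close> bounds solutions in blocks attaining \<open>M\<close>
  independently of their length; depth at most \<open>2 * \<delta>\<close>, the minimal gap between
  distinct right ends, leaves the interval at or above the right ends of all other long blocks. One
  \<open>\<delta>\<close> serves all pairs of blocks, so no constant depends on
  \<open>l\<close>.\<close>

fun ju :: "(nat \<Rightarrow> real) \<Rightarrow> (nat \<Rightarrow> real) \<Rightarrow> 'a::real_field \<Rightarrow> nat \<Rightarrow> 'a" where
  "ju a s x 0 = 1"
| "ju a s x (Suc 0) = (x - of_real (a 0)) / of_real (s 0)"
| "ju a s x (Suc (Suc i)) =
     ((x - of_real (a (Suc i))) * ju a s x (Suc i) - of_real (s i) * ju a s x i) / of_real (s (Suc i))"

text \<open>Coefficient form of \<open>ju\<close>, needed for degrees and derivatives.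
  \<open>ju\<close> itself is polymorphic so that the same recurrence can be evaluated at complex
  points.\<close>

fun jp :: "(nat \<Rightarrow> real) \<Rightarrow> (nat \<Rightarrow> real) \<Rightarrow> nat \<Rightarrow> real poly" where
  "jp a s 0 = 1"
| "jp a s (Suc 0) = smult (1 / s 0) [:- a 0, 1:]"
| "jp a s (Suc (Suc i)) =
     smult (1 / s (Suc i)) ([:- a (Suc i), 1:] * jp a s (Suc i) - smult (s i) (jp a s i))"

definition jK :: "(nat \<Rightarrow> real) \<Rightarrow> (nat \<Rightarrow> real) \<Rightarrow> nat \<Rightarrow> real \<Rightarrow> real" where
  "jK a s D x = (\<Sum>i\<le>D. (ju a s x i)\<^sup>2)"

locale jacobi =
  fixes a s :: "nat \<Rightarrow> real"
  assumes s_pos: "s i > 0"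
begin

lemma s_nz [simp]: "s i \<noteq> 0"
  using s_pos[of i] by simp

lemma ju_0_rec: "of_real (s 0) * ju a s x (Suc 0) = x - (of_real (a 0) :: 'a::real_field)"
  by simp

lemma ju_rec:
  "of_real (s (Suc i)) * ju a s x (Suc (Suc i)) =
     (x - of_real (a (Suc i))) * ju a s x (Suc i) - of_real (s i) * (ju a s x i :: 'a::real_field)"
  by simp

lemma poly_jp: "poly (jp a s n) x = ju a s x n"
  by (induction n rule: induct_nat_012) (auto simp: divide_simps algebra_simps)

lemma poly_jp_complex: "poly (map_poly complex_of_real (jp a s n)) x = ju a s x n"
proof (induction n rule: induct_nat_012)
  case (ge2 n)
  have *: "map_poly complex_of_real (jp a s (Suc (Suc n))) = smult (of_real (1 / s (Suc n)))
     ([:- of_real (a (Suc n)), 1:] * map_poly of_real (jp a s (Suc n))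
       - smult (of_real (s n)) (map_poly of_real (jp a s n)))"
    by (rule poly_eqI) (simp add: coeff_map_poly coeff_pCons split: nat.split)
  show ?case unfolding * by (simp add: ge2 algebra_simps diff_divide_distrib add_divide_distrib)
next
  case 1
  have *: "map_poly complex_of_real (jp a s (Suc 0)) = smult (of_real (1 / s 0)) [:- of_real (a 0), 1:]"
    by (rule poly_eqI) (simp add: coeff_map_poly coeff_pCons split: nat.split)
  show ?case unfolding * by (simp add: diff_divide_distrib)
qed simp

lemma jp_degree_le: "degree (jp a s n) \<le> n \<and> coeff (jp a s n) n > 0"
proof (induction n rule: induct_nat_012)
  case (ge2 n)
  have z: "coeff (jp a s m) i = 0" if "degree (jp a s m) \<le> m" "i > m" for m i
    using that by (simp add: coeff_eq_0)
  have "degree (jp a s (Suc (Suc n))) \<le> Suc (Suc n)"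
    by (rule degree_le) (use ge2 in \<open>auto simp: coeff_pCons z split: nat.split\<close>)
  thus ?case using ge2 s_pos[of "Suc n"] by (simp add: z)
qed (use s_pos[of 0] in auto)

lemma jp_degree: "degree (jp a s n) = n"
  using jp_degree_le[of n] by (intro antisym le_degree) auto

lemma jp_nonzero: "jp a s n \<noteq> 0"
  using jp_degree_le[of n] by auto

text \<open>The bracket is the Casoratian of the solutions at \<open>x\<close> and \<open>y\<close>;
  by the recurrence, \<open>s n\<close> times it grows by \<open>(x - y) * u * v\<close> at each
  step. Stating it over \<open>real_field\<close> allows \<open>y = cnj x\<close> later.\<close>

lemma christoffel_darboux:
  fixes x y :: "'a::real_field"
  shows "(x - y) * (\<Sum>i\<le>n. ju a s x i * ju a s y i) =
     of_real (s n) * (ju a s x (Suc n) * ju a s y n - ju a s x n * ju a s y (Suc n))"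
proof (induction n)
  case 0
  show ?case by (simp add: field_simps)
next
  case (Suc n)
  let ?u = "ju a s x" and ?v = "ju a s y"
  have "(x - y) * (\<Sum>i\<le>Suc n. ?u i * ?v i) =
    of_real (s n) * (?u (Suc n) * ?v n - ?u n * ?v (Suc n)) + (x - y) * (?u (Suc n) * ?v (Suc n))"
    using Suc by (simp add: distrib_left)
  also have "\<dots> = (of_real (s (Suc n)) * ?u (Suc (Suc n))) * ?v (Suc n)
      - ?u (Suc n) * (of_real (s (Suc n)) * ?v (Suc (Suc n)))"
    unfolding ju_rec by (simp add: algebra_simps)
  finally show ?case by (simp add: algebra_simps del: ju.simps)
qed

text \<open>The limit of \<open>christoffel_darboux\<close> as \<open>y\<close> tends to
  \<open>x\<close>. The left side is at least 1, so \<open>u\<close> of index \<open>n + 1\<close>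
  has only simple zeros and shares none with \<open>u\<close> of index \<open>n\<close>.\<close>

lemma christoffel_darboux_confluent:
  "(\<Sum>i\<le>n. (ju a s x i)\<^sup>2) =
     s n * (poly (pderiv (jp a s (Suc n))) x * ju a s x n - poly (pderiv (jp a s n)) x * ju a s x (Suc n))"
proof (induction n)
  case 0
  show ?case by (simp add: pderiv_smult pderiv_pCons)
next
  case (Suc n)
  let ?u = "ju a s x" and ?d = "\<lambda>i. poly (pderiv (jp a s i)) x"
  have d: "s (Suc n) * ?d (Suc (Suc n)) = ?u (Suc n) + (x - a (Suc n)) * ?d (Suc n) - s n * ?d n"
    by (simp add: pderiv_smult pderiv_diff pderiv_add pderiv_mult pderiv_pCons poly_jp algebra_simps)
  have u: "s (Suc n) * ?u (Suc (Suc n)) = (x - a (Suc n)) * ?u (Suc n) - s n * ?u n"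
    using ju_rec[of n x] by simp
  have "s (Suc n) * (?d (Suc (Suc n)) * ?u (Suc n) - ?d (Suc n) * ?u (Suc (Suc n))) =
     (s (Suc n) * ?d (Suc (Suc n))) * ?u (Suc n) - ?d (Suc n) * (s (Suc n) * ?u (Suc (Suc n)))"
    by (simp add: algebra_simps del: ju.simps jp.simps)
  also have "\<dots> = (?u (Suc n))\<^sup>2 + s n * (?d (Suc n) * ?u n - ?d n * ?u (Suc n))"
    unfolding d u by (simp add: algebra_simps power2_eq_square del: ju.simps jp.simps)
  also have "\<dots> = (\<Sum>i\<le>Suc n. (?u i)\<^sup>2)"
    using Suc by simp
  finally show ?case ..
qed

lemma jK_pos: "jK a s D x > 0"
proof -
  have "(ju a s x 0)\<^sup>2 \<le> jK a s D x"
    unfolding jK_def by (rule member_le_sum) auto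
  thus ?thesis by simp
qed

lemma ju_cnj: "ju a s (cnj z) n = cnj (ju a s z n)"
  by (induction n rule: induct_nat_012) auto

lemma ju_complex_of_real: "ju a s (complex_of_real x) n = of_real (ju a s x n)"
  by (induction n rule: induct_nat_012) auto

text \<open>Christoffel-Darboux at \<open>z\<close> and \<open>cnj z\<close>: the boundary term
  vanishes because \<open>cnj z\<close> is a root as well, while the sum becomes a sum of squared
  moduli that contains a 1.\<close>

lemma complex_root_real:
  fixes z :: complex
  assumes "ju a s z (Suc D) = 0"
  shows "z \<in> \<real>"
proof -
  have "(z - cnj z) * (\<Sum>i\<le>D. ju a s z i * ju a s (cnj z) i) = 0"
    using assms by (subst christoffel_darboux) (simp add: ju_cnj del: ju.simps)
  moreover have "(\<Sum>i\<le>D. ju a s z i * ju a s (cnj z) i) = of_real (\<Sum>i\<le>D. (cmod (ju a s z i))\<^sup>2)"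
    by (simp only: ju_cnj complex_norm_square of_real_sum)
  moreover have "(\<Sum>i\<le>D. (cmod (ju a s z i))\<^sup>2) > 0"
    by (rule sum_pos2[of _ 0]) auto
  ultimately have "(z - cnj z) * of_real (\<Sum>i\<le>D. (cmod (ju a s z i))\<^sup>2) = 0"
    and "complex_of_real (\<Sum>i\<le>D. (cmod (ju a s z i))\<^sup>2) \<noteq> 0"
    by (metis, metis of_real_eq_0_iff less_irrefl)
  hence "z = cnj z" by (simp del: of_real_sum)
  thus ?thesis by (simp add: Reals_cnj_iff)
qed

text \<open>Closing the recurrence with \<open>u = 0\<close> at index \<open>D + 1\<close> is the
  eigenvalue equation of the Jacobi matrix of order \<open>D + 1\<close>; the value
  \<open>s D\<close> only scales that condition.\<close>

definition spec :: "nat \<Rightarrow> real set" where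
  "spec D = {x. ju a s x (Suc D) = 0}"

lemma finite_spec: "finite (spec D)"
  using poly_roots_finite[OF jp_nonzero[of "Suc D"]] unfolding spec_def poly_jp .

text \<open>No root is lost on passing from the complex polynomial of degree \<open>D + 1\<close> to
  its real zeros: all roots are real by \<open>complex_root_real\<close> and simple by the confluent
  identity.\<close>

lemma card_spec: "card (spec D) = Suc D"
proof -
  define P where "P = map_poly complex_of_real (jp a s (Suc D))"
  have degP: "degree P = Suc D"
    unfolding P_def using jp_degree[of "Suc D"] by (simp add: degree_map_poly)
  have roots: "{z. poly P z = 0} = complex_of_real ` spec D"
  proof -
    have "z \<in> complex_of_real ` spec D" if "poly P z = 0" for z
    proof -
      from that have *: "ju a s z (Suc D) = 0" unfolding P_def poly_jp_complex .
      then obtain x where x: "z = of_real x"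
        using complex_root_real[OF *] by (auto elim: Reals_cases)
      have "ju a s x (Suc D) = 0"
        using * unfolding x ju_complex_of_real by (simp only: of_real_eq_0_iff)
      thus ?thesis unfolding x spec_def by blast
    qed
    moreover have "poly P (of_real x) = 0" if "x \<in> spec D" for x
      using that unfolding P_def poly_jp_complex ju_complex_of_real spec_def by simp
    ultimately show ?thesis by auto
  qed
  have "rsquarefree P"
    unfolding rsquarefree_roots
  proof (intro allI notI)
    fix z assume z: "poly P z = 0 \<and> poly (pderiv P) z = 0"
    then obtain x where x: "z = of_real x" "x \<in> spec D" using roots by auto
    have "poly (pderiv P) z = of_real (poly (pderiv (jp a s (Suc D))) x)"
      unfolding P_def x by (simp add: of_real_hom.map_poly_pderiv[symmetric])
    hence 0: "poly (pderiv (jp a s (Suc D))) x = 0" using z by simp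
    have "jK a s D x = 0"
      unfolding jK_def christoffel_darboux_confluent using 0 x(2) by (simp add: spec_def del: ju.simps jp.simps)
    thus False using jK_pos[of D x] by simp
  qed
  hence "smult (lead_coeff P) (\<Prod>z|poly P z = 0. [:-z, 1:]) = P"
    by (rule complex_poly_decompose_rsquarefree)
  hence "degree P = degree (\<Prod>z|poly P z = 0. [:-z, 1:])"
    using degP by (metis degree_0 degree_smult_eq nat.simps(3) smult_eq_0_iff)
  also have "\<dots> = card {z. poly P z = 0}"
    by (subst degree_prod_eq_sum_degree) auto
  also have "\<dots> = card (spec D)"
    unfolding roots by (rule card_image) (auto simp: inj_on_def)
  finally show ?thesis using degP by simp
qed

lemma ju_orthogonal:
  assumes "x \<in> spec D" "y \<in> spec D" "x \<noteq> y"
  shows "(\<Sum>i\<le>D. ju a s x i * ju a s y i) = 0"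
proof -
  have "(x - y) * (\<Sum>i\<le>D. ju a s x i * ju a s y i) = 0"
    using christoffel_darboux[of x y D] assms unfolding spec_def by (simp del: ju.simps)
  thus ?thesis using assms(3) by simp
qed

text \<open>The rows of \<open>Q\<close> are the normalised eigenvectors. A one-sided inverse of a
  square matrix is two-sided, so the columns are orthonormal too; this is Gauss quadrature with
  weights \<open>1 / jK\<close>.\<close>

lemma ju_dual_orthogonal:
  assumes "i \<le> D" "j \<le> D"
  shows "(\<Sum>x\<in>spec D. ju a s x i * ju a s x j / jK a s D x) = (if i = j then 1 else 0)"
proof -
  obtain e where e: "bij_betw e {0..<Suc D} (spec D)"
    using ex_bij_betw_nat_finite[OF finite_spec[of D]] card_spec by metis
  define Q where "Q = mat (Suc D) (Suc D) (\<lambda>(r, i). ju a s (e r) i / sqrt (jK a s D (e r)))"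
  have Q: "Q \<in> carrier_mat (Suc D) (Suc D)" unfolding Q_def by simp
  have sqK: "sqrt (jK a s D x) * sqrt (jK a s D x) = jK a s D x" for x
    using jK_pos[of D x] by simp
  have "Q * transpose_mat Q = 1\<^sub>m (Suc D)"
  proof (rule eq_matI)
    fix r t assume rt: "r < dim_row (1\<^sub>m (Suc D))" "t < dim_col (1\<^sub>m (Suc D))"
    have "(Q * transpose_mat Q) $$ (r, t) =
      (\<Sum>i = 0..<Suc D. ju a s (e r) i / sqrt (jK a s D (e r)) * (ju a s (e t) i / sqrt (jK a s D (e t))))"
      using rt unfolding Q_def by (simp add: scalar_prod_def del: ju.simps)
    also have "\<dots> = (\<Sum>i\<le>D. ju a s (e r) i * ju a s (e t) i) / (sqrt (jK a s D (e r)) * sqrt (jK a s D (e t)))"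
      unfolding sum_divide_distrib by (intro sum.cong) auto
    also have "\<dots> = 1\<^sub>m (Suc D) $$ (r, t)"
    proof (cases "r = t")
      case True
      thus ?thesis using rt jK_pos[of D "e t"] unfolding sqK True
        by (simp add: jK_def power2_eq_square del: ju.simps)
    next
      case False
      hence "e r \<noteq> e t" "e r \<in> spec D" "e t \<in> spec D"
        using e rt by (auto simp: bij_betw_def inj_on_def)
      thus ?thesis using ju_orthogonal rt False by simp
    qed
    finally show "(Q * transpose_mat Q) $$ (r, t) = 1\<^sub>m (Suc D) $$ (r, t)" .
  qed (auto simp: Q_def)
  hence "transpose_mat Q * Q = 1\<^sub>m (Suc D)"
    using mat_mult_left_right_inverse[OF Q, of "transpose_mat Q"] Q by simp
  hence "(transpose_mat Q * Q) $$ (i, j) = (if i = j then 1 else 0)"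
    using assms by simp
  moreover have "(transpose_mat Q * Q) $$ (i, j) =
     (\<Sum>r = 0..<Suc D. ju a s (e r) i / sqrt (jK a s D (e r)) * (ju a s (e r) j / sqrt (jK a s D (e r))))"
    using assms unfolding Q_def by (simp add: scalar_prod_def del: ju.simps)
  also have "\<dots> = (\<Sum>r = 0..<Suc D. ju a s (e r) i * ju a s (e r) j / jK a s D (e r))"
    by (simp add: sqK del: ju.simps sum.op_ivl_Suc real_sqrt_mult_self)
  also have "\<dots> = (\<Sum>x\<in>spec D. ju a s x i * ju a s x j / jK a s D x)"
    using sum.reindex_bij_betw[OF e] by fast
  finally show ?thesis by simp
qed

text \<open>The spectral transform: the pairing of a finite sequence with the unnormalised
  eigenvector. With weights \<open>1 / jK\<close> it is an isometry, which is
  \<open>parseval\<close>.\<close>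

definition jF :: "nat \<Rightarrow> (nat \<Rightarrow> real) \<Rightarrow> real \<Rightarrow> real" where
  "jF D f x = (\<Sum>i\<le>D. f i * ju a s x i)"

lemma parseval: "(\<Sum>x\<in>spec D. (jF D f x)\<^sup>2 / jK a s D x) = (\<Sum>i\<le>D. (f i)\<^sup>2)"
proof -
  have "(jF D f x)\<^sup>2 / jK a s D x =
      (\<Sum>i\<le>D. \<Sum>j\<le>D. f i * f j * (ju a s x i * ju a s x j / jK a s D x))" for x
    unfolding jF_def power2_eq_square sum_product sum_divide_distrib
    by (intro sum.cong) (auto simp: algebra_simps)
  hence "(\<Sum>x\<in>spec D. (jF D f x)\<^sup>2 / jK a s D x) =
      (\<Sum>x\<in>spec D. \<Sum>i\<le>D. \<Sum>j\<le>D. f i * f j * (ju a s x i * ju a s x j / jK a s D x))"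
    by simp
  also have "\<dots> = (\<Sum>i\<le>D. \<Sum>x\<in>spec D. \<Sum>j\<le>D. f i * f j * (ju a s x i * ju a s x j / jK a s D x))"
    by (rule sum.swap)
  also have "\<dots> = (\<Sum>i\<le>D. \<Sum>j\<le>D. \<Sum>x\<in>spec D. f i * f j * (ju a s x i * ju a s x j / jK a s D x))"
    by (intro sum.cong refl, rule sum.swap)
  also have "\<dots> = (\<Sum>i\<le>D. \<Sum>j\<le>D. f i * f j * (if i = j then 1 else 0))"
    by (intro sum.cong refl) (simp only: sum_distrib_left[symmetric] ju_dual_orthogonal atMost_iff)
  also have "\<dots> = (\<Sum>i\<le>D. (f i)\<^sup>2)"
    by (simp add: if_distrib power2_eq_square cong: if_cong)
  finally show ?thesis .
qed

end

section \<open>Constant-coefficient recurrences, Chebyshev waves and spectral mass\<close>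

lemma sum_mult_sq_le:
  fixes f g :: "'i \<Rightarrow> real"
  shows "(\<Sum>i\<in>A. f i * g i)\<^sup>2 \<le> (\<Sum>i\<in>A. (f i)\<^sup>2) * (\<Sum>i\<in>A. (g i)\<^sup>2)"
proof -
  have "0 \<le> (\<Sum>i\<in>A. \<Sum>j\<in>A. (f i * g j - f j * g i)\<^sup>2)"
    by (intro sum_nonneg) auto
  also have "\<dots> = (\<Sum>i\<in>A. \<Sum>j\<in>A. (f i)\<^sup>2 * (g j)\<^sup>2 + (g i)\<^sup>2 * (f j)\<^sup>2 - 2 * ((f i * g i) * (f j * g j)))"
    by (intro sum.cong) (auto simp: power2_eq_square algebra_simps)
  also have "\<dots> = 2 * ((\<Sum>i\<in>A. (f i)\<^sup>2) * (\<Sum>i\<in>A. (g i)\<^sup>2)) - 2 * (\<Sum>i\<in>A. f i * g i)\<^sup>2"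
    by (simp add: sum.distrib sum_subtractf sum_product[symmetric] sum_distrib_left[symmetric]
      sum_distrib_right[symmetric] power2_eq_square[of "\<Sum>i\<in>A. f i * g i"] del: mult_minus_right)
  finally show ?thesis by simp
qed

text \<open>\<open>cheb \<xi> n\<close> is the Chebyshev polynomial of the second kind of degree
  \<open>n - 1\<close> at \<open>\<xi> / 2\<close>, that is \<open>sin (n * t) / sin t\<close> for
  \<open>\<xi> = 2 * cos t\<close>. The value 0 at index 0 lets the wave start inside a
  window.\<close>

fun cheb :: "real \<Rightarrow> nat \<Rightarrow> real" where
  "cheb \<xi> 0 = 0"
| "cheb \<xi> (Suc 0) = 1"
| "cheb \<xi> (Suc (Suc n)) = \<xi> * cheb \<xi> (Suc n) - cheb \<xi> n"

text \<open>The quadratic form is invariant under the step \<open>(x, y)\<close> to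
  \<open>(y, \<xi> * y - x)\<close>. It is positive definite for
  \<open>\<bar>\<xi>\<bar> < 2\<close>, which controls solutions without trigonometry.\<close>

lemma energy_const:
  fixes f :: "nat \<Rightarrow> real"
  assumes "\<And>j. p \<le> j \<Longrightarrow> j + 2 \<le> q \<Longrightarrow> f (j + 2) = \<xi> * f (j + 1) - f j"
    and "p \<le> m" "m + 1 \<le> q"
  shows "(f m)\<^sup>2 - \<xi> * f m * f (m + 1) + (f (m + 1))\<^sup>2 = (f p)\<^sup>2 - \<xi> * f p * f (p + 1) + (f (p + 1))\<^sup>2"
  using assms(2,3)
proof (induction m rule: dec_induct)
  case (step n)
  have f: "f (Suc n + 1) = \<xi> * f (Suc n) - f n" using step assms(1)[of n] by simp
  have "(f (Suc n))\<^sup>2 - \<xi> * f (Suc n) * f (Suc n + 1) + (f (Suc n + 1))\<^sup>2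
      = (f n)\<^sup>2 - \<xi> * f n * f (n + 1) + (f (n + 1))\<^sup>2"
    unfolding f by (simp add: power2_eq_square algebra_simps)
  thus ?case using step by simp
qed simp

text \<open>The form has eigenvalues \<open>1 - \<xi> / 2\<close> and \<open>1 + \<xi> / 2\<close>;
  the first is at least \<open>\<omega>\<close>, the second at most 2.\<close>

lemma energy_bounds:
  fixes x y \<xi> :: real
  assumes "0 \<le> \<xi>" "\<xi> \<le> 2 - 2 * \<omega>"
  shows "\<omega> * (x\<^sup>2 + y\<^sup>2) \<le> x\<^sup>2 - \<xi> * x * y + y\<^sup>2"
    and "\<omega> \<ge> 0 \<Longrightarrow> x\<^sup>2 - \<xi> * x * y + y\<^sup>2 \<le> 2 * (x\<^sup>2 + y\<^sup>2)"
proof -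
  have "0 \<le> \<xi> / 2 * (x - y)\<^sup>2" "0 \<le> \<xi> / 2 * (x + y)\<^sup>2" using assms by auto
  hence 1: "\<xi> * x * y \<le> \<xi> / 2 * (x\<^sup>2 + y\<^sup>2)" "- (\<xi> * x * y) \<le> \<xi> / 2 * (x\<^sup>2 + y\<^sup>2)"
    by (simp_all add: power2_eq_square algebra_simps)
  have "\<xi> / 2 * (x\<^sup>2 + y\<^sup>2) \<le> (1 - \<omega>) * (x\<^sup>2 + y\<^sup>2)"
    using assms by (intro mult_right_mono) auto
  hence 2: "\<xi> * x * y \<le> (1 - \<omega>) * (x\<^sup>2 + y\<^sup>2)" "- (\<xi> * x * y) \<le> (1 - \<omega>) * (x\<^sup>2 + y\<^sup>2)"
    using 1 by linarith+
  show "\<omega> * (x\<^sup>2 + y\<^sup>2) \<le> x\<^sup>2 - \<xi> * x * y + y\<^sup>2"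
    using 2(1) by (simp add: algebra_simps)
  show "x\<^sup>2 - \<xi> * x * y + y\<^sup>2 \<le> 2 * (x\<^sup>2 + y\<^sup>2)" if "\<omega> \<ge> 0"
  proof -
    have "(1 - \<omega>) * (x\<^sup>2 + y\<^sup>2) \<le> 1 * (x\<^sup>2 + y\<^sup>2)"
      using that by (intro mult_right_mono) auto
    hence "- (\<xi> * x * y) \<le> x\<^sup>2 + y\<^sup>2" using 2(2) by simp
    thus ?thesis by simp
  qed
qed

lemma cheb_energy: "(cheb \<xi> m)\<^sup>2 - \<xi> * cheb \<xi> m * cheb \<xi> (m + 1) + (cheb \<xi> (m + 1))\<^sup>2 = 1"
  using energy_const[of 0 "m + 1" "cheb \<xi>" \<xi> m] by simp

lemma cheb_sq_le:
  assumes "0 \<le> \<xi>" "\<xi> \<le> 2 - 2 * \<omega>" "\<omega> > 0"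
  shows "(cheb \<xi> m)\<^sup>2 \<le> 1 / \<omega>"
proof -
  have "\<omega> * ((cheb \<xi> m)\<^sup>2 + (cheb \<xi> (m + 1))\<^sup>2) \<le> 1"
    using energy_bounds(1)[OF assms(1,2)] cheb_energy by metis
  moreover have "\<omega> * (cheb \<xi> m)\<^sup>2 \<le> \<omega> * ((cheb \<xi> m)\<^sup>2 + (cheb \<xi> (m + 1))\<^sup>2)"
    using assms by (intro mult_left_mono) auto
  ultimately have "\<omega> * (cheb \<xi> m)\<^sup>2 \<le> 1" by linarith
  thus ?thesis using assms(3) by (simp add: pos_le_divide_eq mult.commute)
qed

text \<open>Any two consecutive values have energy 1, so their squares sum to at least 1/2; the
  range is cut into \<open>n\<close> such pairs.\<close>

lemma cheb_sum_sq_ge: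
  assumes "0 \<le> \<xi>" "\<xi> \<le> 2"
  shows "real n / 2 \<le> (\<Sum>j = 1..2 * n. (cheb \<xi> j)\<^sup>2)"
proof (induction n)
  case (Suc n)
  have "1 \<le> 2 * ((cheb \<xi> (2 * n + 1))\<^sup>2 + (cheb \<xi> (2 * n + 1 + 1))\<^sup>2)"
    using energy_bounds(2)[of \<xi> 0] assms cheb_energy by (metis diff_zero mult_zero_right order_refl)
  moreover have "(\<Sum>j = 1..2 * Suc n. (cheb \<xi> j)\<^sup>2) =
     (\<Sum>j = 1..2 * n. (cheb \<xi> j)\<^sup>2) + (cheb \<xi> (2 * n + 1))\<^sup>2 + (cheb \<xi> (2 * n + 1 + 1))\<^sup>2"
    by simp
  ultimately show ?case using Suc by simp
qed simp

text \<open>Discrete Green identity: the difference operator is moved from \<open>w\<close> onto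
  \<open>cheb\<close>, which it annihilates, so only boundary terms survive. At the left end they
  are \<open>w 0\<close> alone, as \<open>cheb\<close> is 0 and then 1 there.\<close>

lemma cheb_summation_by_parts:
  fixes w :: "nat \<Rightarrow> real"
  shows "(\<Sum>j = 1..K. cheb \<xi> j * (w (j - 1) - \<xi> * w j + w (j + 1))) =
     w 0 - cheb \<xi> (K + 1) * w K + cheb \<xi> K * w (K + 1)"
proof (induction K)
  case (Suc K)
  have "(\<Sum>j = 1..Suc K. cheb \<xi> j * (w (j - 1) - \<xi> * w j + w (j + 1))) =
    w 0 - cheb \<xi> (K + 1) * w K + cheb \<xi> K * w (K + 1)
      + cheb \<xi> (K + 1) * (w K - \<xi> * w (K + 1) + w (K + 2))"
    using Suc by simp
  also have "\<dots> = w 0 - cheb \<xi> (K + 2) * w (K + 1) + cheb \<xi> (K + 1) * w (K + 2)"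
    by (simp add: algebra_simps)
  finally show ?case by simp
qed simp

context jacobi
begin

text \<open>A truncated Chebyshev wave is an approximate eigenvector for \<open>\<theta>\<close> supported in one window of
  constant coefficients, so a fixed share of its spectral mass lies close to \<open>\<theta>\<close>.\<close>

lemma window_mass:
  assumes const: "\<And>m. p < m \<Longrightarrow> m \<le> p + K \<Longrightarrow> a m = \<alpha>" "\<And>m. p \<le> m \<Longrightarrow> m \<le> p + K \<Longrightarrow> s m = \<sigma>"
    and D: "p + K + 1 \<le> D" and K: "K = 2 * n"
    and \<theta>: "\<theta> = \<alpha> + \<xi> * \<sigma>" and \<xi>: "0 \<le> \<xi>" "\<xi> \<le> 2 - 2 * \<omega>" and \<omega>: "\<omega> > 0" "\<omega> \<le> 1" and \<delta>: "\<delta> > 0"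
    and n: "real n * \<omega> * \<delta>\<^sup>2 \<ge> 12 * \<sigma>\<^sup>2"
  shows "(\<Sum>x\<in>{x \<in> spec D. \<bar>x - \<theta>\<bar> \<le> \<delta>}. (\<Sum>i = p..p + K + 1. (ju a s x i)\<^sup>2) / jK a s D x) \<ge> 1 / 2"
proof -
  define u where "u x i = ju a s x i" for x :: real and i
  define f where "f i = (if p < i \<and> i \<le> p + K then cheb \<xi> (i - p) else 0)" for i
  \<comment> \<open>The residual of \<open>f\<close> under the Jacobi matrix minus
    \<open>\<theta>\<close>. Inside the window the wave solves the equation exactly, so the residual
    lives at the three indices where the truncation is felt.\<close>
  define r where "r i = (if i = p then \<sigma> else 0) + (if i = p + K then - \<sigma> * cheb \<xi> (K + 1) else 0)
     + (if i = p + K + 1 then \<sigma> * cheb \<xi> K else 0)" for i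
  have sig: "\<sigma> > 0" using const(2)[of p] s_pos[of p] by simp
  have n0: "n > 0"
  proof (rule ccontr)
    assume "\<not> n > 0"
    thus False using n sig by simp
  qed
  have F: "jF D f x = (\<Sum>j = 1..K. cheb \<xi> j * u x (p + j))" for x
  proof -
    have "jF D f x = (\<Sum>i\<in>{p + 1..p + K}. f i * u x i)"
      unfolding jF_def u_def using D by (intro sum.mono_neutral_right) (auto simp: f_def)
    also have "\<dots> = (\<Sum>j = 1..K. f (j + p) * u x (j + p))"
      by (subst sum.shift_bounds_cl_nat_ivl[symmetric]) (simp add: add.commute)
    finally show ?thesis by (simp add: f_def add.commute)
  qed
  have R: "jF D r x = (x - \<theta>) * jF D f x" for x
  proof -
    have rec: "x * u x (p + j) = \<sigma> * u x (p + (j - 1)) + \<alpha> * u x (p + j) + \<sigma> * u x (p + (j + 1))"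
      if j: "j \<in> {1..K}" for j
    proof -
      obtain i where i: "p + j = Suc i" using j by (cases j) auto
      have "s (Suc i) * u x (Suc (Suc i)) = (x - a (Suc i)) * u x (Suc i) - s i * u x i"
        using ju_rec[of i x] unfolding u_def by simp
      moreover have "a (Suc i) = \<alpha>" "s (Suc i) = \<sigma>" "s i = \<sigma>" "p + (j - 1) = i" "p + (j + 1) = Suc (Suc i)"
        using const i j by auto
      ultimately show ?thesis using i by (simp add: algebra_simps)
    qed
    have "(x - \<theta>) * jF D f x = (\<Sum>j = 1..K. cheb \<xi> j * (x * u x (p + j) - \<theta> * u x (p + j)))"
      unfolding F sum_distrib_left by (intro sum.cong) (auto simp: algebra_simps)
    also have "\<dots> = (\<Sum>j = 1..K. \<sigma> * (cheb \<xi> j * (u x (p + (j - 1)) - \<xi> * u x (p + j) + u x (p + (j + 1)))))"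
      by (intro sum.cong refl, subst rec) (auto simp: \<theta> algebra_simps)
    also have "\<dots> = \<sigma> * (u x (p + 0) - cheb \<xi> (K + 1) * u x (p + K) + cheb \<xi> K * u x (p + (K + 1)))"
      unfolding sum_distrib_left[symmetric]
      by (subst cheb_summation_by_parts[of \<xi> "\<lambda>j. u x (p + j)"]) simp
    also have "\<dots> = (\<Sum>i\<in>{p, p + K, p + K + 1}. r i * u x i)"
      using n0 K by (simp add: r_def algebra_simps)
    also have "\<dots> = jF D r x"
      unfolding jF_def u_def using D by (intro sum.mono_neutral_left) (auto simp: r_def)
    finally show ?thesis ..
  qed
  define M where "M = (\<Sum>i\<le>D. (f i)\<^sup>2)"
  have Msum: "M = (\<Sum>j = 1..K. (cheb \<xi> j)\<^sup>2)"
  proof -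
    have "M = (\<Sum>i\<in>{p + 1..p + K}. (f i)\<^sup>2)"
      unfolding M_def using D by (intro sum.mono_neutral_right) (auto simp: f_def)
    also have "\<dots> = (\<Sum>j = 1..K. (f (j + p))\<^sup>2)"
      by (subst sum.shift_bounds_cl_nat_ivl[symmetric]) (simp add: add.commute)
    finally show ?thesis by (simp add: f_def)
  qed
  have M_ge: "M \<ge> real n / 2"
    unfolding Msum K using \<xi> \<omega> by (intro cheb_sum_sq_ge) auto
  hence M0: "M > 0" using n0 by simp
  have rsum: "(\<Sum>i\<le>D. (r i)\<^sup>2) \<le> 3 * \<sigma>\<^sup>2 / \<omega>"
  proof -
    have "(\<Sum>i\<le>D. (r i)\<^sup>2) = (\<Sum>i\<in>{p, p + K, p + K + 1}. (r i)\<^sup>2)"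
      using D by (intro sum.mono_neutral_right) (auto simp: r_def)
    also have "\<dots> = \<sigma>\<^sup>2 * (1 + (cheb \<xi> (K + 1))\<^sup>2 + (cheb \<xi> K)\<^sup>2)"
      using n0 K by (simp add: r_def power_mult_distrib algebra_simps)
    also have "\<dots> \<le> \<sigma>\<^sup>2 * (1 / \<omega> + 1 / \<omega> + 1 / \<omega>)"
      using cheb_sq_le[OF \<xi> \<omega>(1)] \<omega> by (intro mult_left_mono add_mono) auto
    finally show ?thesis by (simp add: mult.commute)
  qed
  let ?J = "{x \<in> spec D. \<bar>x - \<theta>\<bar> \<le> \<delta>}" and ?O = "{x \<in> spec D. \<not> \<bar>x - \<theta>\<bar> \<le> \<delta>}"
  \<comment> \<open>Chebyshev's inequality for the spectral measure: off the interval,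
    \<open>(x - \<theta>)^2\<close> is at least \<open>\<delta>^2\<close>, so the mass there is at
    most the residual mass \<open>3 * \<sigma>^2 / \<omega>\<close> over \<open>\<delta>^2\<close>.
    The 12 in the hypothesis on \<open>n\<close> makes this at most \<open>n / 4\<close>, hence at
    most half of \<open>M\<close>.\<close>
  have far: "(\<Sum>x\<in>?O. (jF D f x)\<^sup>2 / jK a s D x) \<le> M / 2"
  proof -
    have "\<delta>\<^sup>2 * (\<Sum>x\<in>?O. (jF D f x)\<^sup>2 / jK a s D x) = (\<Sum>x\<in>?O. \<delta>\<^sup>2 * ((jF D f x)\<^sup>2 / jK a s D x))"
      by (simp add: sum_distrib_left)
    also have "\<dots> \<le> (\<Sum>x\<in>?O. (jF D r x)\<^sup>2 / jK a s D x)"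
    proof (rule sum_mono)
      fix x assume "x \<in> ?O"
      hence "\<delta>\<^sup>2 \<le> (x - \<theta>)\<^sup>2" using \<delta> by (simp add: abs_le_square_iff[symmetric])
      hence "\<delta>\<^sup>2 * ((jF D f x)\<^sup>2 / jK a s D x) \<le> (x - \<theta>)\<^sup>2 * ((jF D f x)\<^sup>2 / jK a s D x)"
        using jK_pos[of D x] by (intro mult_right_mono) auto
      thus "\<delta>\<^sup>2 * ((jF D f x)\<^sup>2 / jK a s D x) \<le> (jF D r x)\<^sup>2 / jK a s D x"
        unfolding R by (simp add: power_mult_distrib)
    qed
    also have "\<dots> \<le> (\<Sum>x\<in>spec D. (jF D r x)\<^sup>2 / jK a s D x)"
      using jK_pos[of D] finite_spec by (intro sum_mono2) (auto intro: divide_nonneg_pos)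
    also have "\<dots> \<le> 3 * \<sigma>\<^sup>2 / \<omega>" using rsum by (simp add: parseval)
    also have "\<dots> \<le> \<delta>\<^sup>2 * (real n / 4)" using n \<omega> by (simp add: field_simps)
    also have "\<dots> \<le> \<delta>\<^sup>2 * (M / 2)" using M_ge by (intro mult_left_mono) auto
    finally show ?thesis using \<delta> by simp
  qed
  have "M = (\<Sum>x\<in>spec D. (jF D f x)\<^sup>2 / jK a s D x)"
    unfolding M_def by (rule parseval[symmetric])
  also have "\<dots> = (\<Sum>x\<in>?J. (jF D f x)\<^sup>2 / jK a s D x) + (\<Sum>x\<in>?O. (jF D f x)\<^sup>2 / jK a s D x)"
    using finite_spec[of D] by (subst sum.union_disjoint[symmetric]) (auto intro!: sum.cong)
  finally have "M / 2 \<le> (\<Sum>x\<in>?J. (jF D f x)\<^sup>2 / jK a s D x)" using far by simp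
  \<comment> \<open>Cauchy-Schwarz removes the wave and leaves only the squares of \<open>u\<close>
    over the window, a quantity that can be added over disjoint windows.\<close>
  also have "\<dots> \<le> (\<Sum>x\<in>?J. M * ((\<Sum>i = p..p + K + 1. (u x i)\<^sup>2) / jK a s D x))"
  proof (rule sum_mono)
    fix x
    have "jF D f x = (\<Sum>i = p..p + K + 1. f i * u x i)"
      unfolding jF_def u_def using D by (intro sum.mono_neutral_right) (auto simp: f_def)
    hence "(jF D f x)\<^sup>2 \<le> (\<Sum>i = p..p + K + 1. (f i)\<^sup>2) * (\<Sum>i = p..p + K + 1. (u x i)\<^sup>2)"
      by (simp only: sum_mult_sq_le)
    also have "(\<Sum>i = p..p + K + 1. (f i)\<^sup>2) = M"
      unfolding M_def using D by (intro sum.mono_neutral_left) (auto simp: f_def)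
    finally show "(jF D f x)\<^sup>2 / jK a s D x \<le> M * ((\<Sum>i = p..p + K + 1. (u x i)\<^sup>2) / jK a s D x)"
      using jK_pos[of D x] by (simp add: divide_right_mono)
  qed
  finally have "M * (1 / 2) \<le> M * (\<Sum>x\<in>?J. (\<Sum>i = p..p + K + 1. (u x i)\<^sup>2) / jK a s D x)"
    by (simp add: sum_distrib_left)
  thus ?thesis using M0 unfolding u_def by (simp only: mult_le_cancel_left_pos)
qed

text \<open>Each of \<open>w\<close> disjoint windows of \<open>2 * n + 2\<close> indices carries
  mass at least 1/2 near \<open>\<theta>\<close>, while one eigenvalue contributes at most 1 to all
  windows together, since \<open>jK\<close> is the sum of \<open>u^2\<close> over all
  indices.\<close>

lemma card_spec_near:
  assumes const: "\<And>m. p \<le> m \<Longrightarrow> m \<le> q \<Longrightarrow> a m = \<alpha>" "\<And>m. p \<le> m \<Longrightarrow> m < q \<Longrightarrow> s m = \<sigma>"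
    and D: "q \<le> D" and w: "p + w * (2 * n + 2) \<le> q + 1"
    and \<theta>: "\<theta> = \<alpha> + \<xi> * \<sigma>" and \<xi>: "0 \<le> \<xi>" "\<xi> \<le> 2 - 2 * \<omega>" and \<omega>: "\<omega> > 0" "\<omega> \<le> 1" and \<delta>: "\<delta> > 0"
    and n: "real n * \<omega> * \<delta>\<^sup>2 \<ge> 12 * \<sigma>\<^sup>2"
  shows "w \<le> 2 * card {x \<in> spec D. \<bar>x - \<theta>\<bar> \<le> \<delta>}"
proof -
  let ?J = "{x \<in> spec D. \<bar>x - \<theta>\<bar> \<le> \<delta>}"
  define P where "P t = p + t * (2 * n + 2)" for t
  define W where "W t = {P t..P t + 2 * n + 1}" for t
  have finJ: "finite ?J" using finite_spec by simp
  have Wle: "P t + 2 * n + 1 \<le> q" if "t < w" for t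
  proof -
    have "Suc t * (2 * n + 2) \<le> w * (2 * n + 2)" using that by (intro mult_le_mono1) simp
    thus ?thesis using w unfolding P_def by simp
  qed
  have "real w * (1 / 2) = (\<Sum>t<w. 1 / 2)" by simp
  also have "\<dots> \<le> (\<Sum>t<w. \<Sum>x\<in>?J. (\<Sum>i\<in>W t. (ju a s x i)\<^sup>2) / jK a s D x)"
  proof (rule sum_mono)
    fix t assume "t \<in> {..<w}"
    hence q: "P t + 2 * n + 1 \<le> q" using Wle by simp
    have pP: "p \<le> P t" unfolding P_def by simp
    show "1 / 2 \<le> (\<Sum>x\<in>?J. (\<Sum>i\<in>W t. (ju a s x i)\<^sup>2) / jK a s D x)"
      unfolding W_def
    proof (rule window_mass[where \<alpha> = \<alpha> and \<sigma> = \<sigma> and \<xi> = \<xi> and \<omega> = \<omega> and n = n])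
      show "a m = \<alpha>" if "P t < m" "m \<le> P t + 2 * n" for m
        using const(1)[of m] that q pP by simp
      show "s m = \<sigma>" if "P t \<le> m" "m \<le> P t + 2 * n" for m
        using const(2)[of m] that q pP by simp
    qed (use q D \<theta> \<xi> \<omega> \<delta> n in auto)
  qed
  also have "\<dots> = (\<Sum>x\<in>?J. (\<Sum>t<w. \<Sum>i\<in>W t. (ju a s x i)\<^sup>2) / jK a s D x)"
    by (subst sum.swap) (simp add: sum_divide_distrib)
  also have "\<dots> \<le> (\<Sum>x\<in>?J. 1)"
  proof (rule sum_mono)
    fix x :: real
    have disj: "W t \<inter> W t' = {}" if "t \<noteq> t'" for t t'
    proof -
      have "Suc t * (2 * n + 2) \<le> t' * (2 * n + 2) \<or> Suc t' * (2 * n + 2) \<le> t * (2 * n + 2)"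
        using that by (metis Suc_leI linorder_neqE_nat mult_le_mono1)
      thus ?thesis unfolding W_def P_def by auto
    qed
    have "(\<Sum>t<w. \<Sum>i\<in>W t. (ju a s x i)\<^sup>2) = (\<Sum>i\<in>(\<Union>t<w. W t). (ju a s x i)\<^sup>2)"
      by (rule sum.UNION_disjoint[symmetric]) (use disj in \<open>auto simp: W_def\<close>)
    also have "\<dots> \<le> jK a s D x"
      unfolding jK_def using Wle D by (intro sum_mono2) (auto simp: W_def intro: order_trans dest!: Wle)
    finally show "(\<Sum>t<w. \<Sum>i\<in>W t. (ju a s x i)\<^sup>2) / jK a s D x \<le> 1"
      using jK_pos[of D x] by simp
  qed
  finally have "real w \<le> real (2 * card ?J)" by simp
  thus ?thesis by (simp only: of_nat_le_iff)
qed

lemma step_bound: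
  fixes x \<kappa> :: real
  assumes "s m \<le> \<kappa>" "s (m + 1) \<ge> 1" "\<bar>x - a (m + 1)\<bar> \<le> 2 * \<kappa>"
  shows "\<bar>ju a s x (m + 1)\<bar> + \<bar>ju a s x (m + 2)\<bar> \<le> (2 * \<kappa> + 1) * (\<bar>ju a s x m\<bar> + \<bar>ju a s x (m + 1)\<bar>)"
proof -
  let ?u = "ju a s x"
  have k0: "\<kappa> \<ge> 0" using assms(1) s_pos[of m] by simp
  have "\<bar>?u (m + 2)\<bar> \<le> s (m + 1) * \<bar>?u (m + 2)\<bar>"
    using mult_right_mono[OF assms(2), of "\<bar>?u (m + 2)\<bar>"] by simp
  also have "\<dots> = \<bar>s (m + 1) * ?u (m + 2)\<bar>"
    using assms(2) by (simp add: abs_mult del: ju.simps)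
  also have "s (m + 1) * ?u (m + 2) = (x - a (m + 1)) * ?u (m + 1) - s m * ?u m"
    using ju_rec[of m x] by simp
  also have "\<bar>\<dots>\<bar> \<le> \<bar>x - a (m + 1)\<bar> * \<bar>?u (m + 1)\<bar> + s m * \<bar>?u m\<bar>"
    using abs_triangle_ineq4 s_pos[of m] by (metis abs_mult abs_of_pos)
  also have "\<dots> \<le> 2 * \<kappa> * \<bar>?u (m + 1)\<bar> + \<kappa> * \<bar>?u m\<bar>"
    using assms by (intro add_mono mult_right_mono) auto
  finally have "\<bar>?u (m + 1)\<bar> + \<bar>?u (m + 2)\<bar> \<le> (2 * \<kappa> + 1) * \<bar>?u (m + 1)\<bar> + \<kappa> * \<bar>?u m\<bar>"
    by (simp add: algebra_simps del: ju.simps)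
  also have "\<dots> \<le> (2 * \<kappa> + 1) * \<bar>?u (m + 1)\<bar> + (2 * \<kappa> + 1) * \<bar>?u m\<bar>"
    using k0 by (intro add_mono mult_right_mono) auto
  finally show ?thesis by (simp add: algebra_simps del: ju.simps)
qed

text \<open>Invariance and definiteness of the energy give a factor that does not depend on the
  length of the block, so even a long block is cheap if \<open>x\<close> lies well inside its
  interval.\<close>

lemma constant_block_bound:
  fixes x :: real
  assumes const: "\<And>m. p < m \<Longrightarrow> m < q \<Longrightarrow> a m = \<alpha>" "\<And>m. p \<le> m \<Longrightarrow> m < q \<Longrightarrow> s m = \<sigma>"
    and x: "x = \<alpha> + \<xi> * \<sigma>" and \<xi>: "0 \<le> \<xi>" "\<xi> \<le> 2 - 2 * \<omega>" and \<omega>: "\<omega> > 0"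
    and m: "p \<le> m" "m + 1 \<le> q"
  shows "\<bar>ju a s x m\<bar> + \<bar>ju a s x (m + 1)\<bar> \<le> 2 / sqrt \<omega> * (\<bar>ju a s x p\<bar> + \<bar>ju a s x (p + 1)\<bar>)"
proof -
  let ?u = "ju a s x"
  have sig: "\<sigma> > 0" using const(2)[of p] s_pos[of p] m by simp
  have rec: "?u (j + 2) = \<xi> * ?u (j + 1) - ?u j" if "p \<le> j" "j + 2 \<le> q" for j
  proof -
    have "\<sigma> * ?u (j + 2) = (x - \<alpha>) * ?u (j + 1) - \<sigma> * ?u j"
      using ju_rec[of j x] const(1)[of "Suc j"] const(2)[of j] const(2)[of "Suc j"] that
      by (simp del: ju.simps)
    also have "\<dots> = \<sigma> * (\<xi> * ?u (j + 1) - ?u j)" using x by (simp add: algebra_simps)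
    finally show ?thesis using sig by (simp del: ju.simps)
  qed
  have "(\<bar>?u m\<bar> + \<bar>?u (m + 1)\<bar>)\<^sup>2 \<le> 2 * ((?u m)\<^sup>2 + (?u (m + 1))\<^sup>2)"
    using sum_squares_bound[of "\<bar>?u m\<bar>" "\<bar>?u (m + 1)\<bar>"] by (simp add: power2_sum)
  also have "\<dots> \<le> 2 * (2 / \<omega> * ((?u p)\<^sup>2 + (?u (p + 1))\<^sup>2))"
  proof -
    have "\<omega> * ((?u m)\<^sup>2 + (?u (m + 1))\<^sup>2) \<le> (?u m)\<^sup>2 - \<xi> * ?u m * ?u (m + 1) + (?u (m + 1))\<^sup>2"
      by (rule energy_bounds(1)[OF \<xi>])
    also have "\<dots> = (?u p)\<^sup>2 - \<xi> * ?u p * ?u (p + 1) + (?u (p + 1))\<^sup>2"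
      by (rule energy_const[of p q]) (use rec m in auto)
    also have "\<dots> \<le> 2 * ((?u p)\<^sup>2 + (?u (p + 1))\<^sup>2)"
      using energy_bounds(2)[OF \<xi>] \<omega> by simp
    finally show ?thesis using \<omega> by (simp add: field_simps del: ju.simps)
  qed
  also have "\<dots> \<le> 4 / \<omega> * (\<bar>?u p\<bar> + \<bar>?u (p + 1)\<bar>)\<^sup>2"
    using \<omega> by (simp add: power2_sum divide_right_mono del: ju.simps)
  also have "\<dots> = (2 / sqrt \<omega> * (\<bar>?u p\<bar> + \<bar>?u (p + 1)\<bar>))\<^sup>2"
    using \<omega> by (simp only: power_mult_distrib power_divide real_sqrt_pow2 order_less_imp_le) simp
  finally show ?thesis
    by (rule power2_le_imp_le) (use \<omega> in \<open>intro mult_nonneg_nonneg add_nonneg_nonneg; simp\<close>)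
qed

end

section \<open>Clusters of conjugate algebraic integers\<close>

abbreviation ipoly_real :: "int poly \<Rightarrow> real \<Rightarrow> real" where
  "ipoly_real p x \<equiv> poly (map_poly real_of_int p) x"

lemma of_rat_of_int_poly: "map_poly real_of_rat (map_poly rat_of_int p) = map_poly real_of_int p"
  by (rule poly_eqI) (simp add: coeff_map_poly)

lemma of_rat_poly_mult:
  "map_poly real_of_rat (f * g) = map_poly real_of_rat f * map_poly real_of_rat g"
  by (rule poly_eqI) (simp add: coeff_map_poly coeff_mult of_rat_sum of_rat_mult)

text \<open>Factoring stays inside integer polynomials: the leading coefficients of two factors of a
  monic polynomial are both 1 or both -1, so a common sign change makes both factors monic.\<close>

lemma exists_monic_irreducible_factor:
  fixes x :: real
  assumes "lead_coeff q = 1" "ipoly_real q x = 0"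
  shows "\<exists>p. lead_coeff p = 1 \<and> irreducible\<^sub>d p \<and> p dvd q \<and> ipoly_real p x = 0"
  using assms
proof (induction "degree q" arbitrary: q rule: less_induct)
  case less
  show ?case
  proof (cases "irreducible\<^sub>d q")
    case True
    show ?thesis by (rule exI[of _ q]) (intro conjI True less.prems dvd_refl)
  next
    case False
    thus ?thesis
    proof (rule reducible\<^sub>dE)
      assume "degree q = 0"
      hence "q = 1" by (rule iffD1[OF monic_degree_0[OF less.prems(1)]])
      thus ?thesis using less.prems(2) by simp
    next
      fix f g assume fg: "degree f < degree q" "degree g < degree q" "q = f * g"
      have l: "lead_coeff f * lead_coeff g = 1"
        using less.prems(1) unfolding fg(3) lead_coeff_mult .
      hence "lead_coeff f = 1 \<and> lead_coeff g = 1 \<or> lead_coeff f = -1 \<and> lead_coeff g = -1"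
        by (simp only: zmult_eq_1_iff)
      then consider "lead_coeff f = 1" "lead_coeff g = 1" | "lead_coeff f = -1" "lead_coeff g = -1"
        by blast
      then obtain f' g' where fg': "lead_coeff f' = 1" "lead_coeff g' = 1" "degree f' < degree q"
        "degree g' < degree q" "q = f' * g'"
      proof cases
        case 1
        thus ?thesis using that fg by blast
      next
        case 2
        show ?thesis by (rule that[of "-f" "-g"]) (use 2 fg in auto)
      qed
      have "ipoly_real f' x = 0 \<or> ipoly_real g' x = 0"
        using less.prems(2) unfolding fg'(5) by (simp add: of_int_poly_hom.hom_mult)
      thus ?thesis
      proof
        assume "ipoly_real f' x = 0"
        from less.hyps[OF fg'(3,1) this] obtain p where
          p: "lead_coeff p = 1" "irreducible\<^sub>d p" "p dvd f'" "ipoly_real p x = 0" by (elim exE conjE)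
        have "p dvd q" unfolding fg'(5) by (rule dvd_mult2[OF p(3)])
        with p(1,2,4) show ?thesis by (intro exI[of _ p] conjI)
      next
        assume "ipoly_real g' x = 0"
        from less.hyps[OF fg'(4,2) this] obtain p where
          p: "lead_coeff p = 1" "irreducible\<^sub>d p" "p dvd g'" "ipoly_real p x = 0" by (elim exE conjE)
        have "p dvd q" unfolding fg'(5) by (rule dvd_mult[OF p(3)])
        with p(1,2,4) show ?thesis by (intro exI[of _ p] conjI)
      qed
    qed
  qed
qed

text \<open>Gauss's lemma, the bridge to \<open>alg_conj\<close>, which speaks of polynomials over
  \<open>rat\<close>.\<close>

lemma irreducible_rat_of_int_poly:
  assumes "irreducible\<^sub>d p"
  shows "irreducible (map_poly rat_of_int p)"
  using irreducible\<^sub>d_int_rat[OF assms] by simp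

text \<open>If the two were coprime over the rationals, a Bezout identity
  \<open>f * P + g * Q = 1\<close> would fail at the common root. So each divides the other, and
  both are monic.\<close>

lemma irreducible_common_root_eq:
  fixes x :: real
  assumes p: "lead_coeff p = 1" "irreducible\<^sub>d p" "ipoly_real p x = 0"
    and q: "lead_coeff q = 1" "irreducible\<^sub>d q" "ipoly_real q x = 0"
  shows "p = q"
proof -
  let ?P = "map_poly rat_of_int p" and ?Q = "map_poly rat_of_int q"
  have dvd: "map_poly rat_of_int p dvd map_poly rat_of_int q"
    if "irreducible\<^sub>d p" "ipoly_real p x = 0" "ipoly_real q x = 0" for p q
  proof (rule ccontr)
    let ?P = "map_poly rat_of_int p" and ?Q = "map_poly rat_of_int q"
    assume "\<not> ?P dvd ?Q"
    moreover have "prime_elem ?P"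
      by (rule field_poly_irreducible_imp_prime[OF irreducible_rat_of_int_poly[OF that(1)]])
    ultimately have "algebraic_semidom_class.coprime ?P ?Q" by (simp add: prime_elem_imp_coprime)
    hence "gcd ?P ?Q = 1" by (simp only: coprime_iff_gcd_eq_1)
    then obtain f g where fg: "f * ?P + g * ?Q = 1"
      using bezout_coefficients_fst_snd[of ?P ?Q] by auto
    have "map_poly real_of_rat (f * ?P + g * ?Q) = 1" unfolding fg by simp
    hence "map_poly real_of_rat f * map_poly real_of_int p + map_poly real_of_rat g * map_poly real_of_int q = 1"
      by (simp only: of_rat_poly_mult hom_distribs of_rat_of_int_poly)
    hence "poly (map_poly real_of_rat f * map_poly real_of_int p + map_poly real_of_rat g * map_poly real_of_int q) x = 1"
      by (simp only: poly_1)
    thus False using that(2,3) by (simp only: poly_add poly_mult mult_zero_right add_0_right zero_neq_one)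
  qed
  have "?P dvd ?Q" "?Q dvd ?P" using dvd p q by blast+
  moreover have "lead_coeff ?P = 1" "lead_coeff ?Q = 1" using p q by simp_all
  ultimately have "?P = ?Q" by (intro poly_dvd_antisym) auto
  thus "p = q" by simp
qed

lemma alg_conj_of_irreducible:
  assumes "irreducible\<^sub>d p" "ipoly_real p x = 0" "ipoly_real p y = 0"
  shows "alg_conj x y"
  unfolding alg_conj_def using irreducible_rat_of_int_poly[OF assms(1)] assms(2,3)
  by (metis of_rat_of_int_poly)

section \<open>Integrality of products over roots, discriminants and clusters of roots\<close>

lemma monic_division:
  fixes f p :: "int poly"
  assumes "lead_coeff p = 1"
  shows "\<exists>q r. f = p * q + r \<and> (r = 0 \<or> degree r < degree p)"
proof -
  obtain q r where qr: "pseudo_divmod f p = (q, r)" by force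
  have "p \<noteq> 0" using assms by auto
  from pseudo_divmod[OF this qr] assms show ?thesis by (intro exI[of _ q] exI[of _ r]) auto
qed

text \<open>On the basis \<open>1, x, \<dots>, x\<^sup>d\<^sup>-\<^sup>1\<close> multiplication by \<open>q\<close> modulo \<open>p\<close> is an integer matrix which the
  Vandermonde matrix of the roots of \<open>p\<close> diagonalises.\<close>

lemma prod_poly_roots_int:
  fixes p q :: "int poly"
  assumes p: "lead_coeff p = 1" and fin: "finite R" and card: "card R = degree p"
    and roots: "\<And>x. x \<in> R \<Longrightarrow> ipoly_real p x = 0"
  shows "(\<Prod>x\<in>R. ipoly_real q x) \<in> \<int>"
proof (cases "degree p = 0")
  case True
  thus ?thesis using fin card by simp
next
  case False
  define d where "d = degree p"
  have d0: "d > 0" using False unfolding d_def by simp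
  obtain e where e: "bij_betw e {0..<d} R"
    using ex_bij_betw_nat_finite[OF fin] card unfolding d_def by metis
  have "\<forall>j. \<exists>r. degree r < d \<and> (\<exists>s. monom 1 j * q = p * s + r)"
    using monic_division[OF p] d0 unfolding d_def by (metis degree_0)
  then obtain r where r: "\<And>j. degree (r j) < d" "\<And>j. \<exists>s. monom 1 j * q = p * s + r j"
    by metis
  have r_eval: "ipoly_real (r j) x = x ^ j * ipoly_real q x" if x: "x \<in> R" for j x
  proof -
    obtain s where "monom 1 j * q = p * s + r j" using r(2) by blast
    hence "ipoly_real (monom 1 j * q) x = ipoly_real (p * s + r j) x" by simp
    thus ?thesis using roots[OF x]
      by (simp add: of_int_poly_hom.hom_mult of_int_poly_hom.hom_add poly_monom map_poly_monom)
  qed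
  define M :: "int mat" where "M = mat d d (\<lambda>(j, m). coeff (r j) m)"
  define MR where "MR = map_mat real_of_int M"
  define V :: "real mat" where "V = mat d d (\<lambda>(m, i). e i ^ m)"
  define G :: "real mat" where "G = mat d d (\<lambda>(i, j). if i = j then ipoly_real q (e i) else 0)"
  have carr: "M \<in> carrier_mat d d" "MR \<in> carrier_mat d d" "V \<in> carrier_mat d d" "G \<in> carrier_mat d d"
    unfolding M_def MR_def V_def G_def by auto
  have "MR * V = V * G"
  proof (rule eq_matI)
    fix j i assume "j < dim_row (V * G)" "i < dim_col (V * G)"
    hence ji: "j < d" "i < d" using carr by auto
    have ei: "e i \<in> R" using e ji by (auto simp: bij_betw_def)
    have "(MR * V) $$ (j, i) = (\<Sum>m = 0..<d. real_of_int (coeff (r j) m) * e i ^ m)"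
      using ji by (simp add: MR_def M_def V_def scalar_prod_def)
    also have "\<dots> = (\<Sum>m<d. coeff (map_poly real_of_int (r j)) m * e i ^ m)"
      by (simp add: atLeast0LessThan)
    also have "\<dots> = ipoly_real (r j) (e i)"
      unfolding poly_altdef using r(1)[of j]
      by (intro sum.mono_neutral_right) (auto simp: coeff_eq_0)
    also have "\<dots> = e i ^ j * ipoly_real q (e i)" by (rule r_eval[OF ei])
    also have "\<dots> = (\<Sum>m = 0..<d. e m ^ j * (if m = i then ipoly_real q (e m) else 0))"
      using ji by (simp add: if_distrib cong: if_cong)
    also have "\<dots> = (V * G) $$ (j, i)"
      using ji by (simp add: V_def G_def scalar_prod_def)
    finally show "(MR * V) $$ (j, i) = (V * G) $$ (j, i)" .
  qed (use carr in auto)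
  hence "det MR * det V = det V * det G"
    using det_mult carr by metis
  \<comment> \<open>Vandermonde: a kernel vector of the transpose would be the coefficient vector of
    a nonzero polynomial of degree below \<open>d\<close> with the \<open>d\<close> elements of
    \<open>R\<close> as roots. Cancelling \<open>det V\<close> then identifies the product over the
    roots with the determinant of the integer matrix \<open>M\<close>.\<close>
  moreover have "det V \<noteq> 0"
  proof
    assume "det V = 0"
    hence "det (transpose_mat V) = 0" using det_transpose[OF carr(3)] by simp
    then obtain v where v: "v \<in> carrier_vec d" "v \<noteq> 0\<^sub>v d" "transpose_mat V *\<^sub>v v = 0\<^sub>v d"
      using det_0_iff_vec_prod_zero_field[of "transpose_mat V" d] carr by auto
    define h where "h = (\<Sum>m<d. monom (v $ m) m)"
    have ch: "coeff h m = (if m < d then v $ m else 0)" for m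
      unfolding h_def coeff_sum coeff_monom by auto
    have h0: "h \<noteq> 0"
    proof
      assume "h = 0"
      hence "v $ m = 0" if "m < d" for m using ch[of m] that by simp
      hence "v = 0\<^sub>v d" using v(1) by (intro eq_vecI) auto
      thus False using v(2) by simp
    qed
    have "poly h x = 0" if x: "x \<in> R" for x
    proof -
      obtain i where i: "i < d" "x = e i" using e x by (auto simp: bij_betw_def)
      have "0 = (transpose_mat V *\<^sub>v v) $ i" using v(3) i by simp
      also have "\<dots> = (\<Sum>m = 0..<d. x ^ m * v $ m)"
        using i v(1) by (simp add: V_def scalar_prod_def)
      also have "\<dots> = poly h x"
        unfolding h_def poly_sum poly_monom by (simp add: atLeast0LessThan mult.commute)
      finally show ?thesis ..
    qed
    hence "R \<subseteq> {x. poly h x = 0}" by auto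
    hence "d \<le> card {x. poly h x = 0}"
      using card_mono[OF poly_roots_finite[OF h0]] card unfolding d_def by metis
    also have "\<dots> \<le> degree h" by (rule poly_roots_degree[OF h0])
    also have "\<dots> < d"
      using d0 by (intro degree_lessI) (auto simp: ch)
    finally show False by simp
  qed
  ultimately have "det MR = det G" by simp
  also have "det G = prod_list (diag_mat G)"
    using carr by (intro det_upper_triangular) (auto simp: G_def)
  also have "\<dots> = (\<Prod>i = 0..<d. ipoly_real q (e i))"
    by (auto simp: diag_mat_def G_def prod.list_conv_set_nth intro!: prod.cong)
  also have "\<dots> = (\<Prod>x\<in>R. ipoly_real q x)"
    using prod.reindex_bij_betw[OF e] by fast
  finally have "(\<Prod>x\<in>R. ipoly_real q x) = real_of_int (det M)"
    unfolding MR_def by (simp add: of_int_hom.hom_det)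
  thus ?thesis by simp
qed

lemma monic_poly_eq_prod_roots:
  fixes P :: "'a :: field poly"
  assumes "lead_coeff P = 1" "finite R" "card R = degree P" "\<And>x. x \<in> R \<Longrightarrow> poly P x = 0"
  shows "P = (\<Prod>x\<in>R. [:- x, 1:])"
proof (rule poly_eqI_degree_lead_coeff[where n = "degree P" and A = R])
  have "degree (\<Prod>x\<in>R. [:- x, 1:]) = card R"
    by (subst degree_prod_eq_sum_degree) auto
  moreover have "lead_coeff (\<Prod>x\<in>R. [:- x, 1:]) = 1"
    by (simp add: lead_coeff_prod)
  ultimately show "coeff P (degree P) = coeff (\<Prod>x\<in>R. [:- x, 1:]) (degree P)"
    "degree (\<Prod>x\<in>R. [:- x, 1:]) \<le> degree P"
    using assms by simp_all
  show "poly P z = poly (\<Prod>x\<in>R. [:- x, 1:]) z" if "z \<in> R" for z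
    using assms that by (auto simp: poly_prod)
qed (use assms in auto)

text \<open>The inner product over \<open>y\<close>, taken without absolute values, is the
  derivative of \<open>p\<close> at \<open>x\<close>; hence the double product is an integer by
  \<open>prod_poly_roots_int\<close>, and it is nonzero because the roots in \<open>R\<close> are
  distinct.\<close>

lemma discriminant_ge_1:
  fixes p :: "int poly"
  assumes p: "lead_coeff p = 1" and fin: "finite R" and card: "card R = degree p"
    and roots: "\<And>x. x \<in> R \<Longrightarrow> ipoly_real p x = 0"
  shows "1 \<le> (\<Prod>x\<in>R. \<Prod>y\<in>R - {x}. \<bar>x - y\<bar>)"
proof -
  let ?P = "map_poly real_of_int p"
  have P: "?P = (\<Prod>x\<in>R. [:- x, 1:])"
    using assms by (intro monic_poly_eq_prod_roots) auto
  have ev: "ipoly_real (pderiv p) x = (\<Prod>y\<in>R - {x}. (x - y))" if x: "x \<in> R" for x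
  proof -
    have "map_poly real_of_int (pderiv p) = pderiv ?P"
      by (simp add: of_int_hom.map_poly_pderiv)
    also have "\<dots> = (\<Sum>a\<in>R. (\<Prod>y\<in>R - {a}. [:- y, 1:]))"
      unfolding P pderiv_prod by (simp add: pderiv_pCons)
    finally have "ipoly_real (pderiv p) x = (\<Sum>a\<in>R. (\<Prod>y\<in>R - {a}. (x - y)))"
      by (simp add: poly_sum poly_prod)
    also have "\<dots> = (\<Sum>a\<in>{x}. (\<Prod>y\<in>R - {a}. (x - y)))"
      using fin x by (intro sum.mono_neutral_right) auto
    finally show ?thesis by simp
  qed
  have "(\<Prod>x\<in>R. \<Prod>y\<in>R - {x}. (x - y)) = (\<Prod>x\<in>R. ipoly_real (pderiv p) x)"
    by (simp add: ev)
  also have "\<dots> \<in> \<int>" by (rule prod_poly_roots_int[OF assms])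
  finally obtain z where z: "(\<Prod>x\<in>R. \<Prod>y\<in>R - {x}. (x - y)) = real_of_int z" by (elim Ints_cases)
  have "(\<Prod>x\<in>R. \<Prod>y\<in>R - {x}. (x - y)) \<noteq> 0" using fin by auto
  hence "1 \<le> \<bar>z\<bar>" unfolding z by simp
  hence "1 \<le> \<bar>\<Prod>x\<in>R. \<Prod>y\<in>R - {x}. (x - y)\<bar>" unfolding z by simp
  thus ?thesis by (simp add: abs_prod)
qed

text \<open>With \<open>m = card T\<close> and \<open>d = degree p\<close>, the
  \<open>m * (m - 1)\<close> ordered pairs inside \<open>T\<close> contribute at most
  \<open>B ^ (- N^2)\<close> each to the discriminant, and the remaining factors at most
  \<open>B ^ (d * d)\<close> altogether. A product of at least 1 forces
  \<open>N^2 * m * (m - 1) \<le> d^2\<close>, which explains the exponent \<open>N^2\<close> in the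
  closeness.\<close>

lemma card_root_cluster:
  fixes p :: "int poly" and B :: real
  assumes p: "lead_coeff p = 1" and fin: "finite R" and card: "card R = degree p"
    and roots: "\<And>x. x \<in> R \<Longrightarrow> ipoly_real p x = 0"
    and B: "B > 1" "\<And>x y. x \<in> R \<Longrightarrow> y \<in> R \<Longrightarrow> \<bar>x - y\<bar> \<le> B"
    and T: "T \<subseteq> R" "\<And>x y. x \<in> T \<Longrightarrow> y \<in> T \<Longrightarrow> \<bar>x - y\<bar> \<le> 1 / B ^ (N\<^sup>2)"
  shows "N * (card T - 1) \<le> degree p"
proof -
  define d m \<eta> where "d = degree p" and "m = card T" and "\<eta> = 1 / B ^ (N\<^sup>2)"
  have finT: "finite T" using T(1) fin by (rule finite_subset)
  have eta0: "\<eta> > 0" using B(1) unfolding \<eta>_def by simp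
  have le: "(\<Prod>y\<in>R - {x}. \<bar>x - y\<bar>) \<le> (if x \<in> T then \<eta> ^ (m - 1) else 1) * B ^ d" if x: "x \<in> R" for x
  proof (cases "x \<in> T")
    case True
    have "R - {x} = (T - {x}) \<union> (R - T)" using True T(1) by auto
    hence "(\<Prod>y\<in>R - {x}. \<bar>x - y\<bar>) = (\<Prod>y\<in>T - {x}. \<bar>x - y\<bar>) * (\<Prod>y\<in>R - T. \<bar>x - y\<bar>)"
      using fin finT by (simp add: prod.union_disjoint Int_def)
    also have "\<dots> \<le> (\<Prod>y\<in>T - {x}. \<eta>) * (\<Prod>y\<in>R - T. B)"
      by (intro mult_mono prod_mono conjI prod_nonneg) (use T B True x eta0 in \<open>auto simp: \<eta>_def\<close>)
    also have "\<dots> = \<eta> ^ (m - 1) * B ^ card (R - T)"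
      using True finT by (simp add: m_def)
    also have "\<dots> \<le> \<eta> ^ (m - 1) * B ^ d"
      using eta0 B(1) card fin unfolding d_def card[symmetric]
      by (intro mult_left_mono power_increasing card_mono) auto
    finally show ?thesis using True by simp
  next
    case False
    have "(\<Prod>y\<in>R - {x}. \<bar>x - y\<bar>) \<le> (\<Prod>y\<in>R - {x}. B)"
      by (intro prod_mono conjI) (use B(2) x in auto)
    also have "\<dots> = B ^ card (R - {x})" by simp
    also have "\<dots> \<le> B ^ d"
      using B(1) fin unfolding d_def card[symmetric] by (intro power_increasing card_mono) auto
    finally show ?thesis using False by simp
  qed
  have "1 \<le> (\<Prod>x\<in>R. \<Prod>y\<in>R - {x}. \<bar>x - y\<bar>)"
    by (rule discriminant_ge_1[OF p fin card roots])
  also have "\<dots> \<le> (\<Prod>x\<in>R. (if x \<in> T then \<eta> ^ (m - 1) else 1) * B ^ d)"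
    by (intro prod_mono conjI le prod_nonneg) auto
  also have "\<dots> = (\<Prod>x\<in>R. (if x \<in> T then \<eta> ^ (m - 1) else 1)) * (B ^ d) ^ card R"
    by (simp add: prod.distrib)
  also have "(\<Prod>x\<in>R. (if x \<in> T then \<eta> ^ (m - 1) else 1)) = (\<Prod>x\<in>T. \<eta> ^ (m - 1))"
    using T(1) fin by (simp add: prod.If_cases Int_absorb1)
  finally have "1 \<le> \<eta> ^ ((m - 1) * m) * B ^ (d * d)"
    unfolding card m_def[symmetric] d_def[symmetric]
    by (simp add: power_mult[symmetric] m_def)
  hence "B ^ (N\<^sup>2 * ((m - 1) * m)) \<le> B ^ (d * d)"
    using B(1) by (simp add: \<eta>_def power_divide power_mult[symmetric] field_simps)
  hence "N\<^sup>2 * ((m - 1) * m) \<le> d * d"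
    using B(1) by (simp add: power_increasing_iff)
  moreover have "(N * (m - 1))\<^sup>2 \<le> N\<^sup>2 * ((m - 1) * m)"
    by (simp add: power2_eq_square mult_mono)
  ultimately have "(N * (m - 1))\<^sup>2 \<le> d\<^sup>2"
    unfolding power2_eq_square[of d] by (rule order_trans[rotated])
  thus ?thesis unfolding m_def d_def by (simp add: power2_nat_le_eq_le)
qed

lemma coeff_prod_linear_bound:
  fixes \<kappa> :: real
  assumes "finite R" "\<And>x. x \<in> R \<Longrightarrow> \<bar>x\<bar> \<le> \<kappa>" "\<kappa> \<ge> 0"
  shows "\<bar>coeff (\<Prod>x\<in>R. [:- x, 1:]) i\<bar> \<le> (1 + \<kappa>) ^ card R"
  using assms(1,2)
proof (induction R arbitrary: i rule: finite_induct)
  case empty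
  show ?case by (simp add: coeff_1)
next
  case (insert x R)
  let ?q = "\<Prod>x\<in>R. [:- x, 1:]"
  have IH: "\<bar>coeff ?q j\<bar> \<le> (1 + \<kappa>) ^ card R" for j using insert by auto
  have 0: "0 \<le> (1 + \<kappa>) ^ card R" using assms(3) by simp
  have "\<bar>coeff (pCons 0 ?q) i\<bar> \<le> (1 + \<kappa>) ^ card R"
    using IH 0 by (auto simp: coeff_pCons split: nat.split)
  moreover have "\<bar>x * coeff ?q i\<bar> \<le> \<kappa> * (1 + \<kappa>) ^ card R"
    unfolding abs_mult using IH insert.prems assms(3) by (intro mult_mono) auto
  moreover have "coeff (\<Prod>x\<in>insert x R. [:- x, 1:]) i = coeff (pCons 0 ?q) i - x * coeff ?q i"
    using insert.hyps by simp
  ultimately show ?case using insert.hyps by (simp add: distrib_right)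
qed

text \<open>Northcott's argument: bounded roots and bounded degree bound the integer coefficients,
  so only finitely many coefficient lists remain.\<close>

lemma finite_small_degree_real_split:
  fixes \<kappa> :: real
  assumes "\<kappa> \<ge> 0"
  shows "finite {p :: int poly. degree p < N \<and> lead_coeff p = 1 \<and>
    (\<exists>R. finite R \<and> card R = degree p \<and> (\<forall>x\<in>R. ipoly_real p x = 0 \<and> \<bar>x\<bar> \<le> \<kappa>))}" (is "finite ?S")
proof (rule finite_subset)
  define b where "b = \<lceil>(1 + \<kappa>) ^ N\<rceil>"
  show "finite (Poly ` {xs. set xs \<subseteq> {- b..b} \<and> length xs \<le> N})"
    by (intro finite_imageI finite_lists_length_le) auto
  show "?S \<subseteq> Poly ` {xs. set xs \<subseteq> {- b..b} \<and> length xs \<le> N}"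
  proof
    fix p assume "p \<in> ?S"
    then obtain R where p: "degree p < N" "lead_coeff p = 1"
      and R: "finite R" "card R = degree p" "\<And>x. x \<in> R \<Longrightarrow> ipoly_real p x = 0"
        "\<And>x. x \<in> R \<Longrightarrow> \<bar>x\<bar> \<le> \<kappa>" by blast
    have P: "map_poly real_of_int p = (\<Prod>x\<in>R. [:- x, 1:])"
      using p R by (intro monic_poly_eq_prod_roots) auto
    have "\<bar>coeff p i\<bar> \<le> b" for i
    proof -
      have "real_of_int \<bar>coeff p i\<bar> = \<bar>coeff (map_poly real_of_int p) i\<bar>" by simp
      also have "\<dots> \<le> (1 + \<kappa>) ^ card R"
        unfolding P using R assms by (intro coeff_prod_linear_bound) auto
      also have "\<dots> \<le> (1 + \<kappa>) ^ N"
        using p R assms by (intro power_increasing) auto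
      finally show ?thesis unfolding b_def by linarith
    qed
    hence "set (coeffs p) \<subseteq> {- b..b}"
      by (auto simp: coeffs_def abs_le_iff minus_le_iff split: if_splits)
    moreover have "length (coeffs p) \<le> N" using p(1) by (simp add: length_coeffs_degree coeffs_def)
    ultimately show "p \<in> Poly ` {xs. set xs \<subseteq> {- b..b} \<and> length xs \<le> N}"
      by (intro image_eqI[of _ _ "coeffs p"]) auto
  qed
qed

text \<open>Every element of \<open>E\<close> is a root of \<open>p\<close> or of \<open>q\<close>,
  neither has more roots in \<open>E\<close> than its degree, and \<open>E\<close> has exactly as
  many elements as both degrees together. Hence a factor inherits a full set of real roots.\<close>

lemma factor_split:
  fixes p q :: "int poly"
  assumes "lead_coeff (p * q) = 1" "finite E" "card E = degree (p * q)"
    and "\<And>x. x \<in> E \<Longrightarrow> ipoly_real (p * q) x = 0"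
  shows "card {x \<in> E. ipoly_real p x = 0} = degree p"
proof -
  have nz: "p \<noteq> 0" "q \<noteq> 0" using assms(1) by auto
  have le: "card {x \<in> E. ipoly_real r x = 0} \<le> degree r" if "r \<noteq> 0" for r :: "int poly"
  proof -
    have r: "map_poly real_of_int r \<noteq> 0" using that by simp
    have "card {x \<in> E. ipoly_real r x = 0} \<le> card {x. ipoly_real r x = 0}"
      by (intro card_mono poly_roots_finite[OF r]) auto
    also have "\<dots> \<le> degree r" using poly_roots_degree[OF r] by simp
    finally show ?thesis .
  qed
  have "E \<subseteq> {x \<in> E. ipoly_real p x = 0} \<union> {x \<in> E. ipoly_real q x = 0}"
    using assms(4) by (auto simp: of_int_poly_hom.hom_mult)
  hence "card E \<le> card ({x \<in> E. ipoly_real p x = 0} \<union> {x \<in> E. ipoly_real q x = 0})"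
    using assms(2) by (intro card_mono) auto
  also have "\<dots> \<le> card {x \<in> E. ipoly_real p x = 0} + card {x \<in> E. ipoly_real q x = 0}"
    by (rule card_Un_le)
  finally show ?thesis
    using le[OF nz(1)] le[OF nz(2)] assms(3) by (simp add: degree_mult_eq nz)
qed

text \<open>\<open>T\<close> is split according to the irreducible factors of \<open>\<chi>\<close>.
  A class with factor \<open>p\<close> has at most \<open>1 + degree p / N\<close> elements by
  \<open>card_root_cluster\<close>. Factors of degree at least \<open>N\<close> number at most
  \<open>degree \<chi> / N\<close>, the others at most \<open>Z\<close>, the size of the finite set
  of small-degree candidates. The two degree sums give the 2, and \<open>2 * \<kappa>\<close> bounds
  the distance of any two roots.\<close>

proposition card_conjugate_cluster:
  fixes \<kappa> :: real
  assumes \<kappa>: "\<kappa> \<ge> 1"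
  shows "\<exists>Z::nat. \<forall>(\<chi>::int poly) E T. lead_coeff \<chi> = 1 \<longrightarrow> finite E \<longrightarrow> card E = degree \<chi> \<longrightarrow>
     (\<forall>x\<in>E. ipoly_real \<chi> x = 0 \<and> \<bar>x\<bar> \<le> \<kappa>) \<longrightarrow> T \<subseteq> E \<longrightarrow>
     (\<forall>x\<in>T. \<forall>y\<in>T. alg_conj x y \<longrightarrow> \<bar>x - y\<bar> \<le> 1 / (2 * \<kappa>) ^ (N\<^sup>2)) \<longrightarrow>
     N * card T \<le> N * Z + 2 * degree \<chi>"
proof -
  define S where "S = {p :: int poly. degree p < N \<and> lead_coeff p = 1 \<and>
    (\<exists>R. finite R \<and> card R = degree p \<and> (\<forall>x\<in>R. ipoly_real p x = 0 \<and> \<bar>x\<bar> \<le> \<kappa>))}"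
  have finS: "finite S" unfolding S_def by (rule finite_small_degree_real_split) (use \<kappa> in auto)
  show ?thesis
  proof (intro exI[of _ "card S"] allI impI)
    fix \<chi> :: "int poly" and E T :: "real set"
    assume mon: "lead_coeff \<chi> = 1" and finE: "finite E" and cardE: "card E = degree \<chi>"
      and E: "\<forall>x\<in>E. ipoly_real \<chi> x = 0 \<and> \<bar>x\<bar> \<le> \<kappa>" and TE: "T \<subseteq> E"
      and T: "\<forall>x\<in>T. \<forall>y\<in>T. alg_conj x y \<longrightarrow> \<bar>x - y\<bar> \<le> 1 / (2 * \<kappa>) ^ (N\<^sup>2)"
    have finT: "finite T" using TE finE by (rule finite_subset)
    have "\<forall>x\<in>T. \<exists>p. lead_coeff p = 1 \<and> irreducible\<^sub>d p \<and> p dvd \<chi> \<and> ipoly_real p x = 0"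
      using exists_monic_irreducible_factor[OF mon] E TE by blast
    then obtain f where f: "\<And>x. x \<in> T \<Longrightarrow> lead_coeff (f x) = 1" "\<And>x. x \<in> T \<Longrightarrow> irreducible\<^sub>d (f x)"
      "\<And>x. x \<in> T \<Longrightarrow> f x dvd \<chi>" "\<And>x. x \<in> T \<Longrightarrow> ipoly_real (f x) x = 0"
      by metis
    define P where "P = f ` T"
    define R where "R p = {x \<in> E. ipoly_real p x = 0}" for p
    have finP: "finite P" unfolding P_def using finT by simp
    have P: "lead_coeff p = 1" "irreducible\<^sub>d p" "p dvd \<chi>" if "p \<in> P" for p
      using that f unfolding P_def by auto
    have finR: "finite (R p)" for p unfolding R_def using finE by simp
    have cardR: "card (R p) = degree p" if p: "p \<in> P" for p
    proof -
      obtain q where "\<chi> = p * q" using P(3)[OF p] by (elim dvdE)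
      thus ?thesis unfolding R_def using factor_split[of p q E] mon finE cardE E by simp
    qed
    have sumdeg: "(\<Sum>p\<in>P. degree p) \<le> degree \<chi>"
    proof -
      have "(\<Sum>p\<in>P. degree p) = (\<Sum>p\<in>P. card (R p))" by (simp add: cardR)
      also have "\<dots> = card (\<Union>p\<in>P. R p)"
      proof (rule card_UN_disjoint[symmetric])
        show "\<forall>p\<in>P. \<forall>q\<in>P. p \<noteq> q \<longrightarrow> R p \<inter> R q = {}"
          using irreducible_common_root_eq P unfolding R_def by blast
      qed (use finP finR in auto)
      also have "\<dots> \<le> card E"
        using finE by (intro card_mono) (auto simp: R_def)
      finally show ?thesis unfolding cardE .
    qed
    have cl: "N * card (T \<inter> R p) \<le> N + degree p" if p: "p \<in> P" for p
    proof -
      have "N * (card (T \<inter> R p) - 1) \<le> degree p"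
      proof (rule card_root_cluster[where R = "R p" and B = "2 * \<kappa>"])
        show "\<bar>x - y\<bar> \<le> 2 * \<kappa>" if "x \<in> R p" "y \<in> R p" for x y
        proof -
          have "\<bar>x\<bar> \<le> \<kappa>" "\<bar>y\<bar> \<le> \<kappa>" using that E unfolding R_def by auto
          thus ?thesis by linarith
        qed
        show "\<bar>x - y\<bar> \<le> 1 / (2 * \<kappa>) ^ (N\<^sup>2)" if "x \<in> T \<inter> R p" "y \<in> T \<inter> R p" for x y
          using T that alg_conj_of_irreducible[OF P(2)[OF p], of x y] unfolding R_def by simp
      qed (use P(1)[OF p] cardR[OF p] finR \<kappa> in \<open>auto simp: R_def\<close>)
      thus ?thesis by (cases "card (T \<inter> R p)") auto
    qed
    have "T \<subseteq> (\<Union>p\<in>P. T \<inter> R p)"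
      using f(4) TE unfolding P_def R_def by auto
    hence "card T \<le> card (\<Union>p\<in>P. T \<inter> R p)"
      using finP finT by (intro card_mono) auto
    also have "\<dots> \<le> (\<Sum>p\<in>P. card (T \<inter> R p))"
      by (rule card_UN_le[OF finP])
    finally have "N * card T \<le> (\<Sum>p\<in>P. N * card (T \<inter> R p))"
      unfolding sum_distrib_left[symmetric] by simp
    also have "\<dots> \<le> (\<Sum>p\<in>P. N + degree p)" by (intro sum_mono cl)
    also have "\<dots> = N * card P + (\<Sum>p\<in>P. degree p)" by (simp add: sum.distrib)
    finally have 1: "N * card T \<le> N * card P + (\<Sum>p\<in>P. degree p)" .
    have "card P \<le> card (P \<inter> S) + card (P - S)"
      using finP by (metis card_Int_Diff order_refl)
    also have "card (P \<inter> S) \<le> card S" using finS by (intro card_mono) auto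
    finally have "N * card P \<le> N * card S + N * card (P - S)"
      by (metis add_le_mono1 mult_le_mono2 distrib_left)
    moreover have "N * card (P - S) \<le> (\<Sum>p\<in>P. degree p)"
    proof -
      have "N \<le> degree p" if p: "p \<in> P - S" for p
      proof (rule ccontr)
        assume "\<not> N \<le> degree p"
        hence "p \<in> S" unfolding S_def
          using P(1)[of p] p cardR[of p] finR[of p] E by (auto simp: R_def intro!: exI[of _ "R p"])
        thus False using p by simp
      qed
      hence "(\<Sum>p\<in>P - S. N) \<le> (\<Sum>p\<in>P - S. degree p)" by (intro sum_mono)
      also have "\<dots> \<le> (\<Sum>p\<in>P. degree p)" using finP by (intro sum_mono2) auto
      finally show ?thesis by (simp add: mult.commute)
    qed
    ultimately show "N * card T \<le> N * card S + 2 * degree \<chi>" using 1 sumdeg by linarith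
  qed
qed

section \<open>Growth and decay of eigenvectors\<close>

declare ju.simps(2,3) [simp del]

text \<open>\<open>sqrt (\<gamma> / \<beta>)\<close> is the double root of
  \<open>\<beta> * t^2 - (\<beta> + \<gamma> - y) * t + \<gamma>\<close> at the extreme
  \<open>y = (sqrt \<beta> - sqrt \<gamma>)^2\<close>. As it is at most 1, a larger \<open>b\<close>
  and a smaller \<open>c\<close> only help, so one trial ratio serves all rows of a monotone array
  up to a given block.\<close>

lemma threshold_ineq:
  fixes b c y \<beta> \<gamma> :: real
  assumes "0 < \<gamma>" "\<gamma> \<le> \<beta>" "\<beta> \<le> b" "c \<le> \<gamma>" "y \<le> (sqrt \<beta> - sqrt \<gamma>)\<^sup>2"
  shows "sqrt (\<gamma> / \<beta>) * b \<le> b + c - y - c / sqrt (\<gamma> / \<beta>)"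
proof -
  define B G where "B = sqrt \<beta>" and "G = sqrt \<gamma>"
  have BG: "0 < G" "G \<le> B" "B * B = \<beta>" "G * G = \<gamma>" using assms by (auto simp: B_def G_def)
  have t: "sqrt (\<gamma> / \<beta>) = G / B" unfolding B_def G_def by (rule real_sqrt_divide)
  have "(B - G)\<^sup>2 = \<beta> * (1 - G / B) + \<gamma> * (1 - B / G)"
    using BG(1,2) by (simp add: BG(3,4)[symmetric] power2_eq_square field_simps)
  also have "\<dots> \<le> b * (1 - G / B) + c * (1 - B / G)"
    using assms BG by (intro add_mono mult_right_mono mult_right_mono_neg) auto
  finally have "y \<le> b * (1 - G / B) + c * (1 - B / G)"
    using assms(5) unfolding B_def G_def by linarith
  thus ?thesis unfolding t by (simp add: algebra_simps)
qed

text \<open>Turns the lower bound \<open>sqrt (\<gamma> / \<beta>)\<close> on ratios of the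
  unsymmetrised vector into monotonicity of the symmetrised one, whose off-diagonal entry is
  \<open>sqrt (b * c)\<close>.\<close>

lemma sqrt_ratio_step:
  fixes b c \<beta> \<gamma> :: real
  assumes "0 < \<gamma>" "0 < \<beta>" "\<beta> \<le> b" "0 \<le> c" "c \<le> \<gamma>"
  shows "sqrt (b * c) \<le> sqrt (\<gamma> / \<beta>) * b"
proof -
  have "\<beta> * c \<le> b * \<gamma>" using assms by (intro mult_mono) auto
  hence "c \<le> \<gamma> / \<beta> * b" using assms by (simp add: field_simps)
  hence "b * c \<le> b * (\<gamma> / \<beta> * b)" using assms by (intro mult_left_mono) auto
  hence "sqrt (b * c) \<le> sqrt (\<gamma> / \<beta> * b\<^sup>2)" by (simp add: power2_eq_square mult_ac)
  also have "\<dots> = sqrt (\<gamma> / \<beta>) * b"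
    unfolding real_sqrt_mult using assms by simp
  finally show ?thesis .
qed

section \<open>Symmetrising an array with constant row sums; monotone parts of its
  eigenvectors\<close>

locale tridiagonal =
  fixes k D :: nat and a b c :: "nat \<Rightarrow> real"
  assumes D1: "D \<ge> 1" and b0: "b 0 = k" and a0: "a 0 = 0" and c1: "c 1 = 1" and bD: "b D = 0"
    and row: "1 \<le> m \<Longrightarrow> m \<le> D \<Longrightarrow> c m + a m + b m = k"
    and a_nonneg: "a m \<ge> 0"
    and c_ge: "1 \<le> m \<Longrightarrow> m \<le> D \<Longrightarrow> c m \<ge> 1"
    and b_ge: "m < D \<Longrightarrow> b m \<ge> 1"
begin

text \<open>The value 1 from index \<open>D\<close> on serves the positivity that
  \<open>jacobi\<close> demands everywhere; \<open>off D\<close> merely scales the closing condition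
  and leaves \<open>spec D\<close> unchanged.\<close>

definition off :: "nat \<Rightarrow> real" where
  "off m = (if m < D then sqrt (b m * c (m + 1)) else 1)"

lemma c_le: "1 \<le> m \<Longrightarrow> m \<le> D \<Longrightarrow> c m \<le> k"
  using row[of m] a_nonneg[of m] b_ge[of m] bD by (cases "m = D") auto

lemma b_le: "m \<le> D \<Longrightarrow> b m \<le> k"
  using row[of m] a_nonneg[of m] c_ge[of m] b0 by (cases "m = 0") auto

lemma b_nonneg: "m \<le> D \<Longrightarrow> b m \<ge> 0"
  using b_ge[of m] bD by (cases "m = D") auto

lemma k_ge_1: "real k \<ge> 1"
  using b_ge[of 0] b0 D1 by simp

lemma off_ge: "off m \<ge> 1"
proof (cases "m < D")
  case True
  hence "1 * 1 \<le> b m * c (m + 1)" by (intro mult_mono b_ge c_ge) (use b_ge[of m] in auto)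
  thus ?thesis using True by (simp add: off_def)
qed (simp add: off_def)

lemma off_le: "off m \<le> k"
proof (cases "m < D")
  case True
  hence "b m * c (m + 1) \<le> real k * real k"
    using c_ge[of "m + 1"] by (intro mult_mono b_le c_le) auto
  hence "sqrt (b m * c (m + 1)) \<le> sqrt (real k * real k)" by (rule real_sqrt_le_mono)
  thus ?thesis using True by (simp add: off_def)
qed (use k_ge_1 in \<open>simp add: off_def\<close>)

lemma off_sq: "m < D \<Longrightarrow> off m * off m = b m * c (m + 1)"
  using b_ge[of m] c_ge[of "m + 1"] by (simp add: off_def)

sublocale jacobi a off
proof
  show "off i > 0" for i using off_ge[of i] by linarith
qed

text \<open>The symmetrising weights, with \<open>kap i * b i = kap (i + 1) * c (i + 1)\<close> for
  \<open>i < D\<close>. By \<open>vrec_k\<close> they are the values \<open>v_i\<close> at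
  \<open>k\<close>, so the Christoffel denominators become sums of \<open>u^2\<close>.\<close>

definition kap :: "nat \<Rightarrow> real" where
  "kap i = (\<Prod>j<i. b j / c (Suc j))"

lemma kap_Suc: "kap (Suc i) = kap i * b i / c (Suc i)"
  by (simp add: kap_def)

lemma kap_pos: "i \<le> D \<Longrightarrow> kap i > 0"
  unfolding kap_def
proof (rule prod_pos)
  fix j assume "i \<le> D" "j \<in> {..<i}"
  hence "b j \<ge> 1" "c (Suc j) \<ge> 1" using b_ge[of j] c_ge[of "Suc j"] by auto
  thus "b j / c (Suc j) > 0" by simp
qed

lemma sqrt_kap_Suc:
  assumes "i < D"
  shows "sqrt (kap (Suc i)) * off i = sqrt (kap i) * b i"
    and "sqrt (kap (Suc i)) * c (Suc i) = sqrt (kap i) * off i"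
proof -
  have bc: "b i \<ge> 1" "c (Suc i) \<ge> 1" using assms b_ge[of i] c_ge[of "Suc i"] by auto
  have 1: "sqrt (kap (Suc i)) = sqrt (kap i) * sqrt (b i) / sqrt (c (Suc i))"
    unfolding kap_Suc by (simp add: real_sqrt_mult real_sqrt_divide)
  have 2: "off i = sqrt (b i) * sqrt (c (Suc i))" using assms by (simp add: off_def real_sqrt_mult)
  show "sqrt (kap (Suc i)) * off i = sqrt (kap i) * b i"
    unfolding 1 2 using bc by (simp add: field_simps)
  show "sqrt (kap (Suc i)) * c (Suc i) = sqrt (kap i) * off i"
    unfolding 1 2 using bc by (simp add: field_simps)
qed

lemma vrec_eq: "i \<le> D \<Longrightarrow> vrec c a b x i = sqrt (kap i) * ju a off x i"
proof (induction i rule: induct_nat_012)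
  case 0
  show ?case by (simp add: kap_def)
next
  case 1
  have "sqrt (kap 1) = off 0"
    using sqrt_kap_Suc(2)[of 0] 1 c1 by (simp add: kap_def)
  thus ?case using a0 ju_0_rec[of x] by simp
next
  case (ge2 i)
  have c: "c (Suc (Suc i)) > 0" using c_ge[of "Suc (Suc i)"] ge2.prems by simp
  have "c (Suc (Suc i)) * (sqrt (kap (Suc (Suc i))) * ju a off x (Suc (Suc i)))
      = sqrt (kap (Suc i)) * (off (Suc i) * ju a off x (Suc (Suc i)))"
    using sqrt_kap_Suc(2)[of "Suc i"] ge2.prems by (simp add: mult_ac)
  also have "off (Suc i) * ju a off x (Suc (Suc i)) = (x - a (Suc i)) * ju a off x (Suc i) - off i * ju a off x i"
    using ju_rec[of i x] by simp
  also have "sqrt (kap (Suc i)) * \<dots> = (x - a (Suc i)) * (sqrt (kap (Suc i)) * ju a off x (Suc i))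
      - (sqrt (kap (Suc i)) * off i) * ju a off x i"
    by (simp add: algebra_simps)
  also have "\<dots> = (x - a (Suc i)) * vrec c a b x (Suc i) - b i * vrec c a b x i"
    using sqrt_kap_Suc(1)[of i] ge2 by (simp add: mult_ac)
  finally show ?case using c by (simp add: field_simps)
qed

lemma vrec_k: "i \<le> D \<Longrightarrow> vrec c a b (real k) i = kap i"
proof (induction i rule: induct_nat_012)
  case 1
  show ?case using b0 c1 by (simp add: kap_def)
next
  case (ge2 i)
  have c: "c (Suc (Suc i)) > 0" "c (Suc i) > 0"
    using c_ge[of "Suc (Suc i)"] c_ge[of "Suc i"] ge2.prems by simp_all
  have "b i * kap i = c (Suc i) * kap (Suc i)" using c by (simp add: kap_Suc)
  moreover have "real k - a (Suc i) = c (Suc i) + b (Suc i)"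
    using row[of "Suc i"] ge2.prems by simp
  ultimately have "(real k - a (Suc i)) * kap (Suc i) - b i * kap i = b (Suc i) * kap (Suc i)"
    by (simp add: distrib_right)
  thus ?case using ge2 c by (simp add: kap_Suc[of "Suc i"])
qed (simp add: kap_def)

lemma christoffel_eq:
  "(\<Sum>i\<in>{0..D}. vrec c a b (real k) i) / (\<Sum>i\<in>{0..D}. (vrec c a b x i)\<^sup>2 / vrec c a b (real k) i)
     = (\<Sum>i\<le>D. kap i) / jK a off D x"
proof -
  have "(vrec c a b x i)\<^sup>2 / vrec c a b (real k) i = (ju a off x i)\<^sup>2" if "i \<le> D" for i
  proof -
    have "(vrec c a b x i)\<^sup>2 = kap i * (ju a off x i)\<^sup>2"
      unfolding vrec_eq[OF that] power_mult_distrib using kap_pos[OF that] by simp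
    thus ?thesis unfolding vrec_k[OF that] using kap_pos[OF that] by simp
  qed
  thus ?thesis unfolding jK_def by (simp add: vrec_k atLeast0AtMost)
qed

lemma sum_kap_pos: "(\<Sum>i\<le>D. kap i) > 0"
  by (rule sum_pos) (auto simp: kap_pos)

text \<open>The invariant says that consecutive entries of the unsymmetrised vector have ratio at
  least \<open>sqrt (\<gamma> / \<beta>)\<close>. The row equation, with row sum \<open>k\<close>,
  carries it one index further by \<open>threshold_ineq\<close>; the start is the same inequality
  with \<open>c = 0\<close>.\<close>

lemma growing_prefix:
  fixes x \<beta> \<gamma> :: real
  assumes X: "X < D" and \<gamma>: "0 < \<gamma>" "\<gamma> \<le> \<beta>"
    and b: "\<And>m. m \<le> X \<Longrightarrow> b m \<ge> \<beta>" and c: "\<And>m. 1 \<le> m \<Longrightarrow> m \<le> X \<Longrightarrow> c m \<le> \<gamma>"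
    and x: "x \<ge> k - (sqrt \<beta> - sqrt \<gamma>)\<^sup>2" and i: "i \<le> X"
  shows "ju a off x i > 0" and "ju a off x (Suc i) > 0"
    and "i < X \<Longrightarrow> ju a off x i \<le> ju a off x (Suc i)"
proof -
  define \<tau> where "\<tau> = sqrt (\<gamma> / \<beta>)"
  have \<tau>: "\<tau> > 0" using \<gamma> by (simp add: \<tau>_def)
  have y: "real k - x \<le> (sqrt \<beta> - sqrt \<gamma>)\<^sup>2" using x by simp
  have inv: "ju a off x i > 0 \<and> off i * ju a off x (Suc i) \<ge> \<tau> * b i * ju a off x i" if "i \<le> X" for i
    using that
  proof (induction i)
    case 0
    have "\<tau> * b 0 \<le> b 0 + 0 - (k - x) - 0 / \<tau>"
      unfolding \<tau>_def using \<gamma> b[of 0] y by (intro threshold_ineq) auto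
    thus ?case using a0 b0 ju_0_rec[of x] by simp
  next
    case (Suc i)
    let ?u = "ju a off x"
    have u: "?u i > 0" "off i * ?u (Suc i) \<ge> \<tau> * b i * ?u i" using Suc by auto
    have bi: "b i > 0" using b[of i] \<gamma> Suc.prems by simp
    have "off i * ?u (Suc i) > 0"
      by (rule less_le_trans[OF _ u(2)]) (intro mult_pos_pos bi \<tau> u(1))
    hence up: "?u (Suc i) > 0" using s_pos[of i] by (rule zero_less_mult_pos)
    have "\<tau> * b (Suc i) \<le> b (Suc i) + c (Suc i) - (k - x) - c (Suc i) / \<tau>"
      unfolding \<tau>_def using \<gamma> b[of "Suc i"] c[of "Suc i"] y Suc.prems by (intro threshold_ineq) auto
    hence th: "\<tau> * b (Suc i) \<le> x - a (Suc i) - c (Suc i) / \<tau>"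
      using row[of "Suc i"] Suc.prems X by simp
    have "off i * ?u i \<le> c (Suc i) / \<tau> * ?u (Suc i)"
    proof -
      have "\<tau> * b i * (off i * ?u i) = off i * (\<tau> * b i * ?u i)" by simp
      also have "\<dots> \<le> off i * (off i * ?u (Suc i))" using u(2) s_pos[of i] by (intro mult_left_mono) auto
      also have "\<dots> = b i * c (Suc i) * ?u (Suc i)"
        using off_sq[of i] Suc.prems X by (simp add: mult.assoc[symmetric])
      also have "\<dots> = \<tau> * b i * (c (Suc i) / \<tau> * ?u (Suc i))" using \<tau> by simp
      finally show ?thesis using bi \<tau> by (simp only: mult_le_cancel_left_pos[OF mult_pos_pos])
    qed
    hence "(x - a (Suc i) - c (Suc i) / \<tau>) * ?u (Suc i) \<le> off (Suc i) * ?u (Suc (Suc i))"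
      using ju_rec[of i x] by (simp add: algebra_simps)
    moreover have "\<tau> * b (Suc i) * ?u (Suc i) \<le> (x - a (Suc i) - c (Suc i) / \<tau>) * ?u (Suc i)"
      using th up by (intro mult_right_mono) auto
    ultimately show ?case using up by linarith
  qed
  show pos: "ju a off x i > 0" using inv i by blast
  have bi: "b i > 0" using b[of i] \<gamma> i by simp
  have "off i * ju a off x (Suc i) > 0"
    by (rule less_le_trans[OF _ conjunct2[OF inv[OF i]]]) (intro mult_pos_pos bi \<tau> pos)
  thus "ju a off x (Suc i) > 0" using s_pos[of i] by (rule zero_less_mult_pos)
  assume iX: "i < X"
  have "off i \<le> \<tau> * b i"
    unfolding \<tau>_def off_def using iX X \<gamma> b[of i] c[of "Suc i"] c_ge[of "Suc i"]
    by (simp add: sqrt_ratio_step)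
  hence "off i * ju a off x i \<le> \<tau> * b i * ju a off x i" using pos by (intro mult_right_mono) auto
  also have "\<dots> \<le> off i * ju a off x (Suc i)" using inv[OF i] by blast
  finally show "ju a off x i \<le> ju a off x (Suc i)" using s_pos[of i] by (simp only: mult_le_cancel_left_pos)
qed

lemma growing_prefix_le:
  fixes x \<beta> \<gamma> :: real
  assumes "X < D" "0 < \<gamma>" "\<gamma> \<le> \<beta>"
    and "\<And>m. m \<le> X \<Longrightarrow> b m \<ge> \<beta>" "\<And>m. 1 \<le> m \<Longrightarrow> m \<le> X \<Longrightarrow> c m \<le> \<gamma>"
    and "x \<ge> k - (sqrt \<beta> - sqrt \<gamma>)\<^sup>2" "i \<le> X"
  shows "ju a off x i \<le> ju a off x X"
  using assms(7)
proof (induction i rule: inc_induct)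
  case (step n)
  have "ju a off x n \<le> ju a off x (Suc n)"
    by (rule growing_prefix(3)[OF assms(1-6)]) (use step in auto)
  thus ?case using step by linarith
qed simp

text \<open>The ratio \<open>u\<^sub>i\<^sub>+\<^sub>1 / u\<^sub>i\<close> increases with slope at least \<open>1 / s\<^sub>i\<close> in the spectral parameter.\<close>

lemma prefix_ratio:
  fixes x z \<beta> \<gamma> :: real
  assumes X: "X < D" "0 < \<gamma>" "\<gamma> \<le> \<beta>"
    and bc: "\<And>m. m \<le> X \<Longrightarrow> b m \<ge> \<beta>" "\<And>m. 1 \<le> m \<Longrightarrow> m \<le> X \<Longrightarrow> c m \<le> \<gamma>"
    and x: "x \<ge> k - (sqrt \<beta> - sqrt \<gamma>)\<^sup>2" "x \<le> k" and z: "x \<le> z"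
  shows "(1 + (z - x) / k) ^ X * ju a off x X \<le> ju a off z X"
proof -
  let ?u = "ju a off x" and ?v = "ju a off z"
  have z': "z \<ge> k - (sqrt \<beta> - sqrt \<gamma>)\<^sup>2" using x z by simp
  note ux = growing_prefix[OF X bc x(1)] and uz = growing_prefix[OF X bc z']
  define t where "t = (z - x) / k"
  have kt: "real k * t = z - x" using k_ge_1 by (simp add: t_def)
  \<comment> \<open>The Casoratian of the solutions at \<open>z\<close> and \<open>x\<close> obeys
    the Christoffel-Darboux recursion. Its earlier value is nonnegative and is dropped; what is
    left, \<open>(z - x) * u * v\<close>, becomes the relative gain \<open>t\<close> because
    \<open>off * u\<close> at the next index is at most \<open>k * u\<close>.\<close>
  have key: "?v (Suc i) * ?u i - ?u (Suc i) * ?v i \<ge> t * ?u (Suc i) * ?v i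
    \<and> ?v (Suc i) * ?u i \<ge> ?u (Suc i) * ?v i" if "i \<le> X" for i
    using that
  proof (induction i)
    case 0
    have "off 0 * (t * ?u 1) \<le> k * t"
    proof -
      have "off 0 * (t * ?u 1) = t * x" using a0 ju_0_rec[of x] by (simp add: mult.left_commute)
      also have "\<dots> \<le> t * k" using x z by (intro mult_left_mono) (auto simp: t_def)
      finally show ?thesis by (simp add: mult.commute)
    qed
    also have "\<dots> = off 0 * (?v 1 - ?u 1)"
      using kt ju_0_rec[of x] ju_0_rec[of z] by (simp add: right_diff_distrib)
    finally have "t * ?u 1 \<le> ?v 1 - ?u 1" using s_pos[of 0] by (simp only: mult_le_cancel_left_pos)
    moreover have "0 \<le> t * ?u 1" using ux(2)[of 0] z by (simp add: t_def)
    ultimately show ?case by simp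
  next
    case (Suc i)
    have IH: "?v (Suc i) * ?u i \<ge> ?u (Suc i) * ?v i" using Suc by simp
    have p: "?u i > 0" "?v i > 0" "?u (Suc i) > 0" "?v (Suc i) > 0" "?u (Suc (Suc i)) > 0"
      using ux(1)[of i] uz(1)[of i] ux(1)[of "Suc i"] uz(1)[of "Suc i"] ux(2)[of "Suc i"] Suc.prems by auto
    have ru: "off (Suc i) * ?u (Suc (Suc i)) = (x - a (Suc i)) * ?u (Suc i) - off i * ?u i"
      and rv: "off (Suc i) * ?v (Suc (Suc i)) = (z - a (Suc i)) * ?v (Suc i) - off i * ?v i"
      using ju_rec[of i x] ju_rec[of i z] by simp_all
    have "off (Suc i) * (?v (Suc (Suc i)) * ?u (Suc i) - ?u (Suc (Suc i)) * ?v (Suc i))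
      = (off (Suc i) * ?v (Suc (Suc i))) * ?u (Suc i) - (off (Suc i) * ?u (Suc (Suc i))) * ?v (Suc i)"
      by (simp add: algebra_simps)
    also have "\<dots> = (z - x) * (?u (Suc i) * ?v (Suc i)) + off i * (?v (Suc i) * ?u i - ?u (Suc i) * ?v i)"
      unfolding ru rv by (simp add: algebra_simps)
    also have "\<dots> \<ge> (z - x) * (?u (Suc i) * ?v (Suc i))"
      using IH s_pos[of i] by simp
    finally have 1: "off (Suc i) * (?v (Suc (Suc i)) * ?u (Suc i) - ?u (Suc (Suc i)) * ?v (Suc i))
      \<ge> (z - x) * (?u (Suc i) * ?v (Suc i))" .
    have "off (Suc i) * ?u (Suc (Suc i)) \<le> k * ?u (Suc i)"
    proof -
      have "off (Suc i) * ?u (Suc (Suc i)) \<le> (x - a (Suc i)) * ?u (Suc i)"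
        unfolding ru using p s_pos[of i] by simp
      also have "\<dots> \<le> k * ?u (Suc i)"
        using p x a_nonneg[of "Suc i"] by (intro mult_right_mono) auto
      finally show ?thesis .
    qed
    hence "t * ?v (Suc i) * (off (Suc i) * ?u (Suc (Suc i))) \<le> t * ?v (Suc i) * (k * ?u (Suc i))"
      using p z by (intro mult_left_mono) (auto simp: t_def)
    also have "\<dots> = (k * t) * (?u (Suc i) * ?v (Suc i))" by (simp add: mult_ac)
    also have "\<dots> \<le> off (Suc i) * (?v (Suc (Suc i)) * ?u (Suc i) - ?u (Suc (Suc i)) * ?v (Suc i))"
      unfolding kt by (rule 1)
    finally have "off (Suc i) * (t * ?u (Suc (Suc i)) * ?v (Suc i))
      \<le> off (Suc i) * (?v (Suc (Suc i)) * ?u (Suc i) - ?u (Suc (Suc i)) * ?v (Suc i))"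
      by (simp add: mult_ac)
    hence 2: "t * ?u (Suc (Suc i)) * ?v (Suc i) \<le> ?v (Suc (Suc i)) * ?u (Suc i) - ?u (Suc (Suc i)) * ?v (Suc i)"
      using s_pos[of "Suc i"] by (simp only: mult_le_cancel_left_pos)
    moreover have "0 \<le> t * ?u (Suc (Suc i)) * ?v (Suc i)"
      using p z by (simp add: t_def)
    ultimately show ?case by linarith
  qed
  have "(1 + t) ^ i * ?u i \<le> ?v i" if "i \<le> X" for i
    using that
  proof (induction i)
    case (Suc i)
    have p: "?u i > 0" "?u (Suc i) > 0" using ux(1)[of i] ux(2)[of i] Suc.prems by auto
    have "?u i * ((1 + t) ^ Suc i * ?u (Suc i)) = (1 + t) * ?u (Suc i) * ((1 + t) ^ i * ?u i)" by simp
    also have "\<dots> \<le> (1 + t) * ?u (Suc i) * ?v i"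
      using Suc p z by (intro mult_left_mono) (auto simp: t_def)
    also have "\<dots> \<le> ?u i * ?v (Suc i)"
      using key[of i] Suc.prems by (simp add: algebra_simps)
    finally show ?case using p by (simp only: mult_le_cancel_left_pos)
  qed simp
  thus ?thesis unfolding t_def by simp
qed

text \<open>At an eigenvalue the boundary condition at \<open>D\<close> makes \<open>u\<close> grow from the right end inwards.\<close>

lemma decaying_suffix:
  fixes x \<beta> \<gamma> :: real
  assumes x: "x \<in> spec D" and Y: "1 \<le> Y" "Y \<le> D" and \<beta>: "0 < \<beta>" "\<beta> \<le> \<gamma>"
    and b: "\<And>m. Y \<le> m \<Longrightarrow> m \<le> D \<Longrightarrow> b m \<le> \<beta>" and c: "\<And>m. Y \<le> m \<Longrightarrow> m \<le> D \<Longrightarrow> c m \<ge> \<gamma>"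
    and xb: "x \<ge> k - (sqrt \<gamma> - sqrt \<beta>)\<^sup>2" and i: "Y \<le> i" "i \<le> D"
  shows "\<bar>ju a off x i\<bar> \<le> \<bar>ju a off x Y\<bar>"
proof -
  define \<tau> where "\<tau> = sqrt (\<beta> / \<gamma>)"
  have \<tau>: "\<tau> > 0" using \<beta> by (simp add: \<tau>_def)
  have y: "real k - x \<le> (sqrt \<gamma> - sqrt \<beta>)\<^sup>2" using xb by simp
  have end0: "ju a off x (Suc D) = 0" using x by (simp add: spec_def)
  \<comment> \<open>Two consecutive zeros at \<open>D\<close> and \<open>D + 1\<close> would make
    the confluent Christoffel-Darboux sum vanish.\<close>
  have uD: "ju a off x D \<noteq> 0"
  proof
    assume "ju a off x D = 0"
    hence "jK a off D x = 0" unfolding jK_def christoffel_darboux_confluent by (simp add: end0)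
    thus False using jK_pos[of D x] by simp
  qed
  \<comment> \<open>The sign is normalised at the right end, where the backward induction
    starts.\<close>
  define w where "w i = sgn (ju a off x D) * ju a off x i" for i
  have w_abs: "\<bar>w i\<bar> = \<bar>ju a off x i\<bar>" for i
    using uD unfolding w_def abs_mult by (simp add: abs_sgn_eq)
  have w_rec: "off (Suc i) * w (Suc (Suc i)) = (x - a (Suc i)) * w (Suc i) - off i * w i" for i
  proof -
    have "off (Suc i) * w (Suc (Suc i)) = sgn (ju a off x D) * (off (Suc i) * ju a off x (Suc (Suc i)))"
      by (simp add: w_def)
    also have "off (Suc i) * ju a off x (Suc (Suc i)) = (x - a (Suc i)) * ju a off x (Suc i) - off i * ju a off x i"
      using ju_rec[of i x] by simp
    finally show ?thesis by (simp add: w_def algebra_simps)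
  qed
  have th: "\<tau> * c m \<le> x - a m - b m / \<tau>" if "Y \<le> m" "m \<le> D" for m
  proof -
    have "\<tau> * c m \<le> c m + b m - (k - x) - b m / \<tau>"
      unfolding \<tau>_def using \<beta> b[OF that] c[OF that] y by (intro threshold_ineq) auto
    thus ?thesis using row[of m] that Y by simp
  qed
  \<comment> \<open>Mirror image of the invariant in \<open>growing_prefix\<close>, with
    \<open>b\<close> and \<open>c\<close> exchanged and run downwards from \<open>D\<close>; the
    start uses \<open>u = 0\<close> at index \<open>D + 1\<close> and
    \<open>b D = 0\<close>.\<close>
  have inv: "w (Suc i) > 0 \<and> off i * w i \<ge> \<tau> * c (Suc i) * w (Suc i)" if "Suc i \<le> D" "Y \<le> Suc i" for i
    using that
  proof (induction "D - Suc i" arbitrary: i)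
    case 0
    hence D: "D = Suc i" by simp
    have "w D = \<bar>ju a off x D\<bar>" unfolding w_def abs_sgn by (rule mult.commute)
    hence pos: "w D > 0" using uD by simp
    have "w (Suc D) = 0" unfolding w_def end0 by simp
    hence "off i * w i = (x - a D) * w D"
      using w_rec[of i] unfolding D[symmetric] by simp
    moreover have "\<tau> * c D * w D \<le> (x - a D) * w D"
      using th[of D] Y bD pos by (intro mult_right_mono) auto
    ultimately show ?case using pos D by simp
  next
    case (Suc n)
    have j: "Suc (Suc i) \<le> D" "Y \<le> Suc (Suc i)" "n = D - Suc (Suc i)" using Suc by auto
    have IH: "w (Suc (Suc i)) > 0" "off (Suc i) * w (Suc i) \<ge> \<tau> * c (Suc (Suc i)) * w (Suc (Suc i))"
      using Suc.hyps(1)[OF j(3,1,2)] by auto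
    have cp: "c (Suc (Suc i)) > 0" using c_ge[of "Suc (Suc i)"] j by simp
    have "off (Suc i) * w (Suc i) > 0"
      by (rule less_le_trans[OF _ IH(2)]) (intro mult_pos_pos cp \<tau> IH(1))
    hence wp: "w (Suc i) > 0" using s_pos[of "Suc i"] by (rule zero_less_mult_pos)
    have "off (Suc i) * w (Suc (Suc i)) \<le> b (Suc i) / \<tau> * w (Suc i)"
    proof -
      have "\<tau> * c (Suc (Suc i)) * (off (Suc i) * w (Suc (Suc i))) = off (Suc i) * (\<tau> * c (Suc (Suc i)) * w (Suc (Suc i)))"
        by simp
      also have "\<dots> \<le> off (Suc i) * (off (Suc i) * w (Suc i))"
        using IH(2) s_pos[of "Suc i"] by (intro mult_left_mono) auto
      also have "\<dots> = b (Suc i) * c (Suc (Suc i)) * w (Suc i)"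
        using off_sq[of "Suc i"] j by (simp add: mult.assoc[symmetric])
      also have "\<dots> = \<tau> * c (Suc (Suc i)) * (b (Suc i) / \<tau> * w (Suc i))" using \<tau> by simp
      finally show ?thesis using cp \<tau> by (simp only: mult_le_cancel_left_pos[OF mult_pos_pos])
    qed
    hence "(x - a (Suc i) - b (Suc i) / \<tau>) * w (Suc i) \<le> off i * w i"
      using w_rec[of i] by (simp add: algebra_simps)
    moreover have "\<tau> * c (Suc i) * w (Suc i) \<le> (x - a (Suc i) - b (Suc i) / \<tau>) * w (Suc i)"
      using th[of "Suc i"] Suc.prems wp by (intro mult_right_mono) auto
    ultimately show ?case using wp by linarith
  qed
  have step: "\<bar>w (Suc i)\<bar> \<le> \<bar>w i\<bar>" if "Suc i \<le> D" "Y \<le> i" for i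
  proof -
    have I: "w (Suc i) > 0" "off i * w i \<ge> \<tau> * c (Suc i) * w (Suc i)" using inv[of i] that by auto
    have "sqrt (c (Suc i) * b i) \<le> sqrt (\<beta> / \<gamma>) * c (Suc i)"
      using \<beta> b[of i] c[of "Suc i"] b_nonneg[of i] that by (intro sqrt_ratio_step) auto
    hence "off i \<le> \<tau> * c (Suc i)" using that by (simp add: off_def \<tau>_def mult.commute)
    hence "off i * w (Suc i) \<le> \<tau> * c (Suc i) * w (Suc i)" using I by (intro mult_right_mono) auto
    also have "\<dots> \<le> off i * w i" by (rule I(2))
    finally have "w (Suc i) \<le> w i" using s_pos[of i] by (simp only: mult_le_cancel_left_pos)
    thus ?thesis using I(1) by simp
  qed
  have "\<bar>w i\<bar> \<le> \<bar>w Y\<bar>" using i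
  proof (induction i rule: dec_induct)
    case (step n)
    show ?case using step.IH \<open>\<And>i. Suc i \<le> D \<Longrightarrow> Y \<le> i \<Longrightarrow> \<bar>w (Suc i)\<bar> \<le> \<bar>w i\<bar>\<close>[of n] step by simp
  qed simp
  thus ?thesis unfolding w_abs .
qed

end

section \<open>Block sequences\<close>

context tridiagonal
begin

text \<open>Undoes the symmetrisation: for \<open>x\<close> in \<open>spec D\<close> this is the
  right eigenvector of the original matrix with first entry 1.\<close>

definition evec :: "real \<Rightarrow> nat \<Rightarrow> real" where
  "evec x i = ju a off x i / sqrt (kap i)"

lemma evec_row:
  assumes x: "x \<in> spec D" and i: "i \<le> D"
  shows "(if i = 0 then 0 else c i * evec x (i - 1)) + a i * evec x i
     + (if i = D then 0 else b i * evec x (i + 1)) = x * evec x i"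
proof -
  have up: "b i * evec x (i + 1) = off i * ju a off x (Suc i) / sqrt (kap i)" if "i < D" for i
    using sqrt_kap_Suc(1)[OF that] kap_pos[of i] kap_pos[of "Suc i"] that
    unfolding evec_def by (simp add: field_simps)
  have down: "c (Suc j) * evec x j = off j * ju a off x j / sqrt (kap (Suc j))" if "j < D" for j
    using sqrt_kap_Suc(2)[OF that] kap_pos[of j] kap_pos[of "Suc j"] that
    unfolding evec_def by (simp add: field_simps)
  have end0: "ju a off x (Suc D) = 0" using x by (simp add: spec_def)
  have right: "(if i = D then 0 else b i * evec x (i + 1)) = off i * ju a off x (Suc i) / sqrt (kap i)"
    using up[of i] i end0 by auto
  show ?thesis
  proof (cases i)
    case 0
    have "off 0 * ju a off x (Suc 0) = x" using ju_0_rec[of x] a0 by simp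
    thus ?thesis unfolding right unfolding 0 by (simp add: evec_def a0)
  next
    case (Suc j)
    have "off (Suc j) * ju a off x (Suc (Suc j)) = (x - a (Suc j)) * ju a off x (Suc j) - off j * ju a off x j"
      using ju_rec[of j x] by simp
    thus ?thesis unfolding right unfolding Suc using down[of j] i Suc
      by (simp add: evec_def add_divide_distrib[symmetric] diff_divide_distrib[symmetric] algebra_simps)
  qed
qed

text \<open>The eigenvector equation is read at an entry of maximal modulus; the coefficients of
  that row are nonnegative and sum to \<open>k\<close>.\<close>

lemma spec_abs_le:
  assumes x: "x \<in> spec D"
  shows "\<bar>x\<bar> \<le> k"
proof -
  define m where "m = Max ((\<lambda>i. \<bar>evec x i\<bar>) ` {..D})"
  have "m \<in> (\<lambda>i. \<bar>evec x i\<bar>) ` {..D}" unfolding m_def by (rule Max_in) auto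
  then obtain i where i: "i \<le> D" "m = \<bar>evec x i\<bar>" by auto
  have le: "\<bar>evec x j\<bar> \<le> m" if "j \<le> D" for j unfolding m_def using that by (intro Max_ge) auto
  have "evec x 0 = 1" by (simp add: evec_def kap_def)
  hence m0: "m > 0" using le[of 0] by simp
  have ci: "1 \<le> i \<Longrightarrow> c i \<ge> 0" using c_ge[of i] i by simp
  have "\<bar>x\<bar> * m = \<bar>x * evec x i\<bar>" by (simp add: abs_mult i)
  also have "\<dots> \<le> \<bar>if i = 0 then 0 else c i * evec x (i - 1)\<bar> + \<bar>a i * evec x i\<bar>
     + \<bar>if i = D then 0 else b i * evec x (i + 1)\<bar>"
    unfolding evec_row[OF x i(1), symmetric] by linarith
  also have "\<dots> \<le> (if i = 0 then 0 else c i * m) + a i * m + b i * m"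
  proof (intro add_mono)
    show "\<bar>if i = 0 then 0 else c i * evec x (i - 1)\<bar> \<le> (if i = 0 then 0 else c i * m)"
      using le[of "i - 1"] ci i by (auto simp: abs_mult intro!: mult_left_mono)
    show "\<bar>a i * evec x i\<bar> \<le> a i * m" using a_nonneg[of i] by (simp add: abs_mult i)
    show "\<bar>if i = D then 0 else b i * evec x (i + 1)\<bar> \<le> b i * m"
      using le[of "i + 1"] b_nonneg[of i] i m0 by (auto simp: abs_mult intro!: mult_left_mono)
  qed
  also have "\<dots> = k * m"
  proof (cases "i = 0")
    case True
    thus ?thesis using a0 b0 by simp
  next
    case False
    hence "c i + a i + b i = k" using row[of i] i by simp
    thus ?thesis using False by (simp flip: distrib_right)
  qed
  finally show ?thesis using m0 by simp
qed

end

text \<open>For a triple with sum \<open>k\<close> this equals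
  \<open>\<alpha> + 2 * sqrt (\<beta> * \<gamma>)\<close>, the top of the spectrum of the infinite
  Jacobi matrix with constant coefficients.\<close>

definition gR :: "nat \<Rightarrow> (nat \<times> nat \<times> nat) list \<Rightarrow> nat \<Rightarrow> real" where
  "gR k Gs i = real k - (sqrt (gbet Gs i) - sqrt (ggam Gs i))\<^sup>2"

section \<open>The array of a block sequence and its integer characteristic polynomial\<close>

locale block_sequence =
  fixes k lam :: nat and Gs :: "(nat \<times> nat \<times> nat) list" and l :: "nat \<Rightarrow> nat"
  assumes lam: "lam + 2 \<le> k" and gr: "graphical k lam Gs"
    and l_pos: "\<And>i. 1 \<le> i \<Longrightarrow> i \<le> length Gs \<Longrightarrow> l i \<ge> 1"
    and l_last: "l (length Gs) = 1"
begin

definition g :: nat where "g = length Gs - 1"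
abbreviation D :: nat where "D \<equiv> diam Gs l"

lemma delta_1: "gdelta Gs 1 = (1, lam, k - lam - 1)"
  and delta_in: "1 \<le> i \<Longrightarrow> i \<le> g \<Longrightarrow> gdelta Gs i \<in> Vset k lam"
  and bet_step: "1 \<le> i \<Longrightarrow> i < g \<Longrightarrow> gbet Gs (Suc i) \<le> gbet Gs i"
  and gam_step: "1 \<le> i \<Longrightarrow> i \<le> g \<Longrightarrow> ggam Gs i \<le> ggam Gs (Suc i)"
  and bet_last: "gbet Gs (Suc g) = 0" and row_last: "ggam Gs (Suc g) + galp Gs (Suc g) = k"
  and dist: "distinct Gs" and ne: "Gs \<noteq> []"
  using gr unfolding graphical_def Let_def g_def by auto

lemma len: "length Gs = Suc g"
  unfolding g_def using ne by (cases Gs) auto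

lemma g_ge: "g \<ge> 1"
proof (rule ccontr)
  assume "\<not> g \<ge> 1"
  hence "g = 0" by simp
  hence "gbet Gs 1 = 0" using bet_last by simp
  thus False using delta_1 lam by (simp add: gbet_def)
qed

lemma delta_range:
  assumes "1 \<le> i" "i \<le> g"
  shows "1 \<le> gbet Gs i" "gbet Gs i \<le> k - lam - 1" "1 \<le> ggam Gs i" "ggam Gs i \<le> k - lam - 1"
    "ggam Gs i + galp Gs i + gbet Gs i = k"
  using delta_in[OF assms] unfolding Vset_def gbet_def ggam_def galp_def by auto

lemma bet_antimono:
  assumes "1 \<le> i" "i \<le> j" "j \<le> Suc g"
  shows "gbet Gs j \<le> gbet Gs i"
  using assms(2,3)
proof (induction j rule: dec_induct)
  case (step j)
  thus ?case using bet_step[of j] bet_last assms(1) by (cases "j = g") auto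
qed simp

lemma gam_mono:
  assumes "1 \<le> i" "i \<le> j" "j \<le> Suc g"
  shows "ggam Gs i \<le> ggam Gs j"
  using assms(2,3)
proof (induction j rule: dec_induct)
  case (step j)
  thus ?case using gam_step[of j] assms(1) by auto
qed simp

lemma spos_1: "spos l 1 = 1" and spos_Suc: "1 \<le> i \<Longrightarrow> spos l (Suc i) = spos l i + l i"
  by (simp_all add: spos_def)

lemma spos_mono: "i \<le> j \<Longrightarrow> spos l i \<le> spos l j"
  unfolding spos_def by (intro add_mono sum_mono2) auto

lemma spos_ge: "spos l i \<ge> 1"
  by (simp add: spos_def)

lemma diam_eq: "D = spos l (Suc g)"
  unfolding diam_def len ..

lemma spos_less_diam: "1 \<le> i \<Longrightarrow> i \<le> g \<Longrightarrow> spos l (Suc i) \<le> D"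
  unfolding diam_eq by (rule spos_mono) simp

lemma tri_eq:
  assumes i: "1 \<le> i" "i \<le> Suc g" and m: "spos l i \<le> m" "m < spos l (Suc i)"
  shows "tri Gs l m = gdelta Gs i"
proof -
  have "(THE i. i \<in> {1..length Gs} \<and> spos l i \<le> m \<and> m < spos l i + l i) = i"
  proof (rule the_equality)
    show "i \<in> {1..length Gs} \<and> spos l i \<le> m \<and> m < spos l i + l i"
      using assms spos_Suc[of i] len by simp
    fix j assume j: "j \<in> {1..length Gs} \<and> spos l j \<le> m \<and> m < spos l j + l j"
    hence j': "1 \<le> j" "spos l j \<le> m" "m < spos l (Suc j)" using spos_Suc[of j] by auto
    show "j = i"
    proof (rule ccontr)
      assume "j \<noteq> i"
      hence "Suc j \<le> i \<or> Suc i \<le> j" by auto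
      thus False using spos_mono[of "Suc j" i] spos_mono[of "Suc i" j] m j' by auto
    qed
  qed
  thus ?thesis unfolding tri_def by simp
qed

lemma block_exists:
  assumes "1 \<le> m" "m \<le> D"
  obtains i where "1 \<le> i" "i \<le> Suc g" "spos l i \<le> m" "m < spos l (Suc i)"
proof -
  define i where "i = Max {i \<in> {1..Suc g}. spos l i \<le> m}"
  have "1 \<in> {i \<in> {1..Suc g}. spos l i \<le> m}" using assms spos_1 by simp
  hence "i \<in> {i \<in> {1..Suc g}. spos l i \<le> m}" unfolding i_def by (intro Max_in) auto
  hence i: "1 \<le> i" "i \<le> Suc g" "spos l i \<le> m" by auto
  have "m < spos l (Suc i)"
  proof (rule ccontr)
    assume *: "\<not> m < spos l (Suc i)"
    show False
    proof (cases "i = Suc g")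
      case True
      thus False using * assms(2) diam_eq spos_Suc[of i] i l_last len by simp
    next
      case False
      hence "Suc i \<in> {i \<in> {1..Suc g}. spos l i \<le> m}" using i * by auto
      hence "Suc i \<le> i" unfolding i_def[of] by (intro Max_ge) auto
      thus False by simp
    qed
  qed
  thus ?thesis using that i by blast
qed

lemma arrays_eq:
  assumes "1 \<le> i" "i \<le> Suc g" "spos l i \<le> m" "m < spos l (Suc i)"
  shows "cT Gs l m = ggam Gs i" "aT Gs l m = galp Gs i" "bT k Gs l m = gbet Gs i"
  using tri_eq[OF assms] assms spos_ge[of i]
  unfolding cT_def aT_def bT_def ggam_def galp_def gbet_def by auto

lemma tridiagonal: "tridiagonal k D (aT Gs l) (bT k Gs l) (cT Gs l)"
proof
  show "D \<ge> 1" unfolding diam_eq by (rule spos_ge)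
  show "bT k Gs l 0 = k" "aT Gs l 0 = 0" by (simp_all add: bT_def aT_def)
  have "spos l (Suc 1) = 1 + l 1" using spos_Suc[of 1] spos_1 by simp
  hence "cT Gs l 1 = ggam Gs 1"
    using arrays_eq(1)[of 1 1] spos_1 l_pos[of 1] len by simp
  thus "cT Gs l 1 = 1" using delta_1 by (simp add: ggam_def)
  have DS: "D < spos l (Suc (Suc g))" using spos_Suc[of "Suc g"] diam_eq l_last len by simp
  thus "bT k Gs l D = 0" using arrays_eq(3)[of "Suc g" D] diam_eq bet_last by simp
  show "aT Gs l m \<ge> 0" for m by (simp add: aT_def)
  fix m
  show "cT Gs l m + aT Gs l m + bT k Gs l m = k" if m: "1 \<le> m" "m \<le> D"
  proof -
    obtain i where i: "1 \<le> i" "i \<le> Suc g" "spos l i \<le> m" "m < spos l (Suc i)" using block_exists[OF m] .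
    have "ggam Gs i + galp Gs i + gbet Gs i = k"
      using delta_range(5)[of i] row_last bet_last i by (cases "i = Suc g") auto
    thus ?thesis unfolding arrays_eq[OF i] by (simp flip: of_nat_add)
  qed
  show "cT Gs l m \<ge> 1" if m: "1 \<le> m" "m \<le> D"
  proof -
    obtain i where i: "1 \<le> i" "i \<le> Suc g" "spos l i \<le> m" "m < spos l (Suc i)" using block_exists[OF m] .
    have "ggam Gs 1 \<le> ggam Gs i" using gam_mono i by simp
    thus ?thesis unfolding arrays_eq[OF i] using delta_1 by (simp add: ggam_def)
  qed
  show "bT k Gs l m \<ge> 1" if m: "m < D"
  proof (cases "m = 0")
    case True
    thus ?thesis using lam by (simp add: bT_def)
  next
    case False
    then obtain i where i: "1 \<le> i" "i \<le> Suc g" "spos l i \<le> m" "m < spos l (Suc i)"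
      using block_exists[of m] m by auto
    have "i \<noteq> Suc g" using i(3) m diam_eq by auto
    thus ?thesis unfolding arrays_eq[OF i] using delta_range(1)[of i] i by simp
  qed
qed

sublocale tridiagonal k D "aT Gs l" "bT k Gs l" "cT Gs l"
  by (rule tridiagonal)

abbreviation u :: "real \<Rightarrow> nat \<Rightarrow> real" where "u \<equiv> ju (aT Gs l) off"
abbreviation K :: "real \<Rightarrow> real" where "K \<equiv> jK (aT Gs l) off D"

lemma L1_carrier: "L1 k Gs l \<in> carrier_mat (D + 1) (D + 1)"
  by (simp add: L1_def)

lemma spec_eigT:
  assumes x: "x \<in> spec D"
  shows "eigT k Gs l x"
proof -
  define v where "v = vec (D + 1) (evec x)"
  have v: "v \<in> carrier_vec (D + 1)" by (simp add: v_def)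
  have "v $ 0 = 1" by (simp add: v_def evec_def kap_def)
  hence nz: "v \<noteq> 0\<^sub>v (D + 1)" by auto
  have "L1 k Gs l *\<^sub>v v = x \<cdot>\<^sub>v v"
  proof (rule eq_vecI)
    fix i assume "i < dim_vec (x \<cdot>\<^sub>v v)"
    hence i: "i \<le> D" by (simp add: v_def)
    let ?f = "\<lambda>j. L1 k Gs l $$ (i, j) * evec x j"
    have "(L1 k Gs l *\<^sub>v v) $ i = (\<Sum>j = 0..<D + 1. ?f j)"
      using i L1_carrier by (simp add: v_def scalar_prod_def L1_def)
    also have "\<dots> = (\<Sum>j\<in>{j. j \<le> D \<and> (j = i \<or> j = i + 1 \<or> i = j + 1)}. ?f j)"
      using i by (intro sum.mono_neutral_right) (auto simp: L1_def)
    also have "{j. j \<le> D \<and> (j = i \<or> j = i + 1 \<or> i = j + 1)}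
       = (if i = 0 then {} else {i - 1}) \<union> ({i} \<union> (if i = D then {} else {i + 1}))"
      using i by auto
    also have "sum ?f \<dots> = (if i = 0 then 0 else cT Gs l i * evec x (i - 1))
       + (aT Gs l i * evec x i + (if i = D then 0 else bT k Gs l i * evec x (i + 1)))"
      using i by (subst sum.union_disjoint; (subst sum.union_disjoint)?) (auto simp: L1_def)
    also have "\<dots> = x * evec x i" using evec_row[OF x i] by simp
    finally show "(L1 k Gs l *\<^sub>v v) $ i = (x \<cdot>\<^sub>v v) $ i" using i by (simp add: v_def)
  qed (use L1_carrier in \<open>simp add: v_def L1_def\<close>)
  thus ?thesis
    unfolding eigT_def eigenvalue_def eigenvector_def using v nz L1_carrier by (auto simp: L1_def)
qed

text \<open>An integer copy of the matrix, so that its characteristic polynomial \<open>chi\<close>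
  is monic over the integers and the eigenvalues are algebraic integers.\<close>

definition L1_int :: "int mat" where
  "L1_int = mat (D + 1) (D + 1)
     (\<lambda>(i, j). if j = i then (if i = 0 then 0 else int (fst (snd (tri Gs l i))))
               else if j = i + 1 then (if i = 0 then int k else int (snd (snd (tri Gs l i))))
               else if i = j + 1 then int (fst (tri Gs l i)) else 0)"

lemma L1_int_carrier: "L1_int \<in> carrier_mat (D + 1) (D + 1)"
  by (simp add: L1_int_def)

definition chi :: "int poly" where "chi = char_poly L1_int"

lemma chi_monic: "lead_coeff chi = 1" "degree chi = D + 1"
  using degree_monic_char_poly[of L1_int "D + 1"] unfolding chi_def by (auto simp: L1_int_def)

lemma chi_root:
  assumes "x \<in> spec D"
  shows "ipoly_real chi x = 0"
proof -
  have "L1 k Gs l = map_mat real_of_int L1_int"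
    unfolding L1_def L1_int_def by (rule eq_matI) (auto simp: aT_def bT_def cT_def)
  moreover have "char_poly (map_mat real_of_int L1_int) = map_poly real_of_int (char_poly L1_int)"
    by (rule of_int_hom.char_poly_hom[OF L1_int_carrier])
  ultimately have "map_poly real_of_int chi = char_poly (L1 k Gs l)"
    by (simp add: chi_def)
  thus ?thesis
    using spec_eigT[OF assms] eigenvalue_root_char_poly[OF L1_carrier] unfolding eigT_def by simp
qed

lemma propAC_K:
  assumes AC: "propAC k Gs l" and xy: "x \<in> spec D" "y \<in> spec D" "alg_conj x y"
  shows "K x = K y"
proof -
  have "christoffel k Gs l x = christoffel k Gs l y"
    using AC spec_eigT xy unfolding propAC_def by blast
  hence "(\<Sum>i\<le>D. kap i) / K x = (\<Sum>i\<le>D. kap i) / K y"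
    unfolding christoffel_def vT_def christoffel_eq .
  thus ?thesis using sum_kap_pos jK_pos[of D x] jK_pos[of D y] by (simp add: field_simps)
qed

end

section \<open>Propagation of two consecutive values through blocks\<close>

lemma two_div_sqrt_ge_1:
  fixes \<omega> :: real
  assumes "0 < \<omega>" "\<omega> \<le> 1"
  shows "2 / sqrt \<omega> \<ge> 1"
proof -
  have "sqrt \<omega> \<le> 1" using real_sqrt_le_mono[OF assms(2)] by simp
  moreover have "0 < sqrt \<omega>" using assms(1) by simp
  ultimately show ?thesis by (subst pos_le_divide_eq) linarith+
qed

context block_sequence
begin

text \<open>Two consecutive values are the state of a second-order recurrence; one value alone may
  vanish and then bounds nothing that follows.\<close>

definition N :: "real \<Rightarrow> nat \<Rightarrow> real" where
  "N x m = \<bar>u x m\<bar> + \<bar>u x (m + 1)\<bar>"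

lemma N_nonneg: "N x m \<ge> 0"
  by (simp add: N_def)

lemma N_step:
  fixes x :: real
  assumes "\<bar>x\<bar> \<le> k" "m + 1 \<le> D"
  shows "N x (m + 1) \<le> real (2 * k + 1) * N x m"
proof -
  have "aT Gs l (m + 1) \<le> k" "aT Gs l (m + 1) \<ge> 0"
    using row[of "m + 1"] b_nonneg[of "m + 1"] c_ge[of "m + 1"] a_nonneg[of "m + 1"] assms by auto
  hence "\<bar>x - aT Gs l (m + 1)\<bar> \<le> 2 * real k" using assms by linarith
  from step_bound[OF off_le off_ge this] show ?thesis by (simp add: N_def add.commute)
qed

lemma N_pow:
  fixes x :: real
  assumes "\<bar>x\<bar> \<le> k" "m + j \<le> D"
  shows "N x (m + j) \<le> (2 * k + 1) ^ j * N x m"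
  using assms(2)
proof (induction j)
  case (Suc j)
  have "N x (m + Suc j) \<le> (2 * k + 1) * N x (m + j)"
    using N_step[OF assms(1), of "m + j"] Suc.prems by simp
  also have "\<dots> \<le> (2 * k + 1) * ((2 * k + 1) ^ j * N x m)"
    using Suc by (intro mult_left_mono) auto
  finally show ?case by (simp add: algebra_simps)
qed simp

text \<open>The crude bound, one factor per index; it is affordable only for blocks that are short
  compared with the head.\<close>

lemma N_short_block:
  fixes x :: real
  assumes x: "\<bar>x\<bar> \<le> k" and i: "1 \<le> i" "i \<le> g" "l i \<le> n"
    and m: "spos l i - 1 \<le> m" "m \<le> spos l (Suc i) - 1"
  shows "N x m \<le> (2 * k + 1) ^ n * N x (spos l i - 1)"
proof -
  define j where "j = m - (spos l i - 1)"
  have mj: "m = (spos l i - 1) + j" using m by (simp add: j_def)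
  have j: "j \<le> n" using m i spos_Suc[of i] spos_ge[of i] by (simp add: j_def)
  have "N x m \<le> (2 * k + 1) ^ j * N x (spos l i - 1)"
    unfolding mj by (rule N_pow[OF x]) (use mj m spos_less_diam[of i] i in simp)
  also have "\<dots> \<le> (2 * k + 1) ^ n * N x (spos l i - 1)"
    using j by (intro mult_right_mono N_nonneg) (auto intro!: power_increasing)
  finally show ?thesis .
qed

text \<open>Since \<open>gR = \<alpha> + 2 * \<sigma>\<close>, the parameter is
  \<open>\<xi> = 2 - (gR - x) / \<sigma>\<close>. With \<open>1 \<le> \<sigma> \<le> k\<close>,
  depth at most \<open>2 * \<delta> \<le> 1\<close> keeps it nonnegative and depth at least
  \<open>\<delta>\<close> keeps it below 2 by \<open>\<delta> / k\<close>, the source of the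
  definiteness constant \<open>\<delta> / (2 * k)\<close>.\<close>

lemma guide_parameters:
  fixes x \<sigma> :: real
  assumes i: "1 \<le> i" "i \<le> g" and \<delta>: "0 < \<delta>" "\<delta> \<le> 1 / 2"
    and x: "gR k Gs i - 2 * \<delta> \<le> x" "x \<le> gR k Gs i - \<delta>"
  defines "\<sigma> \<equiv> sqrt (real (gbet Gs i) * real (ggam Gs i))"
  obtains \<xi> where "x = galp Gs i + \<xi> * \<sigma>" "0 \<le> \<xi>" "\<xi> \<le> 2 - 2 * (\<delta> / (2 * k))" "\<sigma> \<ge> 1" "\<sigma> \<le> k"
proof -
  note r = delta_range[OF i]
  have b: "1 \<le> real (gbet Gs i)" "real (gbet Gs i) \<le> k" and c: "1 \<le> real (ggam Gs i)" "real (ggam Gs i) \<le> k"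
    using r by linarith+
  have s1: "\<sigma> \<ge> 1"
  proof -
    have "1 * 1 \<le> real (gbet Gs i) * real (ggam Gs i)" using b c by (intro mult_mono) auto
    thus ?thesis by (simp add: \<sigma>_def)
  qed
  have s2: "\<sigma> \<le> k"
  proof -
    have "real (gbet Gs i) * real (ggam Gs i) \<le> real k * real k" using b c by (intro mult_mono) auto
    hence "\<sigma> \<le> sqrt (real k * real k)" unfolding \<sigma>_def by (rule real_sqrt_le_mono)
    thus ?thesis by simp
  qed
  have R: "gR k Gs i = galp Gs i + 2 * \<sigma>"
    using arg_cong[OF r(5), of real] b c
    by (simp add: gR_def \<sigma>_def power2_diff real_sqrt_mult)
  have k0: "real k > 0" using s1 s2 by linarith
  show ?thesis
  proof (rule that[of "2 - (gR k Gs i - x) / \<sigma>"])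
    show "x = galp Gs i + (2 - (gR k Gs i - x) / \<sigma>) * \<sigma>"
      using s1 R by (simp add: left_diff_distrib)
    have "(gR k Gs i - x) / \<sigma> \<le> (gR k Gs i - x) / 1"
      using s1 x \<delta> by (intro divide_left_mono) auto
    thus "0 \<le> 2 - (gR k Gs i - x) / \<sigma>" using x \<delta> by simp
    have "\<delta> / k \<le> (gR k Gs i - x) / \<sigma>"
      using s1 s2 x \<delta> by (intro frac_le) auto
    thus "2 - (gR k Gs i - x) / \<sigma> \<le> 2 - 2 * (\<delta> / (2 * k))" by simp
  qed (fact s1 s2)+
qed

text \<open>The last index of the block is excluded because \<open>off\<close> there mixes the
  \<open>\<beta>\<close> of this block with the \<open>\<gamma>\<close> of the next.\<close>

lemma off_in_block:
  assumes "1 \<le> i" "i \<le> g" "spos l i \<le> m" "m + 1 < spos l (Suc i)"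
  shows "off m = sqrt (real (gbet Gs i) * real (ggam Gs i))"
  using assms arrays_eq(3)[of i m] arrays_eq(1)[of i "m + 1"] spos_less_diam[of i]
  by (simp add: off_def)

text \<open>The energy argument covers the pairs of indices inside the block; the step into the
  block and the step out of it each cost a crude factor \<open>2 * k + 1\<close>. The bound is
  independent of \<open>l i\<close>.\<close>

lemma N_guide_block:
  fixes x :: real
  assumes x: "\<bar>x\<bar> \<le> k" and i: "1 \<le> i" "i \<le> g" and \<delta>: "0 < \<delta>" "\<delta> \<le> 1 / 2"
    and xR: "gR k Gs i - 2 * \<delta> \<le> x" "x \<le> gR k Gs i - \<delta>"
    and m: "spos l i - 1 \<le> m" "m \<le> spos l (Suc i) - 1"
  shows "N x m \<le> 2 / sqrt (\<delta> / real (2 * k)) * (real (2 * k + 1))\<^sup>2 * N x (spos l i - 1)"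
proof -
  define A where "A = 2 / sqrt (\<delta> / real (2 * k))"
  define B where "B = real (2 * k + 1)"
  define p q where "p = spos l i" and "q = spos l (Suc i) - 1"
  have B1: "B \<ge> 1" unfolding B_def by simp
  have k1: "real k \<ge> 1" by (rule k_ge_1)
  have om: "0 < \<delta> / (2 * k)" "\<delta> / (2 * k) \<le> 1" using \<delta> k1 by (auto simp: field_simps)
  hence A1: "A \<ge> 1" unfolding A_def by (rule two_div_sqrt_ge_1)
  have pq: "1 \<le> p" "p \<le> q" "q \<le> D"
    using spos_ge[of i] spos_Suc[of i] l_pos[of i] i len spos_less_diam[of i] by (auto simp: p_def q_def)
  have step: "N x (j + 1) \<le> B * N x j" if "j + 1 \<le> D" for j
    using N_step[OF x that] by (simp add: B_def)
  have first: "N x p \<le> B * N x (p - 1)" using step[of "p - 1"] pq by simp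
  have mid: "N x j \<le> A * N x p" if j: "p \<le> j" "j + 1 \<le> q" for j
  proof -
    obtain \<xi> where \<xi>: "x = galp Gs i + \<xi> * sqrt (real (gbet Gs i) * real (ggam Gs i))"
      "0 \<le> \<xi>" "\<xi> \<le> 2 - 2 * (\<delta> / (2 * k))"
      using guide_parameters[OF i \<delta> xR] by blast
    show ?thesis unfolding N_def A_def
    proof (rule constant_block_bound[OF _ _ \<xi> om(1) j])
      show "aT Gs l t = galp Gs i" if "p < t" "t < q" for t
        using arrays_eq(2)[of i t] i that by (simp add: p_def q_def)
      show "off t = sqrt (real (gbet Gs i) * real (ggam Gs i))" if "p \<le> t" "t < q" for t
        using off_in_block[of i t] i that by (simp add: p_def q_def)
    qed
  qed
  have N0: "N x j \<ge> 0" for j by (rule N_nonneg)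
  have "N x m \<le> A * (B * (B * N x (p - 1)))"
  proof -
    have up: "y \<le> A * y" "y \<le> B * y" if "y \<ge> 0" for y
      using mult_right_mono[OF A1 that] mult_right_mono[OF B1 that] by simp_all
    have pos: "0 \<le> B * N x (p - 1)" "0 \<le> B * (B * N x (p - 1))"
      using B1 N0 by simp_all
    consider "m = p - 1" | "p \<le> m" "m + 1 \<le> q" | "m = q" "p < q" | "m = q" "p = q"
      using m pq by (fastforce simp: p_def q_def)
    thus ?thesis
    proof cases
      case 1
      thus ?thesis using up(2)[OF N0] up(2)[OF pos(1)] up(1)[OF pos(2)] by (metis order_trans)
    next
      case 2
      have "N x m \<le> A * N x p" using mid 2 .
      also have "\<dots> \<le> A * (B * N x (p - 1))" using first A1 by (intro mult_left_mono) auto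
      also have "\<dots> \<le> A * (B * (B * N x (p - 1)))" by (rule mult_left_mono[OF up(2)[OF pos(1)]]) (use A1 in simp)
      finally show ?thesis .
    next
      case 3
      have "N x m \<le> B * N x (q - 1)" using step[of "q - 1"] 3 pq by simp
      also have "\<dots> \<le> B * (A * N x p)" using mid[of "q - 1"] 3 B1 by (intro mult_left_mono) auto
      also have "\<dots> \<le> B * (A * (B * N x (p - 1)))" using first A1 B1 by (intro mult_left_mono) auto
      finally show ?thesis by (simp add: mult_ac)
    next
      case 4
      thus ?thesis using first up(2)[OF pos(1)] up(1)[OF pos(2)] by (metis order_trans)
    qed
  qed
  thus ?thesis unfolding A_def B_def p_def by (simp only: power2_eq_square mult_ac)
qed

text \<open>Once \<open>\<gamma>\<close> exceeds \<open>\<beta>\<close>, monotonicity of both only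
  drives them further apart, so right ends cannot rise afterwards. With the mirrored
  \<open>gR_descending\<close> this is the unimodality of the right ends.\<close>

lemma gR_ascending:
  assumes "1 \<le> i" "i < j" "j \<le> g" "gR k Gs i < gR k Gs j"
  shows "ggam Gs i \<le> gbet Gs i"
proof (rule ccontr)
  assume "\<not> ggam Gs i \<le> gbet Gs i"
  hence "gbet Gs j \<le> gbet Gs i" "gbet Gs i \<le> ggam Gs i" "ggam Gs i \<le> ggam Gs j"
    using bet_antimono[of i j] gam_mono[of i j] assms by auto
  hence "sqrt (gbet Gs j) \<le> sqrt (gbet Gs i)" "sqrt (gbet Gs i) \<le> sqrt (ggam Gs i)"
    "sqrt (ggam Gs i) \<le> sqrt (ggam Gs j)" by simp_all
  hence "(sqrt (ggam Gs i) - sqrt (gbet Gs i))\<^sup>2 \<le> (sqrt (ggam Gs j) - sqrt (gbet Gs j))\<^sup>2"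
    by (intro power_mono) linarith+
  thus False using assms(4) by (simp add: gR_def power2_commute)
qed

lemma gR_descending:
  assumes "1 \<le> j" "j < i" "i \<le> g" "gR k Gs i < gR k Gs j"
  shows "gbet Gs i \<le> ggam Gs i"
proof (rule ccontr)
  assume "\<not> gbet Gs i \<le> ggam Gs i"
  hence "gbet Gs i \<le> gbet Gs j" "ggam Gs i \<le> gbet Gs i" "ggam Gs j \<le> ggam Gs i"
    using bet_antimono[of j i] gam_mono[of j i] assms by auto
  hence "sqrt (gbet Gs i) \<le> sqrt (gbet Gs j)" "sqrt (ggam Gs i) \<le> sqrt (gbet Gs i)"
    "sqrt (ggam Gs j) \<le> sqrt (ggam Gs i)" by simp_all
  hence "(sqrt (gbet Gs i) - sqrt (ggam Gs i))\<^sup>2 \<le> (sqrt (gbet Gs j) - sqrt (ggam Gs j))\<^sup>2"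
    by (intro power_mono) linarith+
  thus False using assms(4) by (simp add: gR_def)
qed

lemma prefix_arrays:
  assumes "1 \<le> i" "i \<le> g" "m \<le> spos l (Suc i) - 1"
  shows "bT k Gs l m \<ge> gbet Gs i" "1 \<le> m \<Longrightarrow> cT Gs l m \<le> ggam Gs i"
proof -
  have *: "\<exists>j. 1 \<le> j \<and> j \<le> i \<and> spos l j \<le> m \<and> m < spos l (Suc j)" if m: "1 \<le> m"
  proof -
    have "m \<le> D" using spos_less_diam[of i] assms by simp
    then obtain j where j: "1 \<le> j" "j \<le> Suc g" "spos l j \<le> m" "m < spos l (Suc j)"
      using block_exists[of m] m by metis
    have "j \<le> i"
    proof (rule ccontr)
      assume "\<not> j \<le> i"
      hence "spos l (Suc i) \<le> spos l j" by (intro spos_mono) simp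
      thus False using j assms spos_ge[of "Suc i"] by linarith
    qed
    thus ?thesis using j by blast
  qed
  show "cT Gs l m \<le> ggam Gs i" if m: "1 \<le> m"
    using *[OF m] arrays_eq(1) gam_mono assms by fastforce
  show "bT k Gs l m \<ge> gbet Gs i"
  proof (cases "m = 0")
    case True
    thus ?thesis using delta_range(2)[of i] assms by (simp add: bT_def)
  next
    case False
    then obtain j where j: "1 \<le> j" "j \<le> i" "spos l j \<le> m" "m < spos l (Suc j)" using * by auto
    thus ?thesis using arrays_eq(3)[of j m] bet_antimono[of j i] assms by simp
  qed
qed

lemma suffix_arrays:
  assumes "1 \<le> i" "i \<le> g" "spos l i \<le> m" "m \<le> D"
  shows "bT k Gs l m \<le> gbet Gs i" "cT Gs l m \<ge> ggam Gs i"
proof -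
  obtain j where j: "1 \<le> j" "j \<le> Suc g" "spos l j \<le> m" "m < spos l (Suc j)"
    using block_exists[of m] assms spos_ge[of i] by (metis order_trans)
  have "i \<le> j"
  proof (rule ccontr)
    assume "\<not> i \<le> j"
    hence "spos l (Suc j) \<le> spos l i" by (intro spos_mono) simp
    thus False using j assms by linarith
  qed
  thus "bT k Gs l m \<le> gbet Gs i" "cT Gs l m \<ge> ggam Gs i"
    using arrays_eq[OF j] bet_antimono[of i j] gam_mono[of i j] j assms by simp_all
qed

text \<open>\<open>K(x)\<close> is at least \<open>u\<^sub>X(x)\<^sup>2\<close> and at most a subexponential factor times it, where \<open>X\<close> is the end of the
  last long block before those attaining the top right end \<open>gR k Gs i0\<close>; \<open>prefix_ratio\<close> separates
  \<open>u\<^sub>X(x)\<close> from \<open>u\<^sub>X(z)\<close>.\<close>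

lemma K_separation:
  assumes S: "S \<subseteq> {1..g}" "1 \<in> S" "i0 \<in> S" and short: "\<And>i. i \<in> {1..g} - S \<Longrightarrow> l i \<le> n"
    and top: "\<And>i. i \<in> S \<Longrightarrow> gR k Gs i \<le> gR k Gs i0" "gR k Gs 1 < gR k Gs i0"
    and gap: "\<And>i. i \<in> {1..g} \<Longrightarrow> gR k Gs i < gR k Gs i0 \<Longrightarrow> gR k Gs i \<le> gR k Gs i0 - 2 * \<delta>"
    and \<delta>: "0 < \<delta>" "\<delta> \<le> 1 / 2"
    and x: "x \<in> spec D" "gR k Gs i0 - 2 * \<delta> \<le> x" "x \<le> gR k Gs i0 - \<delta>"
    and z: "z \<in> spec D" "x \<le> z" and Kxz: "K x = K z"
  shows "(1 + (z - x) / k) ^ (2 * l 1) \<le>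
    real (D + 1) * (2 * real (2 * k + 1) * (2 / sqrt (\<delta> / real (2 * k)) * real (2 * k + 1) ^ (n + 2)) ^ g)\<^sup>2"
proof -
  define M where "M = gR k Gs i0"
  define A B \<Phi> where "A = 2 / sqrt (\<delta> / real (2 * k))" and "B = real (2 * k + 1)" and "\<Phi> = A * B ^ (n + 2)"
  have k1: "real k \<ge> 1" by (rule k_ge_1)
  have B1: "B \<ge> 1" unfolding B_def by simp
  have om: "0 < \<delta> / (2 * k)" "\<delta> / (2 * k) \<le> 1" using \<delta> k1 by (auto simp: field_simps)
  hence A1: "A \<ge> 1" unfolding A_def by (rule two_div_sqrt_ge_1)
  have Phi1: "\<Phi> \<ge> 1" unfolding \<Phi>_def using A1 B1 by (metis mult_mono one_le_power mult_1 zero_le_one order_trans)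
  have xk: "\<bar>x\<bar> \<le> k" using spec_abs_le[OF x(1)] .
  have finS: "finite S" using S(1) by (rule finite_subset) simp
  define G where "G = {i \<in> S. gR k Gs i = M}"
  have G: "finite G" "G \<noteq> {}" using finS S(3) by (auto simp: G_def M_def)
  define f where "f = Min G"
  define e where "e = Max G"
  have f: "f \<in> G" "\<And>i. i \<in> G \<Longrightarrow> f \<le> i" unfolding f_def using G by auto
  have e: "e \<in> G" "\<And>i. i \<in> G \<Longrightarrow> i \<le> e" unfolding e_def using G by auto
  have low: "gR k Gs i < M" if "i \<in> S - G" for i
    using top(1)[of i] that by (auto simp: G_def M_def)
  have f1: "f > 1"
  proof -
    have "f \<noteq> 1" using f(1) top(2) by (auto simp: G_def M_def)
    moreover have "f \<ge> 1" using f(1) S(1) by (auto simp: G_def)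
    ultimately show ?thesis by simp
  qed
  define i1 where "i1 = Max {i \<in> S. i < f}"
  have "i1 \<in> {i \<in> S. i < f}" unfolding i1_def using finS S(2) f1 by (intro Max_in) auto
  hence i1: "i1 \<in> S" "i1 < f" by auto
  have i1max: "i \<le> i1" if "i \<in> S" "i < f" for i unfolding i1_def using finS that by (intro Max_ge) auto
  have i1r: "1 \<le> i1" "i1 \<le> g" using i1 S(1) by auto
  have eg: "1 \<le> e" "e \<le> g" "1 \<le> f" "f \<le> g" using e(1) f(1) S(1) by (auto simp: G_def)
  have Ri1: "gR k Gs i1 < M" using low[of i1] f(2)[of i1] i1 by fastforce
  have asc: "ggam Gs i1 \<le> gbet Gs i1"
    using gR_ascending[of i1 f] i1 i1r eg Ri1 f(1) by (auto simp: G_def)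
  \<comment> \<open>\<open>X\<close> closes the last long block before the first one attaining
    \<open>M\<close>. Block 1 lies in this prefix, so \<open>X\<close> is at least
    \<open>l 1\<close>, whence the exponent in the conclusion.\<close>
  define X where "X = spos l (Suc i1) - 1"
  have X: "X < D" "1 \<le> X" "l 1 \<le> X"
  proof -
    have "spos l (Suc 1) = 1 + l 1" using spos_Suc[of 1] spos_1 by simp
    moreover have "spos l (Suc 1) \<le> spos l (Suc i1)" by (rule spos_mono) (use i1r in simp)
    ultimately show "l 1 \<le> X" by (simp add: X_def)
    thus "1 \<le> X" using l_pos[of 1] len by simp
    show "X < D" using spos_less_diam[OF i1r] spos_ge[of "Suc i1"] by (simp add: X_def)
  qed
  \<comment> \<open>The right end of block \<open>i1\<close> is below \<open>M\<close>, hence below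
    it by \<open>2 * \<delta>\<close>, and \<open>x\<close> is no deeper than that: the threshold
    for growth.\<close>
  have gi1: "real k - (sqrt (gbet Gs i1) - sqrt (ggam Gs i1))\<^sup>2 \<le> x"
    using gap[of i1] i1r Ri1 x(2) unfolding M_def gR_def by simp
  have gam0: "0 < real (ggam Gs i1)" "real (ggam Gs i1) \<le> real (gbet Gs i1)"
    using delta_range(3)[OF i1r] asc by auto
  have uX: "u x X > 0" by (rule growing_prefix(1)[OF X(1) gam0 prefix_arrays[OF i1r] gi1]) (auto simp: X_def)
  have left: "\<bar>u x m\<bar> \<le> u x X" if m: "m \<le> X" for m
  proof -
    have "u x m \<le> u x X"
      by (rule growing_prefix_le[OF X(1) gam0 prefix_arrays[OF i1r] gi1 m]) (auto simp: X_def)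
    moreover have "u x m > 0"
      by (rule growing_prefix(1)[OF X(1) gam0 prefix_arrays[OF i1r] gi1 m]) (auto simp: X_def)
    ultimately show ?thesis by simp
  qed
  have ratio: "(1 + (z - x) / k) ^ X * u x X \<le> u z X"
    by (rule prefix_ratio[OF X(1) gam0 prefix_arrays[OF i1r] gi1 _ z(2)]) (use xk in \<open>auto simp: X_def\<close>)
  \<comment> \<open>\<open>i2\<close> is the first long block after the last one attaining
    \<open>M\<close>. If there is none, the final term takes its place; its position is
    \<open>D\<close>, so the claim about later indices is trivial.\<close>
  obtain i2 where i2: "e < i2" "i2 \<le> Suc g" "\<And>i. i \<in> S \<Longrightarrow> e < i \<Longrightarrow> i2 \<le> i"
    and right: "\<And>m. spos l i2 \<le> m \<Longrightarrow> m \<le> D \<Longrightarrow> \<bar>u x m\<bar> \<le> \<bar>u x (spos l i2)\<bar>"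
  proof (cases "{i \<in> S. e < i} = {}")
    case True
    show ?thesis
      by (rule that[of "Suc g"]) (use True eg in \<open>auto simp: diam_eq\<close>)
  next
    case False
    define j where "j = Min {i \<in> S. e < i}"
    have "j \<in> {i \<in> S. e < i}" unfolding j_def using finS False by (intro Min_in) auto
    hence j: "j \<in> S" "e < j" by auto
    have jmin: "j \<le> i" if "i \<in> S" "e < i" for i unfolding j_def using finS that by (intro Min_le) auto
    have jr: "1 \<le> j" "j \<le> g" using j S(1) by auto
    have Rj: "gR k Gs j < M" using low[of j] e(2)[of j] j by fastforce
    have desc: "gbet Gs j \<le> ggam Gs j"
      using gR_descending[of e j] j jr eg Rj e(1) by (auto simp: G_def)
    have gj: "real k - (sqrt (ggam Gs j) - sqrt (gbet Gs j))\<^sup>2 \<le> x"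
      using gap[of j] jr Rj x(2) unfolding M_def gR_def by (simp add: power2_commute)
    have bet0: "0 < real (gbet Gs j)" "real (gbet Gs j) \<le> real (ggam Gs j)"
      using delta_range(1)[OF jr] desc by auto
    have Yr: "1 \<le> spos l j" "spos l j \<le> D"
      using spos_ge[of j] spos_mono[of j "Suc g"] jr by (auto simp: diam_eq)
    show ?thesis
    proof (rule that[of j])
      show "\<bar>u x m\<bar> \<le> \<bar>u x (spos l j)\<bar>" if "spos l j \<le> m" "m \<le> D" for m
        by (rule decaying_suffix[OF x(1) Yr bet0 suffix_arrays[OF jr] gj that])
    qed (use j jr jmin in auto)
  qed
  have block: "N x m \<le> \<Phi> * N x (spos l i - 1)"
    if i: "i1 < i" "i < i2" and m: "spos l i - 1 \<le> m" "m \<le> spos l (Suc i) - 1" for i m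
  proof -
    have ir: "1 \<le> i" "i \<le> g" using i i1r i2 by auto
    show ?thesis
    proof (cases "i \<in> S")
      case False
      have "N x m \<le> B ^ n * N x (spos l i - 1)"
        unfolding B_def using N_short_block[OF xk ir short m] False ir by auto
      also have "\<dots> \<le> \<Phi> * N x (spos l i - 1)"
      proof (rule mult_right_mono[OF _ N_nonneg])
        have "1 * B ^ n \<le> A * B ^ (n + 2)"
          using A1 B1 by (intro mult_mono power_increasing) auto
        thus "B ^ n \<le> \<Phi>" by (simp add: \<Phi>_def)
      qed
      finally show ?thesis .
    next
      case True
      have "i \<ge> f" using i1max[OF True] i by fastforce
      moreover have "i \<le> e" using i2(3)[OF True] i by fastforce
      \<comment> \<open>A long block below \<open>M\<close> between two that attain \<open>M\<close>
        would have \<open>\<gamma> \<le> \<beta>\<close> and \<open>\<beta> \<le> \<gamma>\<close>,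
        so its right end would be \<open>k\<close>, which is at least \<open>M\<close>.\<close>
      ultimately have "gR k Gs i = M"
      proof (cases "i \<in> G")
        case False
        hence R: "gR k Gs i < M" using low True by blast
        have fi: "f < i" "i < e" using \<open>i \<ge> f\<close> \<open>i \<le> e\<close> f(1) e(1) False by (metis le_neq_implies_less)+
        have "ggam Gs i \<le> gbet Gs i"
          using gR_ascending[of i e] fi ir eg R e(1) by (auto simp: G_def)
        moreover have "gbet Gs i \<le> ggam Gs i"
          using gR_descending[of f i] fi ir eg R f(1) by (auto simp: G_def)
        ultimately have "gR k Gs i = k" by (simp add: gR_def)
        moreover have "M \<le> k" by (simp add: M_def gR_def)
        ultimately show ?thesis using R by simp
      qed (simp add: G_def)
      hence "N x m \<le> A * B\<^sup>2 * N x (spos l i - 1)"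
        using N_guide_block[OF xk ir \<delta> _ _ m] x unfolding A_def B_def M_def by simp
      also have "\<dots> \<le> \<Phi> * N x (spos l i - 1)"
        unfolding \<Phi>_def using A1 B1
        by (intro mult_right_mono[OF _ N_nonneg] mult_left_mono power_increasing) auto
      finally show ?thesis .
    qed
  qed
  have i12: "Suc i1 \<le> i2" using i1(2) f(2)[OF e(1)] i2(1) by simp
  have chain: "\<forall>m. X \<le> m \<longrightarrow> m \<le> spos l i - 1 \<longrightarrow> N x m \<le> \<Phi> ^ (i - Suc i1) * N x X"
    if "Suc i1 \<le> i" "i \<le> i2" for i
    using that
  proof (induction i rule: dec_induct)
    case base
    show ?case by (auto simp: X_def dest: le_antisym)
  next
    case (step i)
    show ?case
    proof (intro allI impI)
      fix m assume m: "X \<le> m" "m \<le> spos l (Suc i) - 1"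
      have IH: "\<forall>m. X \<le> m \<longrightarrow> m \<le> spos l i - 1 \<longrightarrow> N x m \<le> \<Phi> ^ (i - Suc i1) * N x X"
        using step by simp
      have ex: "Suc i - Suc i1 = Suc (i - Suc i1)" using step by simp
      show "N x m \<le> \<Phi> ^ (Suc i - Suc i1) * N x X"
      proof (cases "m \<le> spos l i - 1")
        case True
        hence "N x m \<le> \<Phi> ^ (i - Suc i1) * N x X" using IH m by blast
        also have "\<dots> \<le> \<Phi> ^ (Suc i - Suc i1) * N x X"
          using Phi1 by (intro mult_right_mono[OF _ N_nonneg] power_increasing) auto
        finally show ?thesis .
      next
        case False
        have "X \<le> spos l i - 1" unfolding X_def using spos_mono[of "Suc i1" i] step by simp
        hence "N x (spos l i - 1) \<le> \<Phi> ^ (i - Suc i1) * N x X" using IH by blast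
        hence "\<Phi> * N x (spos l i - 1) \<le> \<Phi> * (\<Phi> ^ (i - Suc i1) * N x X)"
          using Phi1 by (intro mult_left_mono) auto
        moreover have "N x m \<le> \<Phi> * N x (spos l i - 1)"
          by (rule block) (use step m False in auto)
        ultimately show ?thesis unfolding ex by (simp add: mult.assoc)
      qed
    qed
  qed
  \<comment> \<open>One factor \<open>\<Phi>\<close> for each block strictly between
    \<open>i1\<close> and \<open>i2\<close>, at most \<open>g\<close> of them, and
    \<open>2 * B\<close> for passing from \<open>u\<close> at \<open>X\<close> to two consecutive
    values.\<close>
  define Q where "Q = 2 * B * \<Phi> ^ g"
  have Phg: "\<Phi> ^ g \<ge> 1" using Phi1 by (rule one_le_power)
  have Q1: "Q \<ge> 1"
  proof -
    have "1 * 1 \<le> 2 * B * \<Phi> ^ g" using B1 Phg by (intro mult_mono) auto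
    thus ?thesis by (simp add: Q_def)
  qed
  have NX: "N x X \<le> 2 * B * u x X"
  proof -
    have "N x X \<le> B * N x (X - 1)" using N_step[OF xk, of "X - 1"] X by (simp add: B_def)
    also have "N x (X - 1) \<le> 2 * u x X" using left[of "X - 1"] left[of X] X by (simp add: N_def)
    finally show ?thesis using B1 by simp
  qed
  have NQ: "N x m \<le> Q * u x X" if "X \<le> m" "m \<le> spos l i2 - 1" for m
  proof -
    have "N x m \<le> \<Phi> ^ (i2 - Suc i1) * N x X" using chain[OF i12 order_refl] that by blast
    also have "\<dots> \<le> \<Phi> ^ g * N x X"
      using Phi1 i2(2) by (intro mult_right_mono[OF _ N_nonneg] power_increasing) auto
    also have "\<dots> \<le> \<Phi> ^ g * (2 * B * u x X)" using NX Phg by (intro mult_left_mono) auto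
    finally show ?thesis by (simp add: Q_def mult_ac)
  qed
  have XY: "X \<le> spos l i2 - 1" unfolding X_def using spos_mono[OF i12] by simp
  have uQ: "\<bar>u x m\<bar> \<le> Q * u x X" if m: "m \<le> D" for m
  proof -
    have Y: "\<bar>u x (spos l i2)\<bar> \<le> Q * u x X"
    proof -
      have "\<bar>u x (spos l i2)\<bar> \<le> N x (spos l i2 - 1)" using spos_ge[of i2] by (simp add: N_def)
      also have "\<dots> \<le> Q * u x X" using NQ XY by simp
      finally show ?thesis .
    qed
    consider "m \<le> X" | "X \<le> m" "m \<le> spos l i2 - 1" | "spos l i2 \<le> m" by linarith
    thus ?thesis
    proof cases
      case 1
      have "u x X \<le> Q * u x X" using mult_right_mono[OF Q1, of "u x X"] uX by simp
      thus ?thesis using left[OF 1] by simp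
    next
      case 2
      have "\<bar>u x m\<bar> \<le> N x m" by (simp add: N_def)
      thus ?thesis using NQ[OF 2] by simp
    next
      case 3
      thus ?thesis using right[OF 3 m] Y by simp
    qed
  qed
  have "K x \<le> (\<Sum>m\<le>D. (Q * u x X)\<^sup>2)"
    unfolding jK_def
  proof (rule sum_mono)
    fix m assume "m \<in> {..D}"
    hence "\<bar>u x m\<bar> \<le> \<bar>Q * u x X\<bar>" using uQ[of m] by simp
    thus "(u x m)\<^sup>2 \<le> (Q * u x X)\<^sup>2" by (simp only: abs_le_square_iff)
  qed
  hence up: "K x \<le> real (D + 1) * Q\<^sup>2 * (u x X)\<^sup>2" by (simp add: power_mult_distrib mult.assoc)
  have "(1 + (z - x) / k) ^ (2 * l 1) \<le> (1 + (z - x) / k) ^ (2 * X)"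
    using X z k1 by (intro power_increasing) auto
  hence "(1 + (z - x) / k) ^ (2 * l 1) * (u x X)\<^sup>2 \<le> (1 + (z - x) / k) ^ (2 * X) * (u x X)\<^sup>2"
    by (intro mult_right_mono) auto
  also have "\<dots> = ((1 + (z - x) / k) ^ X * u x X)\<^sup>2"
    by (simp add: power_mult_distrib power_mult[symmetric] mult.commute)
  also have "\<dots> \<le> (u z X)\<^sup>2"
    using ratio uX z k1 by (intro power_mono) auto
  also have "\<dots> \<le> K z" unfolding jK_def using X by (intro member_le_sum) auto
  also have "\<dots> \<le> real (D + 1) * Q\<^sup>2 * (u x X)\<^sup>2" using up Kxz by simp
  finally have "(1 + (z - x) / k) ^ (2 * l 1) \<le> real (D + 1) * Q\<^sup>2"
    using uX by (simp only: mult_le_cancel_right_pos zero_less_power)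
  thus ?thesis unfolding Q_def \<Phi>_def A_def B_def .
qed

end

section \<open>The bound on the head\<close>

context block_sequence
begin

text \<open>\<open>card_spec_near\<close> with \<open>\<theta>\<close> at the midpoint of the
  interval and \<open>\<delta> / 2\<close> as radius, so that the neighbourhood is the whole
  interval.\<close>

lemma card_spec_window:
  assumes i: "1 \<le> i" "i \<le> g" and \<delta>: "0 < \<delta>" "\<delta> \<le> 1 / 2"
    and n: "real n * (\<delta> / (2 * k)) * (\<delta> / 2)\<^sup>2 \<ge> 12 * (real k)\<^sup>2"
  shows "l i div (2 * n + 2) \<le> 2 * card {x \<in> spec D. gR k Gs i - 2 * \<delta> \<le> x \<and> x \<le> gR k Gs i - \<delta>}"
proof -
  let ?\<sigma> = "sqrt (real (gbet Gs i) * real (ggam Gs i))"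
  obtain \<xi> where \<xi>: "gR k Gs i - 3 / 2 * \<delta> = galp Gs i + \<xi> * ?\<sigma>" "0 \<le> \<xi>" "\<xi> \<le> 2 - 2 * (\<delta> / (2 * k))"
    "?\<sigma> \<ge> 1" "?\<sigma> \<le> k"
    using guide_parameters[OF i \<delta>, of "gR k Gs i - 3 / 2 * \<delta>"] \<delta>(1) by auto
  have "?\<sigma>\<^sup>2 \<le> (real k)\<^sup>2" using \<xi>(4,5) by (intro power_mono) auto
  hence n': "12 * ?\<sigma>\<^sup>2 \<le> real n * (\<delta> / (2 * k)) * (\<delta> / 2)\<^sup>2" using n by linarith
  have end_i: "spos l (Suc i) = spos l i + l i" by (rule spos_Suc[OF i(1)])
  have "l i div (2 * n + 2) \<le> 2 * card {x \<in> spec D. \<bar>x - (gR k Gs i - 3 / 2 * \<delta>)\<bar> \<le> \<delta> / 2}"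
  proof (rule card_spec_near[where p = "spos l i" and q = "spos l (Suc i) - 1" and \<alpha> = "galp Gs i" and \<sigma> = ?\<sigma>
        and \<xi> = \<xi> and \<omega> = "\<delta> / (2 * k)" and n = n])
    show "aT Gs l m = galp Gs i" if "spos l i \<le> m" "m \<le> spos l (Suc i) - 1" for m
      using arrays_eq(2)[of i m] i that spos_ge[of "Suc i"] by simp
    show "off m = ?\<sigma>" if "spos l i \<le> m" "m < spos l (Suc i) - 1" for m
      using off_in_block[of i m] i that by simp
    show "spos l (Suc i) - 1 \<le> D" using spos_less_diam[OF i] by simp
    have "l i div (2 * n + 2) * (2 * n + 2) \<le> l i" by (rule div_times_less_eq_dividend)
    thus "spos l i + l i div (2 * n + 2) * (2 * n + 2) \<le> spos l (Suc i) - 1 + 1"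
      using end_i spos_ge[of "Suc i"] by simp
    show "\<delta> / (2 * k) \<le> 1" "\<delta> / (2 * k) > 0" using \<delta> k_ge_1 by (auto simp: field_simps)
  qed (use \<xi> n' \<delta> in auto)
  also have "{x \<in> spec D. \<bar>x - (gR k Gs i - 3 / 2 * \<delta>)\<bar> \<le> \<delta> / 2}
     = {x \<in> spec D. gR k Gs i - 2 * \<delta> \<le> x \<and> x \<le> gR k Gs i - \<delta>}"
  proof (intro Collect_cong conj_cong refl)
    show "\<bar>x - (gR k Gs i - 3 / 2 * \<delta>)\<bar> \<le> \<delta> / 2 \<longleftrightarrow> gR k Gs i - 2 * \<delta> \<le> x \<and> x \<le> gR k Gs i - \<delta>" for x
      by linarith
  qed
  finally show ?thesis .
qed

text \<open>\<open>\<beta>\<close> and \<open>\<gamma>\<close> lie between 1 and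
  \<open>k - lam - 1\<close>, so the distance of their roots is maximal only at the two corners.
  These are the head triple, excluded by distinctness, and the tail triple.\<close>

lemma gR_head_less:
  assumes i: "2 \<le> i" "i \<le> g" and nt: "gdelta Gs i \<noteq> (k - lam - 1, lam, 1)"
  shows "gR k Gs 1 < gR k Gs i"
proof -
  let ?n = "k - lam - 1"
  have i': "1 \<le> i" using i by simp
  note r = delta_range[OF i' i(2)]
  have nh: "gdelta Gs i \<noteq> (1, lam, ?n)"
  proof
    assume "gdelta Gs i = (1, lam, ?n)"
    hence "Gs ! (i - 1) = Gs ! 0" using delta_1 by (simp add: gdelta_def)
    moreover have "i - 1 < length Gs" "0 < length Gs" using i len by linarith+
    ultimately have "i - 1 = 0" using nth_eq_iff_index_eq[OF dist] by blast
    thus False using i by simp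
  qed
  have eq: "gdelta Gs i = (ggam Gs i, galp Gs i, gbet Gs i)"
    by (simp add: ggam_def galp_def gbet_def)
  define b c where "b = gbet Gs i" and "c = ggam Gs i"
  have bc: "1 \<le> b" "b \<le> ?n" "1 \<le> c" "c \<le> ?n" using r by (auto simp: b_def c_def)
  have ne: "\<not> (b = ?n \<and> c = 1)" "\<not> (c = ?n \<and> b = 1)"
    using nh nt r(5) lam unfolding eq b_def c_def by auto
  have aux: "(sqrt x - sqrt y)\<^sup>2 < (sqrt ?n - 1)\<^sup>2"
    if "y \<le> x" "x \<le> ?n" "1 \<le> y" "\<not> (x = ?n \<and> y = 1)" for x y :: nat
  proof -
    have "sqrt x - sqrt y < sqrt ?n - sqrt 1"
    proof (cases "x = ?n")
      case True
      hence "1 < y" using that by linarith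
      thus ?thesis using True by simp
    next
      case False
      hence "sqrt x < sqrt ?n" "sqrt 1 \<le> sqrt y" using that by simp_all
      thus ?thesis by linarith
    qed
    moreover have "0 \<le> sqrt x - sqrt y" using that by simp
    ultimately show ?thesis by (intro power_strict_mono) auto
  qed
  have "(sqrt b - sqrt c)\<^sup>2 < (sqrt ?n - 1)\<^sup>2"
  proof (cases "c \<le> b")
    case True
    thus ?thesis using aux[of c b] bc ne by simp
  next
    case False
    hence "(sqrt c - sqrt b)\<^sup>2 < (sqrt ?n - 1)\<^sup>2" using aux[of b c] bc ne by simp
    thus ?thesis by (simp only: power2_commute)
  qed
  thus ?thesis unfolding gR_def b_def c_def using delta_1 by (simp add: gbet_def ggam_def)
qed

text \<open>Turns the lower bound on \<open>D\<close> minus head and tail into mass of blocks that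
  are neither. By distinctness at most one block carries the tail triple, and its positions are
  counted by \<open>tail\<close>; the 1 is the final term.\<close>

lemma diam_le_middle:
  "D \<le> l 1 + tail k lam Gs l + 1 + (\<Sum>i | 2 \<le> i \<and> i \<le> g \<and> gdelta Gs i \<noteq> (k - lam - 1, lam, 1). l i)"
proof -
  let ?t = "(k - lam - 1, lam, 1 :: nat)"
  let ?M = "{i. 2 \<le> i \<and> i \<le> g \<and> gdelta Gs i \<noteq> ?t}" and ?T = "{i. 2 \<le> i \<and> i \<le> g \<and> gdelta Gs i = ?t}"
  have finM: "finite ?M" "finite ?T" by (auto intro: finite_subset[of _ "{..g}"])
  have "D = 1 + (\<Sum>j\<in>{1..g}. l j)"
    unfolding diam_eq spos_def by (simp add: atLeastLessThanSuc_atLeastAtMost)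
  also have "{1..g} = insert 1 (?M \<union> ?T)" using g_ge by auto
  also have "(\<Sum>j\<in>insert 1 (?M \<union> ?T). l j) = l 1 + (\<Sum>j\<in>?M \<union> ?T. l j)"
    using finM by (subst sum.insert) auto
  also have "(\<Sum>j\<in>?M \<union> ?T. l j) = (\<Sum>j\<in>?M. l j) + (\<Sum>j\<in>?T. l j)"
    using finM by (intro sum.union_disjoint) auto
  also have "(\<Sum>j\<in>?T. l j) \<le> tail k lam Gs l"
  proof (cases "?T = {}")
    case True
    show ?thesis unfolding True by simp
  next
    case False
    then obtain j where j: "2 \<le> j" "j \<le> g" "gdelta Gs j = ?t" by auto
    have "?T = {j}"
    proof -
      have uniq: "i = j" if "2 \<le> i" "i \<le> g" "gdelta Gs i = ?t" for i
      proof -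
        have "i - 1 < length Gs" "j - 1 < length Gs" using that j len by linarith+
        moreover have "Gs ! (i - 1) = Gs ! (j - 1)" using that j by (simp add: gdelta_def)
        ultimately have "i - 1 = j - 1" using nth_eq_iff_index_eq[OF dist] by blast
        thus ?thesis using that j by linarith
      qed
      show ?thesis
      proof (intro equalityI subsetI)
        fix i assume "i \<in> ?T"
        thus "i \<in> {j}" using uniq[of i] by blast
      next
        fix i assume "i \<in> {j}"
        thus "i \<in> ?T" using j by blast
      qed
    qed
    hence "(\<Sum>j\<in>?T. l j) = card {spos l j..<spos l (Suc j)}" using spos_Suc[of j] j by simp
    also have "\<dots> \<le> tail k lam Gs l"
      unfolding tail_def
    proof (intro card_mono subsetI)
      show "finite {i. head l < i \<and> i \<le> D \<and> tri Gs l i = ?t}" by (auto intro: finite_subset[of _ "{..D}"])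
      fix m assume m: "m \<in> {spos l j..<spos l (Suc j)}"
      have "spos l (Suc 1) \<le> spos l j" by (rule spos_mono) (use j in simp)
      hence "head l < m" using m spos_Suc[of 1] spos_1 by (simp add: head_def)
      moreover have "m \<le> D" using m spos_less_diam[of j] j by simp
      moreover have "tri Gs l m = ?t" using tri_eq[of j m] j m by simp
      ultimately show "m \<in> {i. head l < i \<and> i \<le> D \<and> tri Gs l i = ?t}" by simp
    qed
    finally show ?thesis .
  qed
  finally show ?thesis by simp
qed

end

section \<open>Choice of scales and constants\<close>

lemma exists_gap:
  fixes R :: "nat \<Rightarrow> real"
  shows "\<exists>\<delta>. 0 < \<delta> \<and> \<delta> \<le> 1 / 2 \<and> (\<forall>i\<in>{1..g}. \<forall>j\<in>{1..g}. R i < R j \<longrightarrow> R i \<le> R j - 2 * \<delta>)"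
proof -
  \<comment> \<open>The element 1 keeps \<open>V\<close> nonempty when all right ends agree and
    forces \<open>\<delta> \<le> 1 / 2\<close>.\<close>
  define V where "V = insert 1 ((\<lambda>(i, j). R j - R i) ` {(i, j) \<in> {1..g} \<times> {1..g}. R i < R j})"
  have "finite {(i, j) \<in> {1..g} \<times> {1..g}. R i < R j}"
    by (rule finite_subset[of _ "{1..g} \<times> {1..g}"]) auto
  hence fin: "finite V" unfolding V_def by (intro finite.insertI finite_imageI)
  have pos: "v > 0" if "v \<in> V" for v using that unfolding V_def by auto
  have "Min V \<in> V" using fin by (rule Min_in) (simp add: V_def)
  hence 0: "Min V > 0" by (rule pos)
  have 1: "Min V \<le> 1" using fin by (rule Min_le) (simp add: V_def)
  have "R i \<le> R j - 2 * (Min V / 2)" if "i \<in> {1..g}" "j \<in> {1..g}" "R i < R j" for i j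
  proof -
    have "R j - R i \<in> V"
      unfolding V_def by (intro insertI2 image_eqI[of _ _ "(i, j)"]) (use that in simp_all)
    hence "Min V \<le> R j - R i" by (rule Min_le[OF fin])
    thus ?thesis by simp
  qed
  with 0 1 show ?thesis by (intro exI[of _ "Min V / 2"] conjI ballI impI) simp_all
qed

text \<open>Bernoulli's inequality is applied to \<open>sqrt q\<close> and squared, which yields a
  quadratic lower bound for \<open>q ^ h\<close>.\<close>

lemma power_beats_linear:
  fixes q C c :: real
  assumes "q > 1" "C > 0" "c > 0"
  shows "\<exists>H. \<forall>h::nat. real h > H \<longrightarrow> (C * h + 1) * c < q ^ h"
proof -
  define t where "t = sqrt q - 1"
  have t: "t > 0" using assms by (simp add: t_def)
  show ?thesis
  proof (intro exI[of _ "(C + 1) * c / t\<^sup>2"] allI impI)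
    fix h :: nat assume h: "(C + 1) * c / t\<^sup>2 < h"
    have "0 < (C + 1) * c / t\<^sup>2" using assms t by simp
    hence h0: "h \<ge> 1" using h by (cases h) auto
    have "(C + 1) * c < h * t\<^sup>2" using h t by (simp add: field_simps)
    hence "h * ((C + 1) * c) < h * (h * t\<^sup>2)" using h0 by simp
    moreover have "(C * h + 1) * c \<le> h * ((C + 1) * c)"
    proof -
      have "(C * h + 1) * c \<le> (C * h + h) * c" using h0 assms by (intro mult_right_mono) auto
      thus ?thesis by (simp add: algebra_simps)
    qed
    moreover have "h * (h * t\<^sup>2) \<le> q ^ h"
    proof -
      have "h * t \<le> (1 + t) ^ h" using Bernoulli_inequality[of t h] t by (simp add: mult.commute)
      hence "(h * t)\<^sup>2 \<le> ((1 + t) ^ h)\<^sup>2" using t by (intro power_mono) auto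
      also have "\<dots> = ((sqrt q)\<^sup>2) ^ h"
        by (simp add: t_def power_mult[symmetric] mult.commute)
      also have "\<dots> = q ^ h" using assms by simp
      finally show ?thesis by (simp add: power2_eq_square mult_ac)
    qed
    ultimately show "(C * h + 1) * c < q ^ h" by linarith
  qed
qed

lemma alg_conj_sym: "alg_conj x y \<Longrightarrow> alg_conj y x"
  unfolding alg_conj_def by blast

text \<open>When every block is either long (at least \<open>\<mu>\<close> times the head) or negligible (at most \<open>\<nu>\<close> times
  the head), conjugate eigenvalues just below the top guide interval cluster so tightly that they are
  too few for the linear lower bound.\<close>

proposition head_bounded_at_scale:
  fixes C \<mu> :: real
  assumes lam: "lam + 2 \<le> k" and gr: "graphical k lam Gs" and C: "C > 0" and \<mu>: "0 < \<mu>" "\<mu> \<le> 1"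
  shows "\<exists>\<nu>>0. \<exists>H::real. \<forall>l. block_sequence k lam Gs l \<longrightarrow> propAC k Gs l \<longrightarrow> real (diam Gs l) \<le> C * real (l 1) \<longrightarrow>
    (\<forall>i\<in>{1..length Gs - 1}. \<mu> * real (l 1) \<le> real (l i) \<or> real (l i) \<le> \<nu> * real (l 1)) \<longrightarrow>
    (\<exists>i\<in>{1..length Gs - 1}. \<mu> * l 1 \<le> l i \<and> gR k Gs 1 < gR k Gs i) \<longrightarrow> real (l 1) \<le> H"
proof -
  define g where "g = length Gs - 1"
  note g_len = g_def
  have k2: "real k \<ge> 2" using lam by simp
  obtain \<delta> where \<delta>: "0 < \<delta>" "\<delta> \<le> 1 / 2"
    and gap: "\<And>i j. i \<in> {1..g} \<Longrightarrow> j \<in> {1..g} \<Longrightarrow> gR k Gs i < gR k Gs j \<Longrightarrow> gR k Gs i \<le> gR k Gs j - 2 * \<delta>"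
    using exists_gap[of g "gR k Gs"] by blast
  have dd: "\<delta> / (2 * k) * (\<delta> / 2)\<^sup>2 > 0" using \<delta> k2 by simp
  obtain n :: nat where "12 * (real k)\<^sup>2 / (\<delta> / (2 * k) * (\<delta> / 2)\<^sup>2) \<le> real n" using real_arch_simple by blast
  hence n: "12 * (real k)\<^sup>2 \<le> real n * (\<delta> / (2 * k)) * (\<delta> / 2)\<^sup>2"
    unfolding pos_divide_le_eq[OF dd] by (simp only: mult.assoc)
  define w where "w = real (2 * n + 2)"
  have w: "w > 0" by (simp add: w_def)
  \<comment> \<open>With \<open>T\<close> the eigenvalues in the interval, windows give
    \<open>\<mu> * h / w - 1 \<le> 2 * card T\<close>, clustering gives
    \<open>N * card T \<le> N * Z + 2 * (C * h + 1)\<close>. Together,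
    \<open>(N * \<mu> / w) * h \<le> 4 * C * h + 2 * N * Z + N + 4\<close>; \<open>N\<close> makes
    the left coefficient exceed \<open>4 * C\<close> by 1, so \<open>h\<close> is bounded by the
    constant terms.\<close>
  obtain N :: nat where "(4 * C + 1) * w / \<mu> \<le> real N" using real_arch_simple by blast
  hence N: "4 * C + 1 \<le> real N * \<mu> / w" using \<mu> w by (simp add: field_simps)
  define \<eta> where "\<eta> = 1 / (2 * real k) ^ (N\<^sup>2)"
  have eta: "\<eta> > 0" using k2 by (simp add: \<eta>_def)
  have "real k \<ge> 1" using k2 by simp
  from card_conjugate_cluster[OF this, of N]
  obtain Z :: nat where Z: "\<forall>(\<chi>::int poly) E T. lead_coeff \<chi> = 1 \<longrightarrow> finite E \<longrightarrow> card E = degree \<chi> \<longrightarrow>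
     (\<forall>x\<in>E. ipoly_real \<chi> x = 0 \<and> \<bar>x\<bar> \<le> real k) \<longrightarrow> T \<subseteq> E \<longrightarrow>
     (\<forall>x\<in>T. \<forall>y\<in>T. alg_conj x y \<longrightarrow> \<bar>x - y\<bar> \<le> \<eta>) \<longrightarrow> N * card T \<le> N * Z + 2 * degree \<chi>"
    unfolding \<eta>_def by (elim exE)
  define q where "q = 1 + \<eta> / k"
  have q: "q > 1" using eta k2 by (simp add: q_def)
  define A where "A = 2 / sqrt (\<delta> / real (2 * k))"
  define B where "B = real (2 * k + 1)"
  have A: "A > 0" using \<delta> k2 by (simp add: A_def)
  have B: "B > 1" using k2 by (simp add: B_def)
  \<comment> \<open>The part of the factor in \<open>K_separation\<close> that does not grow with
    the head.\<close>
  define c where "c = 4 * B\<^sup>2 * (A * B\<^sup>2) ^ (2 * g)"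
  have c: "c > 0" using A B by (simp add: c_def)
  \<comment> \<open>Eigenvalues at distance at least \<open>\<eta>\<close> separate by
    \<open>q ^ (2 * h)\<close>. This \<open>\<nu>\<close> lets short blocks consume at most
    \<open>q ^ h\<close> of it: \<open>B ^ (2 * g * n0) \<le> q ^ h\<close> whenever
    \<open>n0 \<le> \<nu> * h\<close>. The other \<open>q ^ h\<close> beats the linear term.\<close>
  define \<nu> where "\<nu> = ln q / (2 * (real g + 1) * ln B)"
  have nu: "\<nu> > 0" using q B by (simp add: \<nu>_def)
  obtain H1 where H1: "\<And>h::nat. real h > H1 \<Longrightarrow> (C * h + 1) * c < q ^ h"
    using power_beats_linear[OF q C c] by blast
  show ?thesis
  proof (rule exI[of _ \<nu>], rule conjI[OF nu], rule exI[of _ "max H1 (2 * N * Z + N + 4)"], intro allI impI)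
    fix l
    assume bs: "block_sequence k lam Gs l" and AC: "propAC k Gs l"
      and DC: "real (diam Gs l) \<le> C * real (l 1)"
      and scale: "\<forall>i\<in>{1..length Gs - 1}. \<mu> * l 1 \<le> l i \<or> l i \<le> \<nu> * l 1"
      and mid: "\<exists>i\<in>{1..length Gs - 1}. \<mu> * l 1 \<le> l i \<and> gR k Gs 1 < gR k Gs i"
    interpret block_sequence k lam Gs l by (rule bs)
    have gg: "block_sequence.g Gs = g" using len by (simp add: g_len)
    define h where "h = l 1"
    define S where "S = {i \<in> {1..g}. \<mu> * h \<le> l i}"
    have finS: "finite S" by (simp add: S_def)
    have S1: "1 \<in> S" using g_ge \<mu> mult_right_mono[of \<mu> 1 "real h"] unfolding gg by (simp add: S_def h_def)
    have "Max (gR k Gs ` S) \<in> gR k Gs ` S" using finS S1 by (intro Max_in) auto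
    then obtain i0 where i0: "Max (gR k Gs ` S) = gR k Gs i0" "i0 \<in> S" by (rule imageE)
    have top: "gR k Gs i \<le> gR k Gs i0" if "i \<in> S" for i
      unfolding i0(1)[symmetric] using finS that by simp
    have top1: "gR k Gs 1 < gR k Gs i0"
    proof -
      obtain i where "i \<in> S" "gR k Gs 1 < gR k Gs i" using mid unfolding S_def h_def g_len by blast
      thus ?thesis using top[of i] by linarith
    qed
    have i0r: "1 \<le> i0" "i0 \<le> g" using i0(2) by (auto simp: S_def)
    define T where "T = {x \<in> spec D. gR k Gs i0 - 2 * \<delta> \<le> x \<and> x \<le> gR k Gs i0 - \<delta>}"
    have close: "y - x \<le> \<eta>" if xy: "x \<in> T" "y \<in> T" "x \<le> y" "alg_conj x y" and h1: "real h > H1" for x y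
    proof (rule ccontr)
      assume "\<not> y - x \<le> \<eta>"
      hence far: "\<eta> \<le> y - x" by simp
      define n0 where "n0 = nat \<lfloor>\<nu> * h\<rfloor>"
      have n0: "real n0 \<le> \<nu> * h" using nu unfolding n0_def by simp
      have "(1 + (y - x) / k) ^ (2 * l 1) \<le>
        real (D + 1) * (2 * real (2 * k + 1) * (2 / sqrt (\<delta> / real (2 * k)) * real (2 * k + 1) ^ (n0 + 2)) ^ block_sequence.g Gs)\<^sup>2"
      proof (rule K_separation[where S = S and ?i0.0 = i0])
        show "l i \<le> n0" if "i \<in> {1..block_sequence.g Gs} - S" for i
        proof -
          have "i \<in> {1..length Gs - 1}" "\<not> \<mu> * h \<le> l i"
            using that unfolding gg S_def g_len by auto
          hence "l i \<le> \<nu> * h" using scale unfolding h_def by blast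
          thus ?thesis unfolding n0_def by (rule le_nat_floor)
        qed
        show "K x = K y" using propAC_K[OF AC] xy unfolding T_def by blast
        show "S \<subseteq> {1..block_sequence.g Gs}" unfolding gg S_def by blast
        show "gR k Gs i \<le> gR k Gs i0 - 2 * \<delta>"
          if "i \<in> {1..block_sequence.g Gs}" "gR k Gs i < gR k Gs i0" for i
          using gap[of i i0] that i0r unfolding gg by simp
        show "x \<in> spec D" "gR k Gs i0 - 2 * \<delta> \<le> x" "x \<le> gR k Gs i0 - \<delta>" "y \<in> spec D"
          using xy unfolding T_def by blast+
      qed (fact S1 i0(2) top top1 \<delta> xy)+
      also have "\<dots> = real (D + 1) * (c * B ^ (2 * g * n0))"
      proof -
        have "A * B ^ (n0 + 2) = (A * B\<^sup>2) * B ^ n0" by (simp only: power_add mult_ac)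
        hence "(2 * B * (A * B ^ (n0 + 2)) ^ g)\<^sup>2 = 4 * B\<^sup>2 * ((A * B\<^sup>2) * B ^ n0) ^ (2 * g)"
          by (simp only: power_mult_distrib power_even_eq) simp
        also have "\<dots> = c * (B ^ n0) ^ (2 * g)"
          unfolding c_def power_mult_distrib[of "A * B\<^sup>2" "B ^ n0"] by (simp only: mult.assoc)
        also have "(B ^ n0) ^ (2 * g) = B ^ (2 * g * n0)"
          by (simp only: power_mult[symmetric] mult.commute[of n0])
        finally show ?thesis unfolding gg A_def B_def by (simp only:)
      qed
      also have "\<dots> \<le> (C * h + 1) * (c * q ^ h)"
      proof (intro mult_mono mult_left_mono)
        have "ln (B ^ (2 * g * n0)) = 2 * real g * real n0 * ln B" using B by (simp add: ln_realpow)
        also have "\<dots> \<le> (2 * (real g + 1) * ln B) * real n0" using B by (simp add: algebra_simps)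
        also have "\<dots> \<le> (2 * (real g + 1) * ln B) * (\<nu> * h)" using n0 B by (intro mult_left_mono) auto
        also have "\<dots> = h * ln q"
        proof -
          have "2 * (real g + 1) * ln B * \<nu> = ln q" using B by (simp add: \<nu>_def)
          hence "2 * (real g + 1) * ln B * \<nu> * h = ln q * h" by (simp only:)
          thus ?thesis by (simp only: mult_ac)
        qed
        also have "\<dots> = ln (q ^ h)" using q by (simp add: ln_realpow)
        finally show "B ^ (2 * g * n0) \<le> q ^ h" using B q by (subst (asm) ln_le_cancel_iff) auto
      qed (use DC c C q B in \<open>auto simp: h_def\<close>)
      finally have "(1 + (y - x) / k) ^ (2 * h) \<le> ((C * h + 1) * c) * q ^ h"
        by (simp add: h_def mult_ac)
      moreover have "q ^ (2 * h) \<le> (1 + (y - x) / k) ^ (2 * h)"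
        using far q k2 unfolding q_def by (intro power_mono) (auto simp: divide_right_mono)
      ultimately have "q ^ h * q ^ h \<le> ((C * h + 1) * c) * q ^ h"
        by (simp add: mult_2 power_add)
      hence "q ^ h \<le> (C * h + 1) * c" using q by (simp only: mult_le_cancel_right_pos zero_less_power)
      thus False using H1[OF h1] by simp
    qed
    show "real (l 1) \<le> max H1 (2 * N * Z + N + 4)"
    proof (cases "real h > H1")
      case False
      thus ?thesis by (simp add: h_def)
    next
      case True
      have "N * card T \<le> N * Z + 2 * degree chi"
      proof (rule Z[THEN spec[of _ chi], THEN spec[of _ "spec D"], THEN spec[of _ T],
            THEN mp, THEN mp, THEN mp, THEN mp, THEN mp, THEN mp])
        show "\<forall>x\<in>T. \<forall>y\<in>T. alg_conj x y \<longrightarrow> \<bar>x - y\<bar> \<le> \<eta>"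
        proof (intro ballI impI)
          fix x y assume "x \<in> T" "y \<in> T" "alg_conj x y"
          thus "\<bar>x - y\<bar> \<le> \<eta>"
            using close[OF _ _ _ _ True, of x y] close[OF _ _ _ _ True, of y x] alg_conj_sym[of x y]
            by (cases "x \<le> y") auto
        qed
        show "\<forall>x\<in>spec D. ipoly_real chi x = 0 \<and> \<bar>x\<bar> \<le> real k" using chi_root spec_abs_le by blast
      qed (use chi_monic card_spec finite_spec in \<open>auto simp: T_def\<close>)
      hence 1: "real N * card T \<le> real N * Z + 2 * (C * h + 1)"
      proof -
        have "real (N * card T) \<le> real (N * Z + 2 * degree chi)"
          using \<open>N * card T \<le> N * Z + 2 * degree chi\<close> by (simp only: of_nat_le_iff)
        thus ?thesis using DC by (simp add: chi_monic(2) h_def)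
      qed
      have 2: "\<mu> * h / w - 1 \<le> 2 * card T"
      proof -
        have "l i0 div (2 * n + 2) \<le> 2 * card T"
          unfolding T_def by (rule card_spec_window) (use i0r \<delta> n gg in auto)
        hence "real (l i0 div (2 * n + 2)) \<le> 2 * real (card T)" by linarith
        moreover have "real (l i0) / w - 1 \<le> real (l i0 div (2 * n + 2))"
        proof -
          have "real (l i0) < real (2 * n + 2 + l i0 div (2 * n + 2) * (2 * n + 2))"
            unfolding of_nat_less_iff by (rule dividend_less_div_times) simp
          hence "real (l i0) \<le> (1 + real (l i0 div (2 * n + 2))) * w"
            unfolding w_def of_nat_add of_nat_mult by (simp add: algebra_simps)
          thus ?thesis using w by (simp add: pos_divide_le_eq[symmetric])
        qed
        moreover have "\<mu> * h / w \<le> real (l i0) / w"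
          using i0(2) w unfolding S_def by (intro divide_right_mono) auto
        ultimately show ?thesis by linarith
      qed
      have "real N * (\<mu> * h / w - 1) \<le> real N * (2 * card T)"
        using 2 by (intro mult_left_mono) auto
      also have "\<dots> \<le> 2 * (real N * Z + 2 * (C * h + 1))" using 1 by simp
      finally have "(real N * \<mu> / w) * h \<le> 2 * real N * Z + 4 * C * h + 4 + N"
        by (simp add: algebra_simps)
      moreover have "(4 * C + 1) * h \<le> (real N * \<mu> / w) * h" using N by (intro mult_right_mono) auto
      ultimately have "real h \<le> 2 * real N * Z + N + 4" by (simp add: algebra_simps)
      thus ?thesis by (simp add: h_def)
    qed
  qed
qed

text \<open>Pigeonhole: the open intervals from \<open>m (Suc j)\<close> to \<open>m j\<close> for
  \<open>j \<le> G\<close> are disjoint and number \<open>G + 1\<close>, so at most \<open>G\<close>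
  values cannot meet them all.\<close>

lemma scale_gap:
  fixes m r :: "nat \<Rightarrow> real"
  assumes m: "\<And>j. m (Suc j) \<le> m j" and I: "finite I" "card I \<le> G"
  shows "\<exists>j\<le>G. \<forall>i\<in>I. m j \<le> r i \<or> r i \<le> m (Suc j)"
proof (rule ccontr)
  assume "\<not> ?thesis"
  hence "\<forall>j\<in>{..G}. \<exists>i\<in>I. m (Suc j) < r i \<and> r i < m j" by (meson atMost_iff not_le)
  then obtain f where f: "\<And>j. j \<le> G \<Longrightarrow> f j \<in> I \<and> m (Suc j) < r (f j) \<and> r (f j) < m j"
    by (metis atMost_iff)
  have dec: "m j \<le> m i" if "i \<le> j" for i j using lift_Suc_antimono_le[of m] m that by blast
  have "f i \<noteq> f j" if "i < j" "j \<le> G" for i j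
    using f[of i] f[of j] dec[of "Suc i" j] that by fastforce
  hence "inj_on f {..G}" by (intro linorder_inj_onI) auto
  hence "card {..G} \<le> card I" using f I(1) by (intro card_inj_on_le) auto
  thus False using I(2) by simp
qed

theorem theorem4p2:
  fixes k lam :: nat and Gs :: "(nat \<times> nat \<times> nat) list" and Is :: "nat set"
    and L :: "nat \<Rightarrow> nat"
  assumes "k \<ge> 3" and "lam + 2 \<le> k"
    and "graphical k lam Gs"
    and "Is \<subseteq> {1..length Gs - 1}" and "1 \<in> Is"
    and "\<forall>i\<in>{1..length Gs} - Is. L i \<ge> 1"
  shows "\<exists>F :: real. F > 0 \<and>
    (\<forall>(\<epsilon>::real) (C::real). \<epsilon> > 0 \<longrightarrow> C > 0 \<longrightarrow>
      (\<exists>H :: real. H > 0 \<and>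
        (\<forall>l :: nat \<Rightarrow> nat.
           quadruple k lam Gs Is L l \<and>
           propAC k Gs l \<and>
           real (diam Gs l) \<le> C * real (head l) \<and>
           real (diam Gs l) - real (head l + tail k lam Gs l) > \<epsilon> * real (head l) \<and>
           (\<forall>p\<in>Is. real (l p) > F)
           \<longrightarrow> real (head l) \<le> H)))"
proof (rule exI[of _ 1], intro conjI allI impI)
  fix \<epsilon> C :: real assume \<epsilon>: "\<epsilon> > 0" and C: "C > 0"
  define g where "g = length Gs - 1"
  note g_len = g_def
  define P where "P \<mu> \<nu> H \<longleftrightarrow> (\<forall>l. block_sequence k lam Gs l \<longrightarrow> propAC k Gs l \<longrightarrow>
    real (diam Gs l) \<le> C * real (l 1) \<longrightarrow>
    (\<forall>i\<in>{1..length Gs - 1}. \<mu> * real (l 1) \<le> real (l i) \<or> real (l i) \<le> \<nu> * real (l 1)) \<longrightarrow>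
    (\<exists>i\<in>{1..length Gs - 1}. \<mu> * l 1 \<le> l i \<and> gR k Gs 1 < gR k Gs i) \<longrightarrow> real (l 1) \<le> H)" for \<mu> \<nu> H
  have "\<exists>\<nu>>0. \<exists>H. P \<mu> \<nu> H" if "0 < \<mu>" "\<mu> \<le> 1" for \<mu>
    unfolding P_def by (rule head_bounded_at_scale[OF assms(2,3) C that])
  then obtain \<nu> H where \<nu>: "\<And>\<mu>. 0 < \<mu> \<Longrightarrow> \<mu> \<le> 1 \<Longrightarrow> \<nu> \<mu> > 0"
    and H: "\<And>\<mu>. 0 < \<mu> \<Longrightarrow> \<mu> \<le> 1 \<Longrightarrow> P \<mu> (\<nu> \<mu>) (H \<mu>)"
    by metis
  \<comment> \<open>Each threshold is at most the \<open>\<nu>\<close> belonging to the one before.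
    The start \<open>\<epsilon> / (2 * (g + 1))\<close> is small enough that at most
    \<open>g\<close> blocks below it cannot account for \<open>\<epsilon> * h\<close> indices
    outside head and tail.\<close>
  define m where "m = rec_nat (min 1 (\<epsilon> / (2 * (real g + 1)))) (\<lambda>_ y. min y (\<nu> y))"
  have m_0: "m 0 = min 1 (\<epsilon> / (2 * (real g + 1)))" and m_Suc: "m (Suc j) = min (m j) (\<nu> (m j))" for j
    by (simp_all add: m_def)
  have m: "0 < m j \<and> m j \<le> m 0 \<and> m j \<le> 1" for j
  proof (induction j)
    case 0
    show ?case using \<epsilon> by (simp add: m_0)
  next
    case (Suc j)
    thus ?case using \<nu>[of "m j"] by (auto simp: m_Suc)
  qed
  \<comment> \<open>Only the scales \<open>0..g\<close> can be selected, so a finite maximum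
    suffices; \<open>2 / \<epsilon>\<close> covers heads too small to absorb the extra 1 of
    \<open>diam_le_middle\<close>.\<close>
  define H' where "H' = Max (insert (2 / \<epsilon>) ((\<lambda>j. H (m j)) ` {..g}))"
  have H': "v \<le> H'" if "v \<in> insert (2 / \<epsilon>) ((\<lambda>j. H (m j)) ` {..g})" for v
    unfolding H'_def by (rule Max_ge[OF _ that]) simp
  show "\<exists>H. H > 0 \<and> (\<forall>l. quadruple k lam Gs Is L l \<and> propAC k Gs l \<and>
           real (diam Gs l) \<le> C * real (head l) \<and>
           real (diam Gs l) - real (head l + tail k lam Gs l) > \<epsilon> * real (head l) \<and>
           (\<forall>p\<in>Is. real (l p) > 1) \<longrightarrow> real (head l) \<le> H)"
  proof (rule exI[of _ H'], intro conjI allI impI)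
    show "H' > 0" using H'[of "2 / \<epsilon>"] \<epsilon> by (auto intro: less_le_trans[of 0 "2 / \<epsilon>"])
    fix l
    assume l: "quadruple k lam Gs Is L l \<and> propAC k Gs l \<and>
           real (diam Gs l) \<le> C * real (head l) \<and>
           real (diam Gs l) - real (head l + tail k lam Gs l) > \<epsilon> * real (head l) \<and>
           (\<forall>p\<in>Is. real (l p) > 1)"
    have "quadruple k lam Gs Is L l" and AC: "propAC k Gs l" and DC: "real (diam Gs l) \<le> C * real (l 1)"
      and DT: "real (diam Gs l) - real (l 1 + tail k lam Gs l) > \<epsilon> * real (l 1)"
      using l unfolding head_def by blast+
    hence "\<forall>i\<in>{1..length Gs}. l i \<ge> 1" "l (length Gs) = 1"
      unfolding quadruple_def by blast+
    hence bs: "block_sequence k lam Gs l"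
      by unfold_locales (use assms(2,3) in simp_all)
    interpret block_sequence k lam Gs l by (rule bs)
    have gg: "block_sequence.g Gs = g" using len by (simp add: g_len)
    show "real (head l) \<le> H'"
    proof (cases "real (head l) \<le> 2 / \<epsilon>")
      case True
      thus ?thesis using H'[of "2 / \<epsilon>"] by simp
    next
      case False
      define h where "h = l 1"
      have h0: "2 < \<epsilon> * h" using False \<epsilon> by (simp add: h_def head_def field_simps)
      have hpos: "real h > 0" using h0 \<epsilon> by (cases h) auto
      let ?M = "{i. 2 \<le> i \<and> i \<le> g \<and> gdelta Gs i \<noteq> (k - lam - 1, lam, 1)}"
      \<comment> \<open>Otherwise the middle blocks sum to at most
        \<open>\<epsilon> * h / 2\<close>, and adding \<open>1 < \<epsilon> * h / 2\<close>
        contradicts (iii).\<close>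
      have "\<exists>i\<in>?M. m 0 * h \<le> l i"
      proof (rule ccontr)
        assume "\<not> ?thesis"
        hence M0: "real (l i) \<le> m 0 * h" if "i \<in> ?M" for i
          using that by (meson less_imp_le not_le)
        define e where "e = \<epsilon> / (2 * (real g + 1)) * h"
        have e: "(real g + 1) * e = \<epsilon> * h / 2" "e \<ge> 0"
          using \<epsilon> by (simp_all add: e_def divide_simps)
        have "m 0 * h \<le> e"
          unfolding e_def by (intro mult_right_mono) (auto simp: m_0)
        hence le: "real (l i) \<le> e" if "i \<in> ?M" for i
          using M0[OF that] by linarith
        have "\<epsilon> * h < 1 + (\<Sum>i\<in>?M. real (l i))"
          using DT diam_le_middle unfolding gg h_def of_nat_sum[symmetric] by linarith
        moreover have "(\<Sum>i\<in>?M. real (l i)) \<le> real (card ?M) * e"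
          using sum_mono[of ?M "\<lambda>i. real (l i)" "\<lambda>_. e"] le by simp
        moreover have "real (card ?M) * e \<le> (real g + 1) * e"
        proof (rule mult_right_mono[OF _ e(2)])
          have "card ?M \<le> card {1..g}" by (rule card_mono) auto
          thus "real (card ?M) \<le> real g + 1" by simp
        qed
        ultimately have "\<epsilon> * h < 1 + \<epsilon> * h / 2" using e(1) by linarith
        thus False using h0 by linarith
      qed
      then obtain i where i: "i \<in> ?M" "m 0 * h \<le> l i" by blast
      have iR: "gR k Gs 1 < gR k Gs i" using gR_head_less[of i] i gg by auto
      \<comment> \<open>No block lies strictly between scales \<open>j + 1\<close> and
        \<open>j\<close>. As \<open>m (Suc j) \<le> \<nu> (m j)\<close>, this is the dichotomy
        needed for \<open>\<mu> = m j\<close>, and the middle block \<open>i\<close> remains long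
        since \<open>m j \<le> m 0\<close>.\<close>
      obtain j where j: "j \<le> g" "\<And>i. i \<in> {1..g} \<Longrightarrow> m j \<le> real (l i) / h \<or> real (l i) / h \<le> m (Suc j)"
      proof -
        have "m (Suc j) \<le> m j" for j by (simp add: m_Suc)
        from scale_gap[of m "{1..g}" g "\<lambda>i. real (l i) / h", OF this] show ?thesis using that by auto
      qed
      have "\<forall>i\<in>{1..length Gs - 1}. m j * real (l 1) \<le> real (l i) \<or> real (l i) \<le> \<nu> (m j) * real (l 1)"
      proof
        fix i assume "i \<in> {1..length Gs - 1}"
        hence "m j \<le> real (l i) / h \<or> real (l i) / h \<le> \<nu> (m j)"
          using j(2)[of i] by (auto simp: m_Suc g_len)
        thus "m j * real (l 1) \<le> real (l i) \<or> real (l i) \<le> \<nu> (m j) * real (l 1)"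
          using hpos by (simp add: h_def field_simps)
      qed
      moreover have "\<exists>i\<in>{1..length Gs - 1}. m j * real (l 1) \<le> real (l i) \<and> gR k Gs 1 < gR k Gs i"
      proof
        have "m j * h \<le> m 0 * h" using m[of j] by (intro mult_right_mono) auto
        thus "m j * real (l 1) \<le> real (l i) \<and> gR k Gs 1 < gR k Gs i"
          using i(2) iR by (simp add: h_def)
        show "i \<in> {1..length Gs - 1}" using i(1) by (auto simp: g_len)
      qed
      moreover have "P (m j) (\<nu> (m j)) (H (m j))" using H m by blast
      ultimately have "real (l 1) \<le> H (m j)"
        using bs AC DC unfolding P_def by blast
      thus ?thesis using H'[of "H (m j)"] j(1) by (force simp: head_def)
    qed
  qed
qed simp

end
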